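(* Let $n\ge1$ and let $I,J,K\subseteq\{0\}\cup[n-1]$. Let $c^{\emptyset}_{I,J,K}$ be the number of triples $(\pi_1,\pi_2,\pi_3)$ of signed permutations in $B_n$ such that $\mathrm{set}(\pi_1)=I$, $\mathrm{set}(\pi_2)=J$, $\mathrm{set}(\pi_3)=K$ and $\pi_1\pi_2\pi_3$ is the identity of $B_n$. Then $$c^{\emptyset}_{I,J,K}=\sum_{\lambda,\mu,\nu\in\mathcal{P}^0(n)}g^B(\lambda,\mu,\nu)\,d^B_{\lambda I}\,d^B_{\mu J}\,d^B_{\nu K}.$$
   Context: $[m]=\{1,\dots,m\}$. The hyperoctahedral group $B_n$ is the group of permutations $\pi$ of $\{-n,\dots,-1,0,1,\dots,n\}$ with $\pi(-i)=-\pi(i)$ for all $i$ (so $\pi(0)=0$). The descent set of $\pi\in B_n$ is $\mathrm{set}(\pi)=\{0\le i\le n-1\mid\pi(i)>\pi(i+1)\}$. For $\lambda\vdash 2n$, a standard domino tableau of shape $\lambda$ is a tiling of the Young diagram of $\lambda$ (English convention) by $n$ horizontal or vertical dominoes (pairs of adjacent boxes), labelled with $1,\dots,n$, each label used exactly once, such that the labels are non-decreasing along rows and down columns (equality occurring only within a single domino). $\mathcal{P}^0(n)$ is the set of partitions of $2n$ whose Young diagram can be tiled by dominoes (partitions with empty $2$-core). A standard domino tableau has a descent in position $i$, $1\le i\le n-1$, if the domino $i+1$ lies strictly below the domino $i$ (in strictly lower rows), and a descent in position $0$ if the domino labelled $1$ is vertical. For $\lambda\in\mathcal{P}^0(n)$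 and $I\subseteq\{0\}\cup[n-1]$, $d^B_{\lambda I}$ is the number of standard domino tableaux of shape $\lambda$ whose set of descents is $I$. $2$-quotient: each $\lambda\in\mathcal{P}^0(n)$ corresponds bijectively to a pair of partitions $(\lambda^-,\lambda^+)$ with $|\lambda^-|+|\lambda^+|=n$. In terms of tableaux: fill the boxes of $\lambda$ with alternating signs, the top leftmost box being '$-$' and adjacent boxes having opposite signs; in a domino tableau of shape $\lambda$, the dominoes whose top rightmost box has sign '$-$' (resp. '$+$') form the tableau of shape $\lambda^-$ (resp. $\lambda^+$). Explicitly: choose an even $m\ge\ell(\lambda)$ and let $\beta_i=\lambda_i+m-i$ for $1\le i\le m$ (with $\lambda_i=0$ for $i>\ell(\lambda)$). Exactly $m/2$ of the $\beta_i$ are even and $m/2$ are odd. Writing the even ones as $2e_1>2e_2>\cdots>2e_{m/2}$ and the odd ones as $2o_1+1>\cdots>2o_{m/2}+1$, one has $\lambda^-_k=e_k-(m/2-k)$ and $\lambda^+_k=o_k-(m/2-k)$. The irreducible characters of $B_n$ are indexed by $\mathcal{P}^0(n)$ as follows. Conjugacy classes of $B_n$ are indexed by $\mu\in\mathcal{P}^0(n)$ via the $2$-quotient $(\mu^-,\mu^+)$, where $\mu^+$ lists the lengths of the positive cycles (even number of sign changes) and $\mu^-$ those of the negative cycles (odd number of sign changes). Writing $\psi^\lambda_\mu$ for the value of $\psi^\lambda$ on the class $\mu$, the characters $\psi^\lambda$ are determined by $$\prod_i\bigl[p_{\mu^-_i}(U)-p_{\mu^-_i}(V)\bigr]\prod_i\bigl[p_{\mu^+_i}(U)+p_{\mu^+_i}(V)\bigr]=\sum_{\lambda\in\mathcal{P}^0(n)}\psi^\lambda_\mu\,s_{\lambda^-}(V)\,s_{\lambda^+}(U)$$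 for all $\mu\in\mathcal{P}^0(n)$, where $U,V$ are independent sets of indeterminates, $p_k$ are power sums and $s_\lambda$ Schur functions. The Kronecker coefficients of the hyperoctahedral group are $g^B(\lambda,\mu,\nu)=\frac{1}{|B_n|}\sum_{\omega\in B_n}\psi^\lambda(\omega)\psi^\mu(\omega)\psi^\nu(\omega)$. *)

theory Defs
  imports
    Complex_Main
    "HOL-Library.FuncSet"
    "HOL-Library.Multiset"
    "HOL-Library.Disjoint_Sets"
    "HOL-Library.Poly_Mapping"
    "HOL-Combinatorics.Permutations"
    "HOL-Combinatorics.Orbits"
begin

text \<open>Signed permutations are functions on all of \<^typ>\<open>int\<close>, equal to the identity
  outside \<open>{-n..n}\<close>; the group operation is composition and the neutral element is \<^term>\<open>id\<close>.\<close>

definition hyperoct :: "nat \<Rightarrow> (int \<Rightarrow> int) set" where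
  "hyperoct n = {p. p permutes {- int n..int n} \<and> (\<forall>i. p (- i) = - p i)}"

definition descents :: "nat \<Rightarrow> (int \<Rightarrow> int) \<Rightarrow> nat set" where
  "descents n p = {i. i < n \<and> p (int i) > p (int i + 1)}"

text \<open>The cycles of a signed permutation are those of the induced permutation \<open>\<lambda>i. \<bar>p i\<bar>\<close>
  of \<open>{1..n}\<close>, as sets; a cycle is negative if it contains an odd number of sign changes.\<close>

definition signed_cycles :: "nat \<Rightarrow> (int \<Rightarrow> int) \<Rightarrow> int set set" where
  "signed_cycles n p = orbit (\<lambda>i. \<bar>p i\<bar>) ` {1..int n}"

definition sign_changes :: "(int \<Rightarrow> int) \<Rightarrow> int set \<Rightarrow> nat" where
  "sign_changes p C = card {j \<in> C. p j < 0}"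

definition cycle_lengths :: "int set set \<Rightarrow> nat list" where
  "cycle_lengths \<C> = rev (sorted_list_of_multiset (image_mset card (mset_set \<C>)))"

definition negative_cycle_type :: "nat \<Rightarrow> (int \<Rightarrow> int) \<Rightarrow> nat list" where
  "negative_cycle_type n p = cycle_lengths {C \<in> signed_cycles n p. odd (sign_changes p C)}"

definition positive_cycle_type :: "nat \<Rightarrow> (int \<Rightarrow> int) \<Rightarrow> nat list" where
  "positive_cycle_type n p = cycle_lengths {C \<in> signed_cycles n p. even (sign_changes p C)}"

text \<open>Partitions are weakly decreasing lists of positive parts. Boxes are pairs (row, column),
  both counted from \<open>0\<close>, rows growing downwards.\<close>

definition partition :: "nat list \<Rightarrow> bool" where
  "partition l \<longleftrightarrow> sorted_wrt (\<ge>) l \<and> 0 \<notin> set l"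

definition part :: "nat list \<Rightarrow> nat \<Rightarrow> nat" where
  "part l i = (if i < length l then l ! i else 0)"

definition diagram :: "nat list \<Rightarrow> (nat \<times> nat) set" where
  "diagram l = {(i, j). i < length l \<and> j < l ! i}"

definition horizontal_domino :: "(nat \<times> nat) set \<Rightarrow> bool" where
  "horizontal_domino d \<longleftrightarrow> (\<exists>i j. d = {(i, j), (i, j + 1)})"

definition vertical_domino :: "(nat \<times> nat) set \<Rightarrow> bool" where
  "vertical_domino d \<longleftrightarrow> (\<exists>i j. d = {(i, j), (i + 1, j)})"

definition domino :: "(nat \<times> nat) set \<Rightarrow> bool" where
  "domino d \<longleftrightarrow> horizontal_domino d \<or> vertical_domino d"

definition domino_partitions :: "nat \<Rightarrow> nat list set" where
  "domino_partitions n = {l. partition l \<and> sum_list l = 2 * n \<and>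
     (\<exists>D. partition_on (diagram l) D \<and> (\<forall>d\<in>D. domino d))}"

definition labelled_boxes :: "nat list \<Rightarrow> (nat \<times> nat \<Rightarrow> nat) \<Rightarrow> nat \<Rightarrow> (nat \<times> nat) set" where
  "labelled_boxes l T k = {c \<in> diagram l. T c = k}"

text \<open>A labelled tiling is encoded by the function sending each box to the label of the domino
  covering it, so the dominoes are the sets of boxes with a given label.\<close>

definition standard_domino_tableaux :: "nat \<Rightarrow> nat list \<Rightarrow> (nat \<times> nat \<Rightarrow> nat) set" where
  "standard_domino_tableaux n l = {T \<in> diagram l \<rightarrow>\<^sub>E {1..n}.
     (\<forall>k\<in>{1..n}. domino (labelled_boxes l T k)) \<and>
     (\<forall>i j j'. j \<le> j' \<longrightarrow> (i, j') \<in> diagram l \<longrightarrow> T (i, j) \<le> T (i, j')) \<and>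
     (\<forall>i i' j. i \<le> i' \<longrightarrow> (i', j) \<in> diagram l \<longrightarrow> T (i, j) \<le> T (i', j))}"

definition domino_descents :: "nat \<Rightarrow> nat list \<Rightarrow> (nat \<times> nat \<Rightarrow> nat) \<Rightarrow> nat set" where
  "domino_descents n l T =
     {i. 1 \<le> i \<and> i < n \<and>
         (\<forall>c\<in>labelled_boxes l T i. \<forall>c'\<in>labelled_boxes l T (i + 1). fst c < fst c')} \<union>
     {i. i = 0 \<and> vertical_domino (labelled_boxes l T 1)}"

definition domino_descent_count :: "nat \<Rightarrow> nat list \<Rightarrow> nat set \<Rightarrow> nat" where
  "domino_descent_count n l I =
     card {T \<in> standard_domino_tableaux n l. domino_descents n l T = I}"

text \<open>The numbers \<open>\<beta>\<^sub>i = \<lambda>\<^sub>i + m - i\<close> are computed for \<open>m\<close> the least even number that is at least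
  the number of parts; \<open>i\<close> is shifted by one because indices start at \<open>0\<close>.\<close>

definition even_bound :: "nat list \<Rightarrow> nat" where
  "even_bound l = (if even (length l) then length l else length l + 1)"

definition beta_numbers :: "nat list \<Rightarrow> nat list" where
  "beta_numbers l = (let m = even_bound l in map (\<lambda>i. part l i + m - (i + 1)) [0..<m])"

definition from_beta :: "nat \<Rightarrow> nat list \<Rightarrow> nat list" where
  "from_beta h e = filter (\<lambda>x. x > 0) (map (\<lambda>k. e ! k - (h - (k + 1))) [0..<h])"

definition quotient_minus :: "nat list \<Rightarrow> nat list" where
  "quotient_minus l =
     from_beta (even_bound l div 2) (map (\<lambda>b. b div 2) (filter even (beta_numbers l)))"

definition quotient_plus :: "nat list \<Rightarrow> nat list" where
  "quotient_plus l =
     from_beta (even_bound l div 2) (map (\<lambda>b. b div 2) (filter odd (beta_numbers l)))"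

text \<open>Both are taken in \<open>N\<close> variables \<open>x 0, \<dots>, x (N - 1)\<close> of a commutative ring; the Schur
  polynomial is the generating polynomial of semistandard Young tableaux.\<close>

definition power_sum :: "nat \<Rightarrow> (nat \<Rightarrow> 'a::comm_ring_1) \<Rightarrow> nat \<Rightarrow> 'a" where
  "power_sum N x k = (\<Sum>i<N. x i ^ k)"

definition semistandard_tableaux :: "nat \<Rightarrow> nat list \<Rightarrow> (nat \<times> nat \<Rightarrow> nat) set" where
  "semistandard_tableaux N l = {T \<in> diagram l \<rightarrow>\<^sub>E {..<N}.
     (\<forall>i j j'. j \<le> j' \<longrightarrow> (i, j') \<in> diagram l \<longrightarrow> T (i, j) \<le> T (i, j')) \<and>
     (\<forall>i i' j. i < i' \<longrightarrow> (i', j) \<in> diagram l \<longrightarrow> T (i, j) < T (i', j))}"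

definition schur :: "nat \<Rightarrow> (nat \<Rightarrow> 'a::comm_ring_1) \<Rightarrow> nat list \<Rightarrow> 'a" where
  "schur N x l = (\<Sum>T\<in>semistandard_tableaux N l. \<Prod>c\<in>diagram l. x (T c))"

text \<open>Polynomials in the indeterminates \<open>U\<close> (indexed by \<^const>\<open>Inl\<close>) and \<open>V\<close> (indexed by \<^const>\<open>Inr\<close>).\<close>

type_synonym uv_poly = "((nat + nat) \<Rightarrow>\<^sub>0 nat) \<Rightarrow>\<^sub>0 complex"

definition const :: "complex \<Rightarrow> uv_poly" where
  "const c = Poly_Mapping.single 0 c"

definition indet :: "nat + nat \<Rightarrow> uv_poly" where
  "indet v = Poly_Mapping.single (Poly_Mapping.single v 1) 1"

definition varU :: "nat \<Rightarrow> uv_poly" where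
  "varU i = indet (Inl i)"

definition varV :: "nat \<Rightarrow> uv_poly" where
  "varV i = indet (Inr i)"

definition power_sum_product :: "nat \<Rightarrow> nat list \<Rightarrow> uv_poly" where
  "power_sum_product N \<mu> =
     prod_list (map (\<lambda>k. power_sum N varU k - power_sum N varV k) (quotient_minus \<mu>)) *
     prod_list (map (\<lambda>k. power_sum N varU k + power_sum N varV k) (quotient_plus \<mu>))"

text \<open>The identity of symmetric functions is required in \<open>N\<close> + \<open>N\<close> indeterminates for every \<open>N\<close>.
  The values off \<^term>\<open>domino_partitions n\<close> are irrelevant and set to \<open>0\<close> so that the family is
  unique.\<close>

definition is_character_table :: "nat \<Rightarrow> (nat list \<Rightarrow> nat list \<Rightarrow> complex) \<Rightarrow> bool" where
  "is_character_table n \<psi> \<longleftrightarrow>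
     (\<forall>\<mu>\<in>domino_partitions n. \<forall>N.
        power_sum_product N \<mu> =
          (\<Sum>lam\<in>domino_partitions n.
             const (\<psi> lam \<mu>) * schur N varV (quotient_minus lam) * schur N varU (quotient_plus lam))) \<and>
     (\<forall>lam \<mu>. lam \<notin> domino_partitions n \<or> \<mu> \<notin> domino_partitions n \<longrightarrow> \<psi> lam \<mu> = 0)"

definition character_value :: "nat \<Rightarrow> nat list \<Rightarrow> nat list \<Rightarrow> complex" where
  "character_value n = (THE \<psi>. is_character_table n \<psi>)"

definition conj_class :: "nat \<Rightarrow> (int \<Rightarrow> int) \<Rightarrow> nat list" where
  "conj_class n p = (THE \<mu>. \<mu> \<in> domino_partitions n \<and>
     quotient_minus \<mu> = negative_cycle_type n p \<and> quotient_plus \<mu> = positive_cycle_type n p)"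

definition irr_character :: "nat \<Rightarrow> nat list \<Rightarrow> (int \<Rightarrow> int) \<Rightarrow> complex" where
  "irr_character n lam p = character_value n lam (conj_class n p)"

definition kroneckerB :: "nat \<Rightarrow> nat list \<Rightarrow> nat list \<Rightarrow> nat list \<Rightarrow> complex" where
  "kroneckerB n lam \<mu> \<nu> = 1 / of_nat (card (hyperoct n)) *
     (\<Sum>p\<in>hyperoct n. irr_character n lam p * irr_character n \<mu> p * irr_character n \<nu> p)"

definition descent_triples :: "nat \<Rightarrow> nat set \<Rightarrow> nat set \<Rightarrow> nat set
    \<Rightarrow> ((int \<Rightarrow> int) \<times> (int \<Rightarrow> int) \<times> (int \<Rightarrow> int)) set" where
  "descent_triples n I J K = {(p1, p2, p3).
     p1 \<in> hyperoct n \<and> p2 \<in> hyperoct n \<and> p3 \<in> hyperoct n \<and>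
     descents n p1 = I \<and> descents n p2 = J \<and> descents n p3 = K \<and> p1 \<circ> p2 \<circ> p3 = id}"

end

theory Submission
  imports Defs
begin

text \<open>The Kronecker coefficient is an average over the group, so the right hand side is
  the average of \<open>\<Theta> I p * \<Theta> J p * \<Theta> K p\<close> over all signed permutations \<open>p\<close>, where \<open>\<Theta> I p\<close> is the sum of the numbers \<open>d \<lambda> I * \<psi> \<lambda> p\<close> over all \<open>\<lambda>\<close>. By Moebius inversion it is enough to
  prove the identity after summing both sides over all subsets of \<open>I\<close>, of \<open>J\<close> and of \<open>K\<close>, that is, for
  descents contained in the given sets rather than equal to them.

  Summed in this way, \<open>\<Theta> I p\<close> becomes the number of words fixed by \<open>p\<close>
  (\<open>sum_descent_character\<close>). The words in question are the odd functions on \<open>{-n..n}\<close> obtained by rearranging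
  one sorted word that is constant on the blocks cut out by \<open>I\<close>; they stand for the cosets of the parabolic
  subgroup belonging to \<open>I\<close>. Three facts go into this. First, a domino tableau is a sequence of moves
  of beads by two places to the right, where a descent in position \<open>i \<ge> 1\<close> means that move \<open>i + 1\<close> starts to
  the left of move \<open>i\<close>. A run of moves without descents is therefore a horizontal strip in each component
  of the 2-quotient, and the tableaux with descents in \<open>I\<close> correspond to pairs of
  semistandard tableaux, the first one without the letter \<open>0\<close>, whose joint content is given by the block
  sizes (\<open>card_moves_eq_pair_kostka\<close>).
  Second, the number of such pairs is a coefficient of the product of two Schur polynomials once the two
  alphabets have been merged suitably (\<open>pair_schur_expansion\<close>). Third, the same specialization turns the
  product of power sums that defines the characters into the generating function of fixed words, because
  a fixed word amounts to the choice of a letter for each cycle, which has to be \<open>0\<close> on the negative cycles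
  (\<open>fixed_words_generating_function\<close>). The characters themselves are given by a definite description,
  so it also has to be shown that the defining identities have exactly one solution. This is the
  unitriangularity of Kostka numbers together with their symmetry, proved by the Bender-Knuth involution
  (\<open>character_table_ex1\<close>).

  It remains to see that the average number of fixed triples of words is the number of factorizations
  \<open>p1 \<circ> p2 \<circ> p3 = id\<close> with descents contained in \<open>I\<close>, \<open>J\<close>, \<open>K\<close>. As in Burnside's lemma the average counts
  lexicographically sorted triples (\<open>sum_fixed_triples_eq_sorted_triples\<close>), and a sorted triple is the same as
  such a factorization by standardizing its words one after the other (\<open>card_sorted_triples\<close>).\<close>

section \<open>Sorting by signed permutations\<close>

abbreviation seg :: "nat \<Rightarrow> int set" where
  "seg n \<equiv> {- int n..int n}"

lemma hyperoct_permutes: "p \<in> hyperoct n \<Longrightarrow> p permutes seg n"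
  by (simp add: hyperoct_def)

lemma hyperoct_uminus: "p \<in> hyperoct n \<Longrightarrow> p (- i) = - p i"
  by (simp add: hyperoct_def)

lemma hyperoct_in_seg: "p \<in> hyperoct n \<Longrightarrow> p i \<in> seg n \<longleftrightarrow> i \<in> seg n"
  by (metis hyperoct_permutes permutes_in_image)

lemma hyperoct_outside: "p \<in> hyperoct n \<Longrightarrow> i \<notin> seg n \<Longrightarrow> p i = i"
  by (metis hyperoct_permutes permutes_not_in)

lemma hyperoct_zero: "p \<in> hyperoct n \<Longrightarrow> p 0 = 0"
  using hyperoct_uminus[of p n 0] by simp

lemma hyperoct_id: "id \<in> hyperoct n"
  by (simp add: hyperoct_def permutes_id)

lemma hyperoct_comp: "p \<in> hyperoct n \<Longrightarrow> q \<in> hyperoct n \<Longrightarrow> p \<circ> q \<in> hyperoct n"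
  by (simp add: hyperoct_def permutes_compose)

lemma hyperoct_inv: "p \<in> hyperoct n \<Longrightarrow> inv p \<in> hyperoct n"
  using permutes_inv[of p "seg n"] permutes_inv_eq[of p "seg n"]
  by (auto simp: hyperoct_def)

lemma hyperoct_inv_comp:
  assumes "p \<in> hyperoct n"
  shows "inv p \<circ> p = id" "p \<circ> inv p = id"
  using permutes_inv_o[OF hyperoct_permutes[OF assms]] by auto

lemma hyperoct_inv_apply:
  assumes "p \<in> hyperoct n"
  shows "inv p (p x) = x" "p (inv p x) = x"
  using permutes_inverses[OF hyperoct_permutes[OF assms]] by auto

lemma finite_hyperoct: "finite (hyperoct n)"
  by (rule finite_subset[OF _ finite_permutations[of "seg n"]]) (auto simp: hyperoct_def)

text \<open>Both functions list the same multiset of values in sorted order.\<close>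

lemma mono_rearrangement_eq:
  fixes f g :: "int \<Rightarrow> int"
  assumes "mono_on (seg n) f" "mono_on (seg n) g"
    and "image_mset f (mset_set (seg n)) = image_mset g (mset_set (seg n))"
    and "i \<in> seg n"
  shows "f i = g i"
proof -
  let ?L = "[- int n..int n]"
  have srt: "sorted (map h ?L)" if "mono_on (seg n) h" for h :: "int \<Rightarrow> int"
  proof -
    have "sorted_wrt (\<le>) ?L" by (rule sorted_upto)
    then show ?thesis
      unfolding sorted_wrt_map by (rule sorted_wrt_mono_rel[rotated]) (use that in \<open>auto simp: monotone_on_def\<close>)
  qed
  have ms: "mset (map h ?L) = image_mset h (mset_set (seg n))" for h :: "int \<Rightarrow> int"
    by (metis distinct_upto mset_map mset_set_set set_upto)
  have "map f ?L = map g ?L"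
    using properties_for_sort[of "map f ?L" "map g ?L"] sorted_sort_id[OF srt[OF assms(2)]]
      srt[OF assms(1)] ms[of f] ms[of g] assms(3) by simp
  then show ?thesis using assms(4) by auto
qed

lemma image_mset_rearrange:
  assumes "p \<in> hyperoct n"
  shows "image_mset (f \<circ> p) (mset_set (seg n)) = image_mset f (mset_set (seg n))"
proof -
  have "image_mset p (mset_set (seg n)) = mset_set (seg n)"
    using hyperoct_permutes[OF assms] by (simp add: image_mset_mset_set permutes_inj_on permutes_image)
  then show ?thesis by (metis multiset.map_comp)
qed

lemma hyperoct_eqI:
  assumes "p \<in> hyperoct n" "q \<in> hyperoct n" "\<And>i. i \<in> seg n \<Longrightarrow> p i = q i"
  shows "p = q"
  using assms hyperoct_outside by (metis ext)

text \<open>The number of positions with a smaller key, shifted by \<open>n\<close>, is a signed permutation because the key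
  is odd; its inverse sorts the key.\<close>

lemma hyperoct_sort_exists:
  fixes \<kappa> :: "int \<Rightarrow> int"
  assumes inj: "inj_on \<kappa> (seg n)" and odd: "\<And>i. \<kappa> (- i) = - \<kappa> i"
  shows "\<exists>p\<in>hyperoct n. strict_mono_on (seg n) (\<kappa> \<circ> p)"
proof -
  define R where "R x = {y \<in> seg n. \<kappa> y < \<kappa> x}" for x
  define r where "r x = (if x \<in> seg n then int (card (R x)) - int n else x)" for x
  have fin: "finite (R x)" for x unfolding R_def by (rule finite_subset[of _ "seg n"]) auto
  have less: "card (R x) < card (R y)" if "\<kappa> x < \<kappa> y" "x \<in> seg n" "y \<in> seg n" for x y
  proof (rule psubset_card_mono[OF fin])
    have "x \<in> R y" "x \<notin> R x" using that unfolding R_def by blast+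
    moreover have "R x \<subseteq> R y" using that unfolding R_def by force
    ultimately show "R x \<subset> R y" by blast
  qed
  have inj_r: "inj_on r (seg n)"
  proof (rule inj_onI)
    fix x y assume "x \<in> seg n" "y \<in> seg n" "r x = r y"
    then have "card (R x) = card (R y)" unfolding r_def by (simp split: if_splits)
    then have "\<kappa> x = \<kappa> y"
      using less[of x y] less[of y x] \<open>x \<in> seg n\<close> \<open>y \<in> seg n\<close> by (metis less_irrefl linorder_neqE)
    then show "x = y" using inj \<open>x \<in> seg n\<close> \<open>y \<in> seg n\<close> by (auto dest: inj_onD)
  qed
  have maps: "r x \<in> seg n" if x: "x \<in> seg n" for x
  proof -
    have "R x \<subset> seg n" using x unfolding R_def by blast
    then have "card (R x) < card (seg n)" by (intro psubset_card_mono finite_atLeastAtMost_int)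
    then have "int (card (R x)) \<le> 2 * int n" by simp
    then show ?thesis using x unfolding r_def by simp
  qed
  then have "r ` seg n = seg n"
    by (intro endo_inj_surj inj_r finite_atLeastAtMost_int image_subsetI)
  then have "bij_betw r (seg n) (seg n)" using inj_r by (simp add: bij_betw_def)
  then have perm: "r permutes seg n"
    by (rule bij_imp_permutes) (auto simp: r_def)
  have "r (- x) = - r x" for x
  proof (cases "x \<in> seg n")
    case True
    have "R (- x) = uminus ` {y \<in> seg n. \<kappa> x < \<kappa> y}"
    proof (intro set_eqI iffI)
      fix z assume "z \<in> R (- x)"
      then have "- z \<in> {y \<in> seg n. \<kappa> x < \<kappa> y}" unfolding R_def by (auto simp: odd)
      then have "- (- z) \<in> uminus ` {y \<in> seg n. \<kappa> x < \<kappa> y}" by blast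
      then show "z \<in> uminus ` {y \<in> seg n. \<kappa> x < \<kappa> y}" by simp
    qed (auto simp: R_def odd)
    then have c: "card (R (- x)) = card {y \<in> seg n. \<kappa> x < \<kappa> y}"
      by (simp add: card_image)
    have eq: "insert x (R x \<union> {y \<in> seg n. \<kappa> x < \<kappa> y}) = seg n"
    proof (intro equalityI subsetI)
      fix y assume y: "y \<in> seg n"
      have "y = x" if "\<kappa> y = \<kappa> x" by (rule inj_onD[OF inj that y True])
      then show "y \<in> insert x (R x \<union> {y \<in> seg n. \<kappa> x < \<kappa> y})"
        using y unfolding R_def by (cases "\<kappa> y" "\<kappa> x" rule: linorder_cases) blast+
    qed (use True in \<open>auto simp: R_def\<close>)
    have "card (insert x (R x \<union> {y \<in> seg n. \<kappa> x < \<kappa> y})) = Suc (card (R x) + card {y \<in> seg n. \<kappa> x < \<kappa> y})"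
    proof -
      have f2: "finite {y \<in> seg n. \<kappa> x < \<kappa> y}" by (rule finite_subset[of _ "seg n"]) auto
      show ?thesis
        by (subst card_insert_disjoint, use fin f2 in blast, force simp: R_def, subst card_Un_disjoint)
          (use fin f2 in \<open>auto simp: R_def\<close>)
    qed
    then have "card (R x) + card {y \<in> seg n. \<kappa> x < \<kappa> y} = 2 * n"
      unfolding eq by simp
    then have "int (card (R x)) + int (card (R (- x))) = 2 * int n"
      unfolding c by linarith
    then show ?thesis using True unfolding r_def by auto
  qed (auto simp: r_def)
  then have rH: "r \<in> hyperoct n" using perm by (simp add: hyperoct_def)
  have "strict_mono_on (seg n) (\<kappa> \<circ> inv r)"
  proof (rule strict_mono_onI)
    fix i j assume i: "i \<in> seg n" and j: "j \<in> seg n" and ij: "i < j"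
    let ?x = "inv r i" and ?y = "inv r j"
    have xy: "?x \<in> seg n" "?y \<in> seg n" using hyperoct_in_seg[OF hyperoct_inv[OF rH]] i j by auto
    have rr: "r ?x = i" "r ?y = j" using hyperoct_inv_apply[OF rH] by auto
    have "\<not> \<kappa> ?y < \<kappa> ?x" using less[of ?y ?x] xy rr ij unfolding r_def by (auto split: if_splits)
    moreover have "\<kappa> ?x \<noteq> \<kappa> ?y" using inj xy rr ij by (metis inj_onD less_irrefl)
    ultimately show "(\<kappa> \<circ> inv r) i < (\<kappa> \<circ> inv r) j" by simp
  qed
  then show ?thesis using hyperoct_inv[OF rH] by blast
qed

lemma hyperoct_sort_unique:
  fixes \<kappa> :: "int \<Rightarrow> int"
  assumes inj: "inj_on \<kappa> (seg n)" and p: "p \<in> hyperoct n" and q: "q \<in> hyperoct n"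
    and "strict_mono_on (seg n) (\<kappa> \<circ> p)" "strict_mono_on (seg n) (\<kappa> \<circ> q)"
  shows "p = q"
proof (rule hyperoct_eqI[OF p q])
  fix i assume i: "i \<in> seg n"
  have "(\<kappa> \<circ> p) i = (\<kappa> \<circ> q) i"
    by (rule mono_rearrangement_eq[OF _ _ _ i])
      (use assms in \<open>auto simp: image_mset_rearrange strict_mono_on_imp_mono_on simp del: o_apply\<close>)
  then show "p i = q i"
    using inj i hyperoct_in_seg[OF p] hyperoct_in_seg[OF q] by (auto dest: inj_onD)
qed

text \<open>Comparing these keys compares pairs lexicographically as long as the second entries are at most
  \<open>n\<close> in absolute value. Working with integers rather than with pairs keeps the key an odd function
  whenever both entries are odd functions of the position.\<close>

definition lex_key :: "nat \<Rightarrow> int \<Rightarrow> int \<Rightarrow> int" where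
  "lex_key n x a = x * (2 * int n + 1) + a"

lemma lex_key_less_iff:
  assumes "\<bar>a\<bar> \<le> int n" "\<bar>b\<bar> \<le> int n"
  shows "lex_key n x a < lex_key n y b \<longleftrightarrow> x < y \<or> x = y \<and> a < b"
proof -
  have *: "lex_key n x a < lex_key n y b" if "x < y" "\<bar>a\<bar> \<le> int n" "\<bar>b\<bar> \<le> int n" for x y a b
  proof -
    have "(x + 1) * (2 * int n + 1) \<le> y * (2 * int n + 1)"
      using that by (intro mult_right_mono) auto
    then show ?thesis using that unfolding lex_key_def by (simp add: algebra_simps)
  qed
  show ?thesis
    using *[of x y a b] *[of y x b a] assms by (cases x y rule: linorder_cases) (auto simp: lex_key_def)
qed

lemma lex_key_le_iff:
  assumes "\<bar>a\<bar> \<le> int n" "\<bar>b\<bar> \<le> int n"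
  shows "lex_key n x a \<le> lex_key n y b \<longleftrightarrow> x < y \<or> x = y \<and> a \<le> b"
  using lex_key_less_iff[OF assms(2,1), of y x] by (auto simp: not_less[symmetric])

lemma lex_key_eq_iff:
  assumes "\<bar>a\<bar> \<le> int n" "\<bar>b\<bar> \<le> int n"
  shows "lex_key n x a = lex_key n y b \<longleftrightarrow> x = y \<and> a = b"
  using lex_key_le_iff[OF assms, of x y] lex_key_le_iff[OF assms(2,1), of y x]
  by (auto simp: order.eq_iff[of "lex_key n x a"])

lemma hyperoct_weak_sort_exists:
  fixes k :: "int \<Rightarrow> int"
  assumes odd: "\<And>i. k (- i) = - k i"
  shows "\<exists>p\<in>hyperoct n. strict_mono_on (seg n) (\<lambda>i. lex_key n (k (p i)) (p i))"
proof -
  have "inj_on (\<lambda>i. lex_key n (k i) i) (seg n)"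
    by (rule inj_onI) (auto simp: lex_key_eq_iff)
  moreover have "lex_key n (k (- i)) (- i) = - lex_key n (k i) i" for i
    by (simp add: lex_key_def odd)
  ultimately show ?thesis
    using hyperoct_sort_exists[of "\<lambda>i. lex_key n (k i) i" n] by (auto simp: o_def)
qed

lemma strict_mono_lexD:
  assumes "p \<in> hyperoct n" "strict_mono_on (seg n) (\<lambda>i. lex_key n (k (p i)) (p i))"
    and "i \<in> seg n" "j \<in> seg n" "i < j"
  shows "k (p i) < k (p j) \<or> k (p i) = k (p j) \<and> p i < p j"
proof -
  have "lex_key n (k (p i)) (p i) < lex_key n (k (p j)) (p j)"
    using strict_mono_onD[OF assms(2-5)] .
  moreover have "\<bar>p i\<bar> \<le> int n" "\<bar>p j\<bar> \<le> int n"
    using hyperoct_in_seg[OF assms(1), of i] hyperoct_in_seg[OF assms(1), of j] assms(3,4) by auto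
  ultimately show ?thesis by (simp add: lex_key_less_iff)
qed

lemma strict_mono_lex_imp_mono:
  assumes "p \<in> hyperoct n" "strict_mono_on (seg n) (\<lambda>i. lex_key n (k (p i)) (p i))"
  shows "mono_on (seg n) (k \<circ> p)"
proof (rule mono_onI)
  fix i j assume "i \<in> seg n" "j \<in> seg n" "i \<le> j"
  then show "(k \<circ> p) i \<le> (k \<circ> p) j"
    using strict_mono_lexD[OF assms, of i j] by (cases "i = j") auto
qed

text \<open>The sorted arrangement of \<open>k\<close> is unique, so two signed permutations that sort \<open>k\<close> differ by an
  element of the stabilizer: the sorting permutations form a coset of it.\<close>

lemma card_stabilizer_eq_card_sorting:
  fixes k :: "int \<Rightarrow> int"
  assumes odd: "\<And>i. k (- i) = - k i"
  shows "card {w \<in> hyperoct n. k \<circ> w = k} = card {p \<in> hyperoct n. mono_on (seg n) (k \<circ> p)}"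
proof -
  obtain p where p: "p \<in> hyperoct n" and sm: "strict_mono_on (seg n) (\<lambda>i. lex_key n (k (p i)) (p i))"
    using hyperoct_weak_sort_exists[of k n] odd by blast
  have mono: "mono_on (seg n) (k \<circ> p)"
    by (rule strict_mono_lex_imp_mono[OF p sm])
  have "bij_betw (\<lambda>w. w \<circ> p) {w \<in> hyperoct n. k \<circ> w = k} {p \<in> hyperoct n. mono_on (seg n) (k \<circ> p)}"
  proof (rule bij_betw_byWitness[where f' = "\<lambda>q. q \<circ> inv p"])
    show "\<forall>w\<in>{w \<in> hyperoct n. k \<circ> w = k}. w \<circ> p \<circ> inv p = w"
      by (simp add: o_assoc[symmetric] hyperoct_inv_comp[OF p])
    show "\<forall>q\<in>{p \<in> hyperoct n. mono_on (seg n) (k \<circ> p)}. q \<circ> inv p \<circ> p = q"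
      by (simp add: o_assoc[symmetric] hyperoct_inv_comp[OF p])
    show "(\<lambda>w. w \<circ> p) ` {w \<in> hyperoct n. k \<circ> w = k} \<subseteq> {p \<in> hyperoct n. mono_on (seg n) (k \<circ> p)}"
      using mono by (auto simp: hyperoct_comp p o_assoc)
    show "(\<lambda>q. q \<circ> inv p) ` {p \<in> hyperoct n. mono_on (seg n) (k \<circ> p)} \<subseteq> {w \<in> hyperoct n. k \<circ> w = k}"
    proof clarify
      fix q assume q: "q \<in> hyperoct n" and mq: "mono_on (seg n) (k \<circ> q)"
      have in_seg: "(k \<circ> q) i = (k \<circ> p) i" if "i \<in> seg n" for i
        by (rule mono_rearrangement_eq[OF mq mono _ that]) (simp add: image_mset_rearrange p q)
      have eq: "k \<circ> q = k \<circ> p"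
      proof
        fix i show "(k \<circ> q) i = (k \<circ> p) i"
        proof (cases "i \<in> seg n")
          case False
          then show ?thesis using hyperoct_outside[OF p] hyperoct_outside[OF q] by simp
        qed (rule in_seg)
      qed
      have "k \<circ> (q \<circ> inv p) = k \<circ> p \<circ> inv p" by (simp add: o_assoc eq)
      also have "\<dots> = k" by (simp add: o_assoc[symmetric] hyperoct_inv_comp[OF p])
      finally show "q \<circ> inv p \<in> hyperoct n \<and> k \<circ> (q \<circ> inv p) = k"
        by (simp add: hyperoct_comp hyperoct_inv p q)
    qed
  qed
  then show ?thesis by (rule bij_betw_same_card)
qed

section \<open>Words, descents and standardization\<close>

text \<open>The weakly increasing odd word that jumps by one after each position in \<open>I\<close>. Its stabilizer in
  \<^term>\<open>hyperoct n\<close> is the parabolic subgroup whose simple reflections are those not indexed by \<open>I\<close>,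
  so the words obtained by rearranging it stand for the cosets of that subgroup.\<close>

definition block_word :: "nat \<Rightarrow> nat set \<Rightarrow> int \<Rightarrow> int" where
  "block_word n I i = (if i \<in> seg n then sgn i * int (card {d \<in> I. int d < \<bar>i\<bar>}) else 0)"

definition words :: "nat \<Rightarrow> nat set \<Rightarrow> (int \<Rightarrow> int) set" where
  "words n I = (\<lambda>p. block_word n I \<circ> p) ` hyperoct n"

lemma block_word_uminus: "block_word n I (- i) = - block_word n I i"
  by (auto simp: block_word_def)

lemma block_word_zero: "block_word n I 0 = 0"
  by (simp add: block_word_def)

lemma block_word_nonneg_mono:
  assumes "finite I" "0 \<le> i" "i \<le> j" "j \<le> int n"
  shows "block_word n I i \<le> block_word n I j"
proof -
  have "card {d \<in> I. int d < i} \<le> card {d \<in> I. int d < j}"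
    using assms by (intro card_mono) auto
  then show ?thesis using assms by (auto simp: block_word_def sgn_if)
qed

lemma block_word_nonneg: "finite I \<Longrightarrow> 0 \<le> i \<Longrightarrow> 0 \<le> block_word n I i"
  by (auto simp: block_word_def sgn_if)

lemma mono_block_word:
  assumes "finite I"
  shows "mono_on (seg n) (block_word n I)"
proof (rule mono_onI)
  fix i j assume i: "i \<in> seg n" and j: "j \<in> seg n" and ij: "i \<le> j"
  consider "0 \<le> i" | "j \<le> 0" | "i \<le> 0" "0 \<le> j" by linarith
  then show "block_word n I i \<le> block_word n I j"
  proof cases
    case 1 then show ?thesis using block_word_nonneg_mono[OF assms] ij j by simp
  next
    case 2 then show ?thesis
      using block_word_nonneg_mono[OF assms, of "- j" "- i" n] ij i by (simp add: block_word_uminus)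
  next
    case 3 then show ?thesis
      using block_word_nonneg[OF assms, of "- i" n] block_word_nonneg[OF assms, of j n]
      by (simp add: block_word_uminus)
  qed
qed

lemma abs_block_word_le:
  assumes "I \<subseteq> {..<n}"
  shows "\<bar>block_word n I i\<bar> \<le> int n"
proof -
  have "card {d \<in> I. int d < \<bar>i\<bar>} \<le> card {..<n}"
    using assms by (intro card_mono) auto
  then show ?thesis by (auto simp: block_word_def sgn_if)
qed

lemma block_word_step:
  assumes "finite I" "i < n"
  shows "block_word n I (int i) = block_word n I (int i + 1) \<longleftrightarrow> i \<notin> I"
proof -
  have "{d \<in> I. int d < int i + 1} = {d \<in> I. int d < int i} \<union> (if i \<in> I then {i} else {})"
    by (auto simp: order_le_less)
  then have "card {d \<in> I. int d < int i + 1} = card {d \<in> I. int d < int i} + (if i \<in> I then 1 else 0)"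
    using assms(1) by (auto simp: card_insert_if)
  then show ?thesis using assms(2) by (cases "i = 0") (auto simp: block_word_def sgn_if)
qed

text \<open>Away from \<open>0\<close> a block of equal letters is an interval of positions without a descent in between.
  The block of the letter \<open>0\<close> is symmetric about the origin, and there \<open>p 0 = 0 < p x\<close> for positive
  \<open>x\<close> gives the claim for pairs of different sign by oddness.\<close>

lemma descents_subset_iff_increasing:
  assumes I: "finite I" and p: "p \<in> hyperoct n"
  shows "descents n p \<subseteq> I \<longleftrightarrow>
    (\<forall>x\<in>seg n. \<forall>y\<in>seg n. x < y \<longrightarrow> block_word n I x = block_word n I y \<longrightarrow> p x < p y)"
proof
  assume D: "descents n p \<subseteq> I"
  have inj: "p x = p y \<Longrightarrow> x = y" for x y
    using hyperoct_inv_apply[OF p] by metis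
  have step: "p (int i) < p (int i + 1)" if "i < n" "i \<notin> I" for i
    using D that inj[of "int i" "int i + 1"] unfolding descents_def by force
  have nn: "p (int i) < p (int j)" if "i < j" "j \<le> n" "block_word n I (int i) = block_word n I (int j)" for i j
    using that
  proof (induction j)
    case (Suc j)
    have m: "block_word n I (int i) \<le> block_word n I (int j)" "block_word n I (int j) \<le> block_word n I (int (Suc j))"
      by (rule block_word_nonneg_mono[OF I]; use Suc.prems in linarith)+
    then have "block_word n I (int j) = block_word n I (int (Suc j))" using Suc.prems by linarith
    then have "block_word n I (int j) = block_word n I (int j + 1)" by (simp add: add.commute)
    then have "j \<notin> I" using block_word_step[OF I] Suc.prems by simp
    then have s: "p (int j) < p (int (Suc j))" using step[of j] Suc.prems by (simp add: add.commute)
    show ?case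
    proof (cases "i = j")
      case False
      then have "p (int i) < p (int j)" using Suc.prems m by (intro Suc.IH) auto
      then show ?thesis using s by simp
    qed (use s in simp)
  qed simp
  have pos: "p x < p y" if "0 \<le> x" "x < y" "y \<le> int n" "block_word n I x = block_word n I y" for x y
    using nn[of "nat x" "nat y"] that by simp
  show "\<forall>x\<in>seg n. \<forall>y\<in>seg n. x < y \<longrightarrow> block_word n I x = block_word n I y \<longrightarrow> p x < p y"
  proof (intro ballI impI)
    fix x y assume x: "x \<in> seg n" and y: "y \<in> seg n" and xy: "x < y"
      and eq: "block_word n I x = block_word n I y"
    consider "0 \<le> x" | "y \<le> 0" | "x < 0" "0 < y" by linarith
    then show "p x < p y"
    proof cases
      case 1 then show ?thesis using pos xy y eq by simp
    next
      case 2 then show ?thesis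
        using pos[of "- y" "- x"] xy x eq by (simp add: block_word_uminus hyperoct_uminus[OF p])
    next
      case 3
      have "block_word n I x = 0" "block_word n I y = 0"
        using block_word_nonneg[OF I, of "- x" n] block_word_nonneg[OF I, of y n] 3 eq
        by (auto simp: block_word_uminus)
      then have "p 0 < p y" "p 0 < p (- x)"
        using pos[of 0 y] pos[of 0 "- x"] 3 x y by (auto simp: block_word_uminus block_word_zero)
      then show ?thesis by (simp add: hyperoct_uminus[OF p] hyperoct_zero[OF p])
    qed
  qed
next
  assume inc: "\<forall>x\<in>seg n. \<forall>y\<in>seg n. x < y \<longrightarrow> block_word n I x = block_word n I y \<longrightarrow> p x < p y"
  show "descents n p \<subseteq> I"
  proof
    fix i assume i: "i \<in> descents n p"
    then have "i < n" "p (int i + 1) < p (int i)" by (auto simp: descents_def)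
    then show "i \<in> I" using inc block_word_step[OF I, of i n] by (force simp: not_less)
  qed
qed

lemma words_uminus: "f \<in> words n I \<Longrightarrow> f (- i) = - f i"
  by (auto simp: words_def block_word_uminus hyperoct_uminus)

lemma words_comp: "f \<in> words n I \<Longrightarrow> p \<in> hyperoct n \<Longrightarrow> f \<circ> p \<in> words n I"
  by (auto simp: words_def o_assoc[symmetric] hyperoct_comp)

lemma abs_words_le: "f \<in> words n I \<Longrightarrow> I \<subseteq> {..<n} \<Longrightarrow> \<bar>f i\<bar> \<le> int n"
  by (auto simp: words_def abs_block_word_le)

lemma finite_words: "finite (words n I)"
  by (simp add: words_def finite_hyperoct)

lemma words_outside: "f \<in> words n I \<Longrightarrow> i \<notin> seg n \<Longrightarrow> f i = 0"
proof -
  assume "f \<in> words n I" and i: "i \<notin> seg n"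
  then obtain p where p: "p \<in> hyperoct n" and f: "f = block_word n I \<circ> p" by (auto simp: words_def)
  have "p i \<notin> seg n" using i hyperoct_in_seg[OF p] by blast
  then show "f i = 0" unfolding f block_word_def comp_def by (rule if_not_P)
qed

lemma words_rearrangement:
  "f \<in> words n I \<Longrightarrow> image_mset f (mset_set (seg n)) = image_mset (block_word n I) (mset_set (seg n))"
  by (auto simp: words_def image_mset_rearrange)

lemma mono_word_eq_block_word:
  assumes "finite I" "f \<in> words n I" "mono_on (seg n) f"
  shows "f = block_word n I"
proof
  fix i show "f i = block_word n I i"
  proof (cases "i \<in> seg n")
    case True
    show ?thesis
      by (rule mono_rearrangement_eq[OF assms(3) mono_block_word[OF assms(1)] words_rearrangement[OF assms(2)] True])
  next
    case False
    then have "block_word n I i = 0" unfolding block_word_def by (rule if_not_P)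
    then show ?thesis using words_outside[OF assms(2) False] by simp
  qed
qed

text \<open>Sorting a word by its letters and breaking ties by position yields one signed permutation with descents
  in \<open>I\<close>, and uniqueness of sorting shows that there is no other. So words and permutations with
  descents in \<open>I\<close> are the same thing.\<close>

lemma standardization:
  assumes I: "finite I" and f: "f \<in> words n I"
  shows "\<exists>!p. p \<in> hyperoct n \<and> descents n p \<subseteq> I \<and> f \<circ> p = block_word n I"
proof (rule ex_ex1I)
  obtain p where p: "p \<in> hyperoct n" and sm: "strict_mono_on (seg n) (\<lambda>i. lex_key n (f (p i)) (p i))"
    using hyperoct_weak_sort_exists[of f n] words_uminus[OF f] by blast
  have "mono_on (seg n) (f \<circ> p)"
    by (rule strict_mono_lex_imp_mono[OF p sm])
  then have eq: "f \<circ> p = block_word n I"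
    by (rule mono_word_eq_block_word[OF I words_comp[OF f p]])
  have "descents n p \<subseteq> I"
    unfolding descents_subset_iff_increasing[OF I p] eq[symmetric]
  proof (intro ballI impI)
    fix x y assume "x \<in> seg n" "y \<in> seg n" "x < y" "(f \<circ> p) x = (f \<circ> p) y"
    then show "p x < p y" using strict_mono_lexD[OF p sm, of x y] by simp
  qed
  then show "\<exists>p. p \<in> hyperoct n \<and> descents n p \<subseteq> I \<and> f \<circ> p = block_word n I"
    using p eq by blast
next
  fix p q
  assume p: "p \<in> hyperoct n \<and> descents n p \<subseteq> I \<and> f \<circ> p = block_word n I"
    and q: "q \<in> hyperoct n \<and> descents n q \<subseteq> I \<and> f \<circ> q = block_word n I"
  have *: "strict_mono_on (seg n) ((\<lambda>i. lex_key n (f i) i) \<circ> p)"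
    if p: "p \<in> hyperoct n \<and> descents n p \<subseteq> I \<and> f \<circ> p = block_word n I" for p
  proof (rule strict_mono_onI)
    fix i j assume i: "i \<in> seg n" and j: "j \<in> seg n" and ij: "i < j"
    have fp: "f (p i) = block_word n I i" "f (p j) = block_word n I j"
      using p by (metis comp_apply)+
    have "f (p i) \<le> f (p j)"
      unfolding fp using mono_onD[OF mono_block_word[OF I] i j] ij by simp
    moreover have "f (p i) = f (p j) \<Longrightarrow> p i < p j"
      using p i j ij descents_subset_iff_increasing[OF I] unfolding fp by auto
    moreover have "\<bar>p i\<bar> \<le> int n" "\<bar>p j\<bar> \<le> int n"
      using hyperoct_in_seg[of p n i] hyperoct_in_seg[of p n j] i j p by auto
    ultimately show "((\<lambda>i. lex_key n (f i) i) \<circ> p) i < ((\<lambda>i. lex_key n (f i) i) \<circ> p) j"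
      by (auto simp: lex_key_less_iff)
  qed
  show "p = q"
    by (rule hyperoct_sort_unique[OF _ _ _ *[OF p] *[OF q]]) (use p q in \<open>auto simp: inj_on_def lex_key_eq_iff\<close>)
qed

section \<open>Triples of words and factorizations of the identity\<close>

definition sorted_triple :: "nat \<Rightarrow> (int \<Rightarrow> int) \<Rightarrow> (int \<Rightarrow> int) \<Rightarrow> (int \<Rightarrow> int) \<Rightarrow> bool" where
  "sorted_triple n f g h \<longleftrightarrow> mono_on (seg n) (\<lambda>i. lex_key n (lex_key n (f i) (h i)) (g i))"

lemma sorted_tripleI:
  assumes "\<And>i. \<bar>h i\<bar> \<le> int n" "\<And>i. \<bar>g i\<bar> \<le> int n"
    and "\<And>i j. i \<in> seg n \<Longrightarrow> j \<in> seg n \<Longrightarrow> i < j \<Longrightarrow>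
      f i < f j \<or> f i = f j \<and> (h i < h j \<or> h i = h j \<and> g i \<le> g j)"
  shows "sorted_triple n f g h"
  unfolding sorted_triple_def
proof (rule mono_onI)
  fix i j assume "i \<in> seg n" "j \<in> seg n" "i \<le> j"
  then show "lex_key n (lex_key n (f i) (h i)) (g i) \<le> lex_key n (lex_key n (f j) (h j)) (g j)"
    using assms(3)[of i j] assms(1,2) by (cases "i = j") (auto simp: lex_key_le_iff lex_key_less_iff lex_key_eq_iff)
qed

lemma sorted_tripleD:
  assumes "sorted_triple n f g h" "\<And>i. \<bar>h i\<bar> \<le> int n" "\<And>i. \<bar>g i\<bar> \<le> int n"
    and "i \<in> seg n" "j \<in> seg n" "i < j"
  shows "f i < f j \<or> f i = f j \<and> (h i < h j \<or> h i = h j \<and> g i \<le> g j)"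
proof -
  have "lex_key n (lex_key n (f i) (h i)) (g i) \<le> lex_key n (lex_key n (f j) (h j)) (g j)"
    using mono_onD[OF assms(1)[unfolded sorted_triple_def] assms(4,5)] assms(6) by simp
  then show ?thesis
    using assms(2,3) by (auto simp: lex_key_le_iff lex_key_less_iff lex_key_eq_iff)
qed

text \<open>The argument behind Burnside's lemma. Summing over triples of words, each triple contributes
  the size of its stabilizer, which is the number of permutations that sort it; and a pair of a triple and
  a permutation sorting it is a pair of a permutation and an arbitrary sorted triple.\<close>

lemma sum_fixed_triples_eq_sorted_triples:
  assumes I: "I \<subseteq> {..<n}" and J: "J \<subseteq> {..<n}" and K: "K \<subseteq> {..<n}"
  shows "(\<Sum>w\<in>hyperoct n. card {f \<in> words n I. f \<circ> w = f} * card {g \<in> words n J. g \<circ> w = g} *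
      card {h \<in> words n K. h \<circ> w = h}) =
    card (hyperoct n) * card {(f, g, h). f \<in> words n I \<and> g \<in> words n J \<and> h \<in> words n K \<and> sorted_triple n f g h}"
proof -
  define T where "T = words n I \<times> words n J \<times> words n K"
  have finT: "finite T" unfolding T_def by (simp add: finite_words)
  define k where "k = (\<lambda>(f, g, h) i. lex_key n (lex_key n (f i) (h i)) (g (i::int)))"
  define act where "act = (\<lambda>(w :: int \<Rightarrow> int) (f :: int \<Rightarrow> int, g :: int \<Rightarrow> int, h :: int \<Rightarrow> int). (f \<circ> w, g \<circ> w, h \<circ> w))"
  have fin: "finite (hyperoct n)" by (rule finite_hyperoct)
  have k_odd: "k t (- i) = - k t i" if "t \<in> T" for t i
    using that unfolding T_def k_def by (auto simp: words_uminus lex_key_def algebra_simps)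
  have k_act: "k (act w t) = k t \<circ> w" for w t
    unfolding k_def act_def by (auto split: prod.splits)
  have act_T: "act w t \<in> T" if "w \<in> hyperoct n" "t \<in> T" for w t
    using that unfolding T_def act_def by (auto simp: words_comp)
  have k_inj: "s = t" if "s \<in> T" "t \<in> T" "k s = k t" for s t
  proof -
    obtain f g h where s: "s = (f, g, h)" by (cases s)
    obtain f' g' h' where t: "t = (f', g', h')" by (cases t)
    have "f i = f' i \<and> g i = g' i \<and> h i = h' i" for i
    proof -
      have "lex_key n (lex_key n (f i) (h i)) (g i) = lex_key n (lex_key n (f' i) (h' i)) (g' i)"
        using fun_cong[OF that(3), of i] unfolding k_def s t by simp
      moreover have "\<bar>h i\<bar> \<le> int n" "\<bar>h' i\<bar> \<le> int n" "\<bar>g i\<bar> \<le> int n" "\<bar>g' i\<bar> \<le> int n"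
        using that J K unfolding s t T_def by (auto intro: abs_words_le)
      ultimately show ?thesis by (simp add: lex_key_eq_iff)
    qed
    then show ?thesis unfolding s t by auto
  qed
  have fixed: "act w t = t \<longleftrightarrow> k t \<circ> w = k t" if "w \<in> hyperoct n" "t \<in> T" for w t
    using k_inj[OF act_T[OF that] that(2)] k_act[of w t] by metis
  have "(\<Sum>w\<in>hyperoct n. card {f \<in> words n I. f \<circ> w = f} * card {g \<in> words n J. g \<circ> w = g} *
      card {h \<in> words n K. h \<circ> w = h}) = (\<Sum>w\<in>hyperoct n. card {t \<in> T. act w t = t})"
  proof (rule sum.cong[OF refl])
    fix w
    have "{t \<in> T. act w t = t} = {f \<in> words n I. f \<circ> w = f} \<times> {g \<in> words n J. g \<circ> w = g} \<times> {h \<in> words n K. h \<circ> w = h}"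
      unfolding T_def act_def by auto
    then show "card {f \<in> words n I. f \<circ> w = f} * card {g \<in> words n J. g \<circ> w = g} *
      card {h \<in> words n K. h \<circ> w = h} = card {t \<in> T. act w t = t}"
      by (simp add: card_cartesian_product)
  qed
  also have "\<dots> = (\<Sum>w\<in>hyperoct n. \<Sum>t\<in>T. if act w t = t then 1 else 0)"
    by (simp add: finT sum.If_cases Int_def)
  also have "\<dots> = (\<Sum>t\<in>T. \<Sum>w\<in>hyperoct n. if act w t = t then 1 else 0)"
    by (rule sum.swap)
  also have "\<dots> = (\<Sum>t\<in>T. card {w \<in> hyperoct n. k t \<circ> w = k t})"
    by (rule sum.cong[OF refl]) (simp add: fixed fin sum.If_cases Int_def cong: conj_cong)
  also have "\<dots> = (\<Sum>t\<in>T. card {p \<in> hyperoct n. mono_on (seg n) (k t \<circ> p)})"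
    by (rule sum.cong[OF refl]) (rule card_stabilizer_eq_card_sorting, erule k_odd)
  also have "\<dots> = (\<Sum>t\<in>T. \<Sum>p\<in>hyperoct n. if mono_on (seg n) (k (act p t)) then 1 else 0)"
    by (simp add: fin sum.If_cases Int_def k_act)
  also have "\<dots> = (\<Sum>p\<in>hyperoct n. \<Sum>t\<in>T. if mono_on (seg n) (k (act p t)) then 1 else 0)"
    by (rule sum.swap)
  also have "\<dots> = (\<Sum>p\<in>hyperoct n. \<Sum>t\<in>T. if mono_on (seg n) (k t) then 1 else 0)"
  proof (rule sum.cong[OF refl])
    fix p assume p: "p \<in> hyperoct n"
    have inv1: "act (inv p) (act p t) = t" "act p (act (inv p) t) = t" for t
      unfolding act_def by (auto simp: o_assoc[symmetric] hyperoct_inv_comp[OF p] split: prod.splits)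
    show "(\<Sum>t\<in>T. if mono_on (seg n) (k (act p t)) then 1 else 0) = (\<Sum>t\<in>T. if mono_on (seg n) (k t) then 1 else (0::nat))"
      by (rule sum.reindex_bij_witness[where i = "act (inv p)" and j = "act p"])
        (auto simp: inv1 act_T p hyperoct_inv)
  qed
  also have "\<dots> = card (hyperoct n) * card {t \<in> T. mono_on (seg n) (k t)}"
    by (simp add: finT sum.If_cases Int_def)
  also have "{t \<in> T. mono_on (seg n) (k t)} =
    {(f, g, h). f \<in> words n I \<and> g \<in> words n J \<and> h \<in> words n K \<and> sorted_triple n f g h}"
    unfolding T_def k_def sorted_triple_def by auto
  finally show ?thesis .
qed

text \<open>Given \<open>p1 \<circ> p2 \<circ> p3 = id\<close>, consider three orderings of the same \<open>2 * n + 1\<close> entries, taken one from the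
  other by \<open>p1\<close>, \<open>p2\<close> and \<open>p3\<close>. That a factor has its descents in the prescribed set says that one
  ordering sorts by the letters of one word and breaks ties as the next ordering does. Following the ties
  once around the cycle, the first ordering is the lexicographic one for \<open>f\<close>, then \<open>h\<close>, then \<open>g\<close>; this
  is why the words enter \<^const>\<open>sorted_triple\<close> in that order. Conversely, a sorted triple gives back the
  factors by standardizing \<open>g\<close> and then \<open>h\<close>.\<close>

lemma card_sorted_triples:
  assumes I: "I \<subseteq> {..<n}" and J: "J \<subseteq> {..<n}" and K: "K \<subseteq> {..<n}"
  shows "card {(f, g, h). f \<in> words n I \<and> g \<in> words n J \<and> h \<in> words n K \<and> sorted_triple n f g h} =
    card {(p1, p2, p3). p1 \<in> hyperoct n \<and> p2 \<in> hyperoct n \<and> p3 \<in> hyperoct n \<and>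
      descents n p1 \<subseteq> I \<and> descents n p2 \<subseteq> J \<and> descents n p3 \<subseteq> K \<and> p1 \<circ> p2 \<circ> p3 = id}"
    (is "card ?S = card ?P")
proof -
  have fI: "finite I" and fJ: "finite J" and fK: "finite K"
    using I J K by (auto intro: finite_subset)
  let ?b = "block_word n"
  define \<Phi> where "\<Phi> = (\<lambda>(p1 :: int \<Rightarrow> int, p2 :: int \<Rightarrow> int, p3 :: int \<Rightarrow> int). (?b I, ?b J \<circ> (p3 \<circ> p1), ?b K \<circ> p1))"
  have cyc: "p2 \<circ> p3 \<circ> p1 = id \<and> p3 \<circ> p1 \<circ> p2 = id"
    if "p1 \<in> hyperoct n" "p3 \<in> hyperoct n" "p1 \<circ> p2 \<circ> p3 = id" for p1 p2 p3
  proof -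
    have "p2 \<circ> p3 = inv p1" using that hyperoct_inv_comp[OF that(1)] by (metis comp_assoc comp_id id_comp)
    moreover have "p1 \<circ> p2 = inv p3" using that hyperoct_inv_comp[OF that(2)] by (metis comp_assoc comp_id id_comp)
    ultimately show ?thesis
      using hyperoct_inv_comp[OF that(1)] hyperoct_inv_comp[OF that(2)] by (metis comp_assoc)
  qed
  have "bij_betw \<Phi> ?P ?S"
    unfolding bij_betw_def
  proof
    show "inj_on \<Phi> ?P"
    proof (rule inj_onI)
      fix s t assume st: "s \<in> ?P" "t \<in> ?P" "\<Phi> s = \<Phi> t"
      obtain p1 p2 p3 where s: "s = (p1, p2, p3)" by (cases s)
      obtain q1 q2 q3 where t: "t = (q1, q2, q3)" by (cases t)
      have p: "p1 \<in> hyperoct n" "p2 \<in> hyperoct n" "p3 \<in> hyperoct n"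
        "descents n p1 \<subseteq> I" "descents n p2 \<subseteq> J" "descents n p3 \<subseteq> K" "p1 \<circ> p2 \<circ> p3 = id"
        and q: "q1 \<in> hyperoct n" "q2 \<in> hyperoct n" "q3 \<in> hyperoct n"
        "descents n q1 \<subseteq> I" "descents n q2 \<subseteq> J" "descents n q3 \<subseteq> K" "q1 \<circ> q2 \<circ> q3 = id"
        using st(1,2) unfolding s t by auto
      have eq: "\<Phi> (p1, p2, p3) = \<Phi> (q1, q2, q3)" using st(3) unfolding s t .
      have gw: "?b J \<circ> (p3 \<circ> p1) \<in> words n J" using p by (auto simp: words_def hyperoct_comp)
      have "?b J \<circ> (p3 \<circ> p1) \<circ> p2 = ?b J" using cyc[OF p(1,3,7)] by (simp add: o_assoc[symmetric])
      moreover have "?b J \<circ> (p3 \<circ> p1) \<circ> q2 = ?b J"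
        using cyc[OF q(1,3,7)] eq unfolding \<Phi>_def by (simp add: o_assoc[symmetric])
      ultimately have e2: "p2 = q2" using standardization[OF fJ gw] p q by blast
      have hw: "?b K \<circ> p1 \<circ> p2 \<in> words n K" using p by (auto simp: words_def hyperoct_comp o_assoc[symmetric])
      have "?b K \<circ> p1 \<circ> p2 \<circ> p3 = ?b K" using p(7) by (simp add: o_assoc[symmetric])
      moreover have "?b K \<circ> p1 \<circ> p2 \<circ> q3 = ?b K"
        using q(7) eq unfolding \<Phi>_def e2 by (simp add: o_assoc[symmetric])
      ultimately have e3: "p3 = q3" using standardization[OF fK hw] p q by blast
      have "p1 = inv (p2 \<circ> p3)"
        using p(7) hyperoct_inv_comp[OF hyperoct_comp[OF p(2,3)]] by (metis comp_assoc comp_id id_comp)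
      moreover have "q1 = inv (q2 \<circ> q3)"
        using q(7) hyperoct_inv_comp[OF hyperoct_comp[OF q(2,3)]] by (metis comp_assoc comp_id id_comp)
      ultimately show "s = t" unfolding s t using e2 e3 by simp
    qed
    show "\<Phi> ` ?P = ?S"
    proof (intro equalityI subsetI)
      fix t assume "t \<in> \<Phi> ` ?P"
      then obtain p1 p2 p3 where p: "p1 \<in> hyperoct n" "p2 \<in> hyperoct n" "p3 \<in> hyperoct n"
        "descents n p1 \<subseteq> I" "descents n p2 \<subseteq> J" "descents n p3 \<subseteq> K" "p1 \<circ> p2 \<circ> p3 = id"
        and t: "t = \<Phi> (p1, p2, p3)" by auto
      have "sorted_triple n (?b I) (?b J \<circ> (p3 \<circ> p1)) (?b K \<circ> p1)"
      proof (rule sorted_tripleI)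
        fix i j assume i: "i \<in> seg n" and j: "j \<in> seg n" and ij: "i < j"
        have m1: "?b I i \<le> ?b I j" using mono_onD[OF mono_block_word[OF fI] i j] ij by simp
        have s1: "p1 i \<in> seg n" "p1 j \<in> seg n" using hyperoct_in_seg[OF p(1)] i j by auto
        have s3: "p3 (p1 i) \<in> seg n" "p3 (p1 j) \<in> seg n" using hyperoct_in_seg[OF p(3)] s1 by auto
        have m2: "p1 i < p1 j" if "?b I i = ?b I j"
          using that descents_subset_iff_increasing[OF fI p(1)] p(4) i j ij by blast
        then have m2': "?b K (p1 i) \<le> ?b K (p1 j)" if "?b I i = ?b I j"
          using mono_onD[OF mono_block_word[OF fK] s1] that by simp
        have m3: "p3 (p1 i) < p3 (p1 j)" if "?b I i = ?b I j" "?b K (p1 i) = ?b K (p1 j)"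
          using that m2 descents_subset_iff_increasing[OF fK p(3)] p(6) s1 by blast
        then have "?b J (p3 (p1 i)) \<le> ?b J (p3 (p1 j))" if "?b I i = ?b I j" "?b K (p1 i) = ?b K (p1 j)"
          using mono_onD[OF mono_block_word[OF fJ] s3] that by simp
        with m1 m2' show "?b I i < ?b I j \<or> ?b I i = ?b I j \<and> ((?b K \<circ> p1) i < (?b K \<circ> p1) j \<or>
          (?b K \<circ> p1) i = (?b K \<circ> p1) j \<and> (?b J \<circ> (p3 \<circ> p1)) i \<le> (?b J \<circ> (p3 \<circ> p1)) j)"
          by force
      qed (use J K in \<open>auto simp: abs_block_word_le\<close>)
      moreover have "?b I \<in> words n I" unfolding words_def
        by (rule image_eqI[OF _ hyperoct_id]) simp
      ultimately show "t \<in> ?S"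
        using p unfolding t \<Phi>_def by (auto simp: words_def hyperoct_comp)
    next
      fix t assume "t \<in> ?S"
      then obtain f g h where t: "t = (f, g, h)" and f: "f \<in> words n I" and g: "g \<in> words n J"
        and h: "h \<in> words n K" and srt: "sorted_triple n f g h" by auto
      note D = sorted_tripleD[OF srt abs_words_le[OF h K] abs_words_le[OF g J]]
      have "mono_on (seg n) f"
      proof (rule mono_onI)
        fix i j assume "i \<in> seg n" "j \<in> seg n" "i \<le> j"
        then show "f i \<le> f j" using D[of i j] by (cases "i = j") auto
      qed
      then have fb: "f = ?b I" by (rule mono_word_eq_block_word[OF fI f])
      obtain u where u: "u \<in> hyperoct n" "descents n u \<subseteq> J" "g \<circ> u = ?b J"
        using standardization[OF fJ g] by blast
      obtain v where v: "v \<in> hyperoct n" "descents n v \<subseteq> K" "h \<circ> u \<circ> v = ?b K"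
        using standardization[OF fK words_comp[OF h u(1)]] by blast
      define w where "w = inv (u \<circ> v)"
      have uv: "u \<circ> v \<in> hyperoct n" by (rule hyperoct_comp[OF u(1) v(1)])
      have wH: "w \<in> hyperoct n" unfolding w_def by (rule hyperoct_inv[OF uv])
      have wuv: "w \<circ> u \<circ> v = id" and uvw: "u \<circ> v \<circ> w = id"
        using hyperoct_inv_comp[OF uv] unfolding w_def by (simp_all add: o_assoc)
      have hw: "?b K \<circ> w = h" using uvw v(3) by (metis comp_assoc comp_id)
      have gw: "?b J \<circ> (v \<circ> w) = g" using uvw u(3) by (metis comp_assoc comp_id)
      have uw: "u (v (w x)) = x" for x using uvw by (metis comp_apply id_apply)
      have "descents n w \<subseteq> I"
        unfolding descents_subset_iff_increasing[OF fI wH]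
      proof (intro ballI impI)
        fix x y assume x: "x \<in> seg n" and y: "y \<in> seg n" and xy: "x < y" and eq: "?b I x = ?b I y"
        have ne: "w x \<noteq> w y" using xy uw by (metis less_irrefl)
        have ne': "v (w x) \<noteq> v (w y)" using xy uw by (metis less_irrefl)
        have s: "w x \<in> seg n" "w y \<in> seg n" using hyperoct_in_seg[OF wH] x y by auto
        have s': "v (w x) \<in> seg n" "v (w y) \<in> seg n" using hyperoct_in_seg[OF v(1)] s by auto
        have hx: "h x = ?b K (w x)" "h y = ?b K (w y)" using hw by (metis comp_apply)+
        have gx: "g x = ?b J (v (w x))" "g y = ?b J (v (w y))" using gw by (metis comp_apply)+
        have "h x < h y \<or> h x = h y \<and> g x \<le> g y" using D[OF x y xy] eq fb by auto
        then show "w x < w y"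
        proof
          assume "h x < h y"
          then show ?thesis using mono_onD[OF mono_block_word[OF fK] s(2,1)] hx by force
        next
          assume A: "h x = h y \<and> g x \<le> g y"
          have "v (w x) < v (w y)"
          proof (rule ccontr)
            assume "\<not> ?thesis"
            then have lt: "v (w y) < v (w x)" using ne' by simp
            then have "g y \<le> g x" using mono_onD[OF mono_block_word[OF fJ] s'(2,1)] gx by force
            then have "?b J (v (w y)) = ?b J (v (w x))" using A gx by simp
            then have "u (v (w y)) < u (v (w x))"
              using descents_subset_iff_increasing[OF fJ u(1)] u(2) s' lt by blast
            then show False using uw xy by simp
          qed
          moreover have "v (w y) < v (w x)" if "w y < w x"
            using descents_subset_iff_increasing[OF fK v(1)] v(2) s that A hx by metis
          ultimately show ?thesis using ne by force
        qed
      qed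
      then have "(w, u, v) \<in> ?P" using wH u v wuv by auto
      moreover have "\<Phi> (w, u, v) = t" unfolding \<Phi>_def t fb[symmetric] by (simp add: hw gw)
      ultimately show "t \<in> \<Phi> ` ?P" by blast
    qed
  qed
  from bij_betw_same_card[OF this] show ?thesis by simp
qed

section \<open>Partitions and horizontal strips\<close>

lemma part_antimono: "partition l \<Longrightarrow> i \<le> j \<Longrightarrow> part l j \<le> part l i"
  unfolding partition_def part_def
  by (cases "i = j") (auto dest: sorted_wrt_nth_less[of _ _ i j])

lemma part_pos_iff: "partition l \<Longrightarrow> 0 < part l i \<longleftrightarrow> i < length l"
  unfolding partition_def part_def by (auto simp: in_set_conv_nth)

lemma part_eq_0_iff: "partition l \<Longrightarrow> part l i = 0 \<longleftrightarrow> length l \<le> i"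
  using part_pos_iff[of l i] by auto

lemma part_Nil [simp]: "part [] i = 0"
  by (simp add: part_def)

lemma partition_Nil [simp]: "partition []"
  by (simp add: partition_def)

lemma partition_eqI:
  assumes "partition l" "partition m" "\<And>i. part l i = part m i"
  shows "l = m"
proof -
  have len: "length l = length m"
    using part_pos_iff[OF assms(1)] part_pos_iff[OF assms(2)] assms(3)
    by (metis linorder_neqE_nat less_irrefl)
  show ?thesis
  proof (rule nth_equalityI[OF len])
    fix i assume "i < length l"
    then show "l ! i = m ! i" using assms(3)[of i] len by (simp add: part_def)
  qed
qed

text \<open>Partitions are mostly handled through their row lengths \<^const>\<open>part\<close>, and this turns a sequence of row
  lengths into a list.\<close>

lemma partition_of_fun:
  fixes f :: "nat \<Rightarrow> nat"
  assumes mono: "\<And>i. f (Suc i) \<le> f i" and zero: "f M = 0"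
  obtains l where "partition l" "\<And>i. part l i = f i" "length l \<le> M"
proof -
  have anti: "f j \<le> f i" if "i \<le> j" for i j
    using that by (rule lift_Suc_antimono_le[of f, OF mono])
  define m where "m = (LEAST i. f i = 0)"
  have fm: "f m = 0" unfolding m_def using zero by (rule LeastI)
  have less: "0 < f i" if "i < m" for i
    using that not_less_Least[of i "\<lambda>i. f i = 0"] unfolding m_def by auto
  have ge: "f i = 0" if "m \<le> i" for i
    using anti[OF that] fm by simp
  let ?l = "map f [0..<m]"
  have "partition ?l"
    unfolding partition_def sorted_wrt_iff_nth_less using less anti by fastforce
  moreover have "part ?l i = f i" for i
    using ge[of i] by (auto simp: part_def)
  moreover have "length ?l \<le> M"
    using Least_le[of "\<lambda>i. f i = 0", OF zero] unfolding m_def by simp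
  ultimately show ?thesis using that by blast
qed

lemma diagram_part: "diagram l = {(i, j). j < part l i}"
  by (auto simp: diagram_def part_def split: if_splits)

lemma sum_list_part:
  assumes "length l \<le> M"
  shows "sum_list l = (\<Sum>i<M. part l i)"
proof -
  have "sum_list l = (\<Sum>i<length l. part l i)"
    by (simp add: sum_list_sum_nth part_def atLeast0LessThan)
  also have "\<dots> = (\<Sum>i<M. part l i)"
    by (rule sum.mono_neutral_left) (use assms in \<open>auto simp: part_def\<close>)
  finally show ?thesis .
qed

lemma finite_diagram: "finite (diagram l)"
proof -
  have "diagram l = Sigma {..<length l} (\<lambda>i. {..<l ! i})"
    by (auto simp: diagram_def)
  then show ?thesis by simp
qed

lemma card_diagram: "card (diagram l) = sum_list l"
proof -
  have "diagram l = Sigma {..<length l} (\<lambda>i. {..<l ! i})"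
    by (auto simp: diagram_def)
  then show ?thesis by (simp add: sum_list_sum_nth atLeast0LessThan)
qed

lemma partition_eq_iff_diagram:
  assumes "partition l" "partition m"
  shows "l = m \<longleftrightarrow> diagram l = diagram m"
proof
  assume d: "diagram l = diagram m"
  have "part l i = part m i" for i
  proof -
    have "{j. j < part l i} = {j. j < part m i}"
      using d unfolding diagram_part by auto
    then show ?thesis by (metis lessThan_def lessThan_eq_iff)
  qed
  then show "l = m" by (rule partition_eqI[OF assms])
qed simp

lemma order_ideal_diagram:
  assumes l: "partition l" and D: "D \<subseteq> diagram l"
    and closed: "\<And>i j i' j'. (i, j) \<in> D \<Longrightarrow> i' \<le> i \<Longrightarrow> j' \<le> j \<Longrightarrow> (i', j') \<in> D"
  obtains m where "partition m" "diagram m = D"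
proof -
  define f where "f i = card {j. (i, j) \<in> D}" for i
  have seg: "{j. (i, j) \<in> D} = {..<f i}" for i
  proof -
    let ?A = "{j. (i, j) \<in> D}"
    have "?A \<subseteq> {..<part l i}" using D by (auto simp: diagram_part)
    then have fin: "finite ?A" by (rule finite_subset) simp
    have "\<exists>k. ?A = {..<k}"
    proof (cases "?A = {}")
      case True
      then have "?A = {..<0}" unfolding lessThan_0 .
      then show ?thesis by blast
    next
      case False
      have "?A = {..<Suc (Max ?A)}"
      proof (intro equalityI subsetI)
        fix j assume "j \<in> ?A"
        then show "j \<in> {..<Suc (Max ?A)}" using Max_ge[OF fin] by (simp add: less_Suc_eq_le del: mem_Collect_eq)
      next
        fix j assume "j \<in> {..<Suc (Max ?A)}"
        then show "j \<in> ?A" using closed[of i "Max ?A" i j] Max_in[OF fin False] by (simp add: less_Suc_eq_le)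
      qed
      then show ?thesis by blast
    qed
    then obtain k where "?A = {..<k}" by blast
    then show ?thesis unfolding f_def by simp
  qed
  have iff: "(i, j) \<in> D \<longleftrightarrow> j < f i" for i j using seg[of i] by auto
  have mono: "f (Suc i) \<le> f i" for i
  proof (rule ccontr)
    assume "\<not> f (Suc i) \<le> f i"
    then have "(Suc i, f i) \<in> D" by (simp add: iff)
    then have "(i, f i) \<in> D" by (rule closed) auto
    then show False by (simp add: iff)
  qed
  have "f (length l) = 0"
  proof (rule ccontr)
    assume "f (length l) \<noteq> 0"
    then have "(length l, 0) \<in> diagram l" using D iff by blast
    then show False by (simp add: diagram_def)
  qed
  then obtain m where m: "partition m" "\<And>i. part m i = f i"
    using partition_of_fun[of f, OF mono] by metis
  then have "diagram m = D" using iff by (auto simp: diagram_part)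
  then show ?thesis using that m by blast
qed

lemma finite_partitions: "finite {l. partition l \<and> sum_list l \<le> n}"
proof (rule finite_subset)
  show "{l. partition l \<and> sum_list l \<le> n} \<subseteq> {l. set l \<subseteq> {..n} \<and> length l \<le> n}"
  proof clarify
    fix l assume l: "partition l" "sum_list l \<le> n"
    have "set l \<subseteq> {..n}" using l(2) member_le_sum_list[of _ l] by fastforce
    moreover have "length l \<le> sum_list l"
      using l(1) by (induction l) (auto simp: partition_def)
    ultimately show "set l \<subseteq> {..n} \<and> length l \<le> n" using l(2) by simp
  qed
qed (rule finite_lists_length_le, simp)

text \<open>The skew shape has at most one box in each column, expressed by interlacing row lengths.\<close>

definition hstrip :: "nat list \<Rightarrow> nat list \<Rightarrow> bool" where
  "hstrip m l \<longleftrightarrow> partition m \<and> partition l \<and> (\<forall>i. part l (Suc i) \<le> part m i \<and> part m i \<le> part l i)"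

lemma hstripD:
  assumes "hstrip m l"
  shows "partition m" "partition l" "part l (Suc i) \<le> part m i" "part m i \<le> part l i"
  using assms by (auto simp: hstrip_def)

lemma hstrip_length:
  assumes "hstrip m l"
  shows "length m \<le> length l" "length l \<le> Suc (length m)"
proof -
  show "length m \<le> length l"
    using hstripD(4)[OF assms, of "length l"] part_eq_0_iff[OF hstripD(1)[OF assms], of "length l"]
    by (simp add: part_def)
  show "length l \<le> Suc (length m)"
    using hstripD(3)[OF assms, of "length m"] part_eq_0_iff[OF hstripD(2)[OF assms], of "Suc (length m)"]
    by (simp add: part_def)
qed

lemma hstrip_sum_list_le:
  assumes "hstrip m l"
  shows "sum_list m \<le> sum_list l"
  unfolding sum_list_part[OF hstrip_length(1)[OF assms]] sum_list_part[OF order.refl, of l]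
  by (intro sum_mono hstripD(4)[OF assms])

lemma hstrip_sum_list_eq:
  assumes "hstrip m l" "sum_list m = sum_list l"
  shows "m = l"
proof (rule partition_eqI)
  show "partition m" "partition l" using hstripD[OF assms(1)] by auto
  fix i
  have eq: "(\<Sum>i<length l. part m i) = (\<Sum>i<length l. part l i)"
    using assms(2) sum_list_part[OF hstrip_length(1)[OF assms(1)]] sum_list_part[OF order.refl, of l] by simp
  have le: "part m j \<le> part l j" for j by (rule hstripD(4)[OF assms(1)])
  show "part m i = part l i"
  proof (cases "i < length l")
    case True
    show ?thesis
      using sum_mono_inv[OF eq] le True by auto
  next
    case False
    then show ?thesis using le[of i] by (simp add: part_def)
  qed
qed

lemma hstrip_refl: "partition l \<Longrightarrow> hstrip l l"
  by (simp add: hstrip_def part_antimono)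

lemma finite_hstrip: "finite {m. hstrip m l}"
  by (rule finite_subset[OF _ finite_partitions[of "sum_list l"]])
    (auto simp: hstrip_sum_list_le dest: hstripD)

section \<open>Branching of Schur polynomials and Kostka numbers\<close>

lemma semistandard_tableaux_0:
  "semistandard_tableaux 0 l = (if diagram l = {} then {\<lambda>_. undefined} else {})"
  unfolding semistandard_tableaux_def by (auto simp: PiE_eq_empty_iff)

lemma diagram_empty_iff: "partition l \<Longrightarrow> diagram l = {} \<longleftrightarrow> l = []"
  by (metis card_diagram card.empty card_0_eq finite_diagram partition_Nil partition_eq_iff_diagram
      sum_list.Nil)

lemma schur_0:
  assumes "partition l"
  shows "schur 0 x l = (if l = [] then 1 else 0)"
  using diagram_empty_iff[OF assms] diagram_empty_iff[of "[]"]
  by (auto simp: schur_def semistandard_tableaux_0)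

lemma finite_semistandard_tableaux: "finite (semistandard_tableaux N l)"
  by (rule finite_subset[of _ "diagram l \<rightarrow>\<^sub>E {..<N}"])
    (auto simp: semistandard_tableaux_def intro!: finite_PiE finite_diagram)

lemma diagram_closed:
  assumes "partition l" "(i, j) \<in> diagram l" "i' \<le> i" "j' \<le> j"
  shows "(i', j') \<in> diagram l"
  using assms part_antimono[OF assms(1,3)] by (auto simp: diagram_part)

lemma hstrip_diagram_subset: "hstrip m l \<Longrightarrow> diagram m \<subseteq> diagram l"
  by (auto simp: diagram_part intro: less_le_trans hstripD(4))

text \<open>Used for semistandard tableaux, where the new boxes form a horizontal strip, and for domino tableaux,
  where they form one domino.\<close>

definition extend_tableau :: "nat \<Rightarrow> nat list \<Rightarrow> nat list \<Rightarrow> (nat \<times> nat \<Rightarrow> nat) \<Rightarrow> nat \<times> nat \<Rightarrow> nat" where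
  "extend_tableau N m l T = (\<lambda>c. if c \<in> diagram m then T c else if c \<in> diagram l then N else undefined)"

lemma extend_tableau_semistandard:
  assumes ml: "hstrip m l" and T: "T \<in> semistandard_tableaux N m"
  shows "extend_tableau N m l T \<in> semistandard_tableaux (Suc N) l"
proof -
  note sub = hstrip_diagram_subset[OF ml]
  note m = hstripD(1)[OF ml]
  have Tl: "T c < N" if "c \<in> diagram m" for c
    using T that by (auto simp: semistandard_tableaux_def dest: PiE_mem)
  have row: "T (i, j) \<le> T (i, j')" if "j \<le> j'" "(i, j') \<in> diagram m" for i j j'
    using T that by (auto simp: semistandard_tableaux_def)
  have col: "T (i, j) < T (i', j)" if "i < i'" "(i', j) \<in> diagram m" for i i' j
    using T that by (auto simp: semistandard_tableaux_def)
  have strip: "(i, j) \<in> diagram m" if "i < i'" "(i', j) \<in> diagram l" for i i' j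
  proof -
    have "part l i' \<le> part l (Suc i)" using that by (intro part_antimono hstripD(2)[OF ml]) auto
    also have "\<dots> \<le> part m i" by (rule hstripD(3)[OF ml])
    finally show ?thesis using that by (auto simp: diagram_part)
  qed
  show ?thesis
    unfolding semistandard_tableaux_def
  proof (intro CollectI conjI allI impI)
    show "extend_tableau N m l T \<in> diagram l \<rightarrow>\<^sub>E {..<Suc N}"
      using sub Tl by (auto simp: extend_tableau_def less_Suc_eq PiE_iff extensional_def)
  next
    fix i j j' :: nat assume le: "j \<le> j'" and l: "(i, j') \<in> diagram l"
    have "(i, j) \<in> diagram l" using diagram_closed[OF hstripD(2)[OF ml] l order.refl le] .
    then show "extend_tableau N m l T (i, j) \<le> extend_tableau N m l T (i, j')"
      using l row[OF le] Tl diagram_closed[OF m _ order.refl le] sub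
      by (auto simp: extend_tableau_def intro: less_imp_le)
  next
    fix i i' j :: nat assume le: "i < i'" and l: "(i', j) \<in> diagram l"
    then show "extend_tableau N m l T (i, j) < extend_tableau N m l T (i', j)"
      using strip[OF le l] col[OF le] Tl by (auto simp: extend_tableau_def)
  qed
qed

lemma semistandard_restrict:
  assumes l: "partition l" and T: "T \<in> semistandard_tableaux (Suc N) l"
  obtains m where "hstrip m l" "diagram m = {c \<in> diagram l. T c < N}"
    "restrict T (diagram m) \<in> semistandard_tableaux N m"
proof -
  have Tl: "T c \<le> N" if "c \<in> diagram l" for c
  proof -
    have "T \<in> diagram l \<rightarrow>\<^sub>E {..<Suc N}" using T by (simp add: semistandard_tableaux_def)
    from PiE_mem[OF this that] show ?thesis by simp
  qed
  have row: "T (i, j) \<le> T (i, j')" if "j \<le> j'" "(i, j') \<in> diagram l" for i j j'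
    using T that by (auto simp: semistandard_tableaux_def)
  have col: "T (i, j) < T (i', j)" if "i < i'" "(i', j) \<in> diagram l" for i i' j
    using T that by (auto simp: semistandard_tableaux_def)
  define D where "D = {c \<in> diagram l. T c < N}"
  have closed: "(i', j') \<in> D" if "(i, j) \<in> D" "i' \<le> i" "j' \<le> j" for i j i' j'
  proof -
    have ij: "(i, j) \<in> diagram l" "T (i, j) < N" using that(1) by (auto simp: D_def)
    have d: "(i, j') \<in> diagram l" "(i', j') \<in> diagram l"
      using diagram_closed[OF l ij(1)] that by auto
    have "T (i', j') \<le> T (i, j')" using col[of i' i j'] d that(2) by (cases "i' = i") auto
    moreover have "T (i, j') \<le> T (i, j)" using row[OF that(3)] ij by blast
    ultimately show ?thesis using ij d by (simp add: D_def)
  qed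
  obtain m where m: "partition m" "diagram m = D"
  proof (rule order_ideal_diagram[OF l, of D])
    show "D \<subseteq> diagram l" by (auto simp: D_def)
    show "(i', j') \<in> D" if "(i, j) \<in> D" "i' \<le> i" "j' \<le> j" for i j i' j'
      using closed[OF that] .
  qed
  have mem: "j < part m i \<longleftrightarrow> j < part l i \<and> T (i, j) < N" for i j
  proof -
    have "(i, j) \<in> diagram m \<longleftrightarrow> (i, j) \<in> D" by (simp only: m(2))
    then show ?thesis by (simp add: diagram_part D_def)
  qed
  have h: "hstrip m l"
    unfolding hstrip_def
  proof (intro conjI allI m(1) l)
    fix i
    show "part m i \<le> part l i" using mem[of "part l i" i] by (simp add: not_less[symmetric])
    show "part l (Suc i) \<le> part m i"
    proof (rule ccontr)
      assume "\<not> part l (Suc i) \<le> part m i"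
      then have lt: "part m i < part l (Suc i)" by simp
      have "T (i, part m i) < T (Suc i, part m i)" using lt by (intro col) (auto simp: diagram_part)
      then have "T (i, part m i) < N" using Tl[of "(Suc i, part m i)"] lt by (auto simp: diagram_part)
      moreover have "part m i < part l i" using lt part_antimono[OF l, of i "Suc i"] by simp
      ultimately show False using mem[of "part m i" i] by simp
    qed
  qed
  have d: "diagram m = {c \<in> diagram l. T c < N}" unfolding m(2) D_def ..
  have "restrict T (diagram m) \<in> semistandard_tableaux N m"
    unfolding semistandard_tableaux_def
  proof (intro CollectI conjI allI impI)
    show "restrict T (diagram m) \<in> diagram m \<rightarrow>\<^sub>E {..<N}" using d by auto
  next
    fix i j j' :: nat assume a: "j \<le> j'" "(i, j') \<in> diagram m"
    then show "restrict T (diagram m) (i, j) \<le> restrict T (diagram m) (i, j')"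
      using diagram_closed[OF m(1) a(2) order.refl a(1)] row[OF a(1)] d by auto
  next
    fix i i' j :: nat assume a: "i < i'" "(i', j) \<in> diagram m"
    then show "restrict T (diagram m) (i, j) < restrict T (diagram m) (i', j)"
      using diagram_closed[OF m(1) a(2) _ order.refl, of i] col[OF a(1)] d by auto
  qed
  then show ?thesis using that h d by blast
qed

text \<open>The branching rule: the boxes with the largest letter form a horizontal strip, and removing them leaves a
  tableau in the other letters.\<close>

lemma schur_Suc:
  assumes l: "partition l"
  shows "schur (Suc N) x l = (\<Sum>m | hstrip m l. schur N x m * x N ^ (sum_list l - sum_list m))"
proof -
  let ?S = "SIGMA m:{m. hstrip m l}. semistandard_tableaux N m"
  have dm: "{c \<in> diagram l. extend_tableau N m l T c < N} = diagram m"
    if "hstrip m l" "T \<in> semistandard_tableaux N m" for m T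
    using that hstrip_diagram_subset[OF that(1)]
    by (auto simp: extend_tableau_def semistandard_tableaux_def split: if_splits dest: PiE_mem)
  have bij: "bij_betw (\<lambda>(m, T). extend_tableau N m l T) ?S (semistandard_tableaux (Suc N) l)"
    unfolding bij_betw_def
  proof
    show "inj_on (\<lambda>(m, T). extend_tableau N m l T) ?S"
    proof (rule inj_onI, clarify)
      fix m T m' T'
      assume a: "hstrip m l" "T \<in> semistandard_tableaux N m" "hstrip m' l" "T' \<in> semistandard_tableaux N m'"
        and eq: "extend_tableau N m l T = extend_tableau N m' l T'"
      have "diagram m = diagram m'" using dm[OF a(1,2)] dm[OF a(3,4)] eq by simp
      then have m: "m = m'" using partition_eq_iff_diagram hstripD(1) a by blast
      have "T c = T' c" for c
      proof (cases "c \<in> diagram m")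
        case True then show ?thesis using fun_cong[OF eq, of c] m by (simp add: extend_tableau_def)
      next
        case False
        have "T \<in> diagram m \<rightarrow>\<^sub>E {..<N}" "T' \<in> diagram m \<rightarrow>\<^sub>E {..<N}"
          using a(2,4) m by (auto simp: semistandard_tableaux_def)
        from PiE_arb[OF this(1) False] PiE_arb[OF this(2) False] show ?thesis by simp
      qed
      then show "m = m' \<and> T = T'" using m by auto
    qed
    show "(\<lambda>(m, T). extend_tableau N m l T) ` ?S = semistandard_tableaux (Suc N) l"
    proof (intro equalityI subsetI)
      fix T assume T: "T \<in> semistandard_tableaux (Suc N) l"
      obtain m where m: "hstrip m l" "diagram m = {c \<in> diagram l. T c < N}"
        "restrict T (diagram m) \<in> semistandard_tableaux N m"
        using semistandard_restrict[OF l T] by blast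
      have "T = extend_tableau N m l (restrict T (diagram m))"
      proof
        fix c
        have "T c < Suc N" if "c \<in> diagram l"
          using T that by (auto simp: semistandard_tableaux_def dest: PiE_mem)
        moreover have "T c = undefined" if "c \<notin> diagram l"
          using T that by (auto simp: semistandard_tableaux_def dest: PiE_arb)
        ultimately show "T c = extend_tableau N m l (restrict T (diagram m)) c"
        proof -
          assume "c \<in> diagram l \<Longrightarrow> T c < Suc N" "c \<notin> diagram l \<Longrightarrow> T c = undefined"
          moreover have "c \<in> diagram m \<longleftrightarrow> c \<in> diagram l \<and> T c < N" by (simp only: m(2) mem_Collect_eq)
          ultimately show ?thesis unfolding extend_tableau_def restrict_def
            by (cases "c \<in> diagram m"; cases "c \<in> diagram l") simp_all
        qed
      qed
      then show "T \<in> (\<lambda>(m, T). extend_tableau N m l T) ` ?S" using m by force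
    qed (auto simp: extend_tableau_semistandard)
  qed
  have "schur (Suc N) x l = (\<Sum>(m, T)\<in>?S. \<Prod>c\<in>diagram l. x (extend_tableau N m l T c))"
    unfolding schur_def by (subst sum.reindex_bij_betw[OF bij, symmetric]) (simp add: case_prod_unfold)
  also have "\<dots> = (\<Sum>m | hstrip m l. \<Sum>T\<in>semistandard_tableaux N m. \<Prod>c\<in>diagram l. x (extend_tableau N m l T c))"
    by (subst sum.Sigma) (auto simp: finite_hstrip finite_semistandard_tableaux)
  also have "\<dots> = (\<Sum>m | hstrip m l. \<Sum>T\<in>semistandard_tableaux N m. (\<Prod>c\<in>diagram m. x (T c)) * x N ^ (sum_list l - sum_list m))"
  proof (intro sum.cong refl)
    fix m T assume "m \<in> {m. hstrip m l}"
    then have m: "hstrip m l" by simp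
    note sub = hstrip_diagram_subset[OF m]
    have "(\<Prod>c\<in>diagram l. x (extend_tableau N m l T c)) =
      (\<Prod>c\<in>diagram m. x (extend_tableau N m l T c)) * (\<Prod>c\<in>diagram l - diagram m. x (extend_tableau N m l T c))"
      by (subst prod.subset_diff[OF sub finite_diagram]) (simp add: mult.commute)
    also have "(\<Prod>c\<in>diagram m. x (extend_tableau N m l T c)) = (\<Prod>c\<in>diagram m. x (T c))"
      by (intro prod.cong refl) (simp add: extend_tableau_def)
    also have "(\<Prod>c\<in>diagram l - diagram m. x (extend_tableau N m l T c)) = (\<Prod>c\<in>diagram l - diagram m. x N)"
      by (intro prod.cong refl) (simp add: extend_tableau_def)
    also have "\<dots> = x N ^ (sum_list l - sum_list m)"
      using sub by (simp add: card_Diff_subset finite_diagram card_diagram)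
    finally show "(\<Prod>c\<in>diagram l. x (extend_tableau N m l T c)) = (\<Prod>c\<in>diagram m. x (T c)) * x N ^ (sum_list l - sum_list m)" .
  qed
  finally show ?thesis unfolding schur_def by (simp add: sum_distrib_right)
qed

text \<open>The number of semistandard tableaux of shape \<open>l\<close> with \<open>\<alpha> i\<close> entries \<open>i\<close>, in the form supplied by the
  branching rule.\<close>

primrec kostka :: "nat \<Rightarrow> nat list \<Rightarrow> (nat \<Rightarrow> nat) \<Rightarrow> nat" where
  "kostka 0 l \<alpha> = (if l = [] then 1 else 0)"
| "kostka (Suc N) l \<alpha> = (\<Sum>m | hstrip m l \<and> sum_list l = sum_list m + \<alpha> N. kostka N m \<alpha>)"

lemma kostka_cong: "(\<And>i. i < N \<Longrightarrow> \<alpha> i = \<beta> i) \<Longrightarrow> kostka N l \<alpha> = kostka N l \<beta>"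
  by (induction N arbitrary: l) auto

lemma finite_hstrip_conj: "finite {m. hstrip m l \<and> P m}"
  by (rule finite_subset[OF _ finite_hstrip[of l]]) auto

text \<open>Letters below \<open>k\<close> only fit into the first \<open>k\<close> rows, whence the dominance order.\<close>

lemma kostka_nonzero:
  assumes "kostka N l \<alpha> \<noteq> 0"
  shows "length l \<le> N \<and> sum_list l = (\<Sum>i<N. \<alpha> i) \<and> (\<forall>k\<le>N. (\<Sum>i<k. \<alpha> i) \<le> (\<Sum>i<k. part l i))"
  using assms
proof (induction N arbitrary: l)
  case (Suc N)
  then obtain m where m: "hstrip m l" "sum_list l = sum_list m + \<alpha> N" "kostka N m \<alpha> \<noteq> 0"
    by (auto simp: sum_eq_0_iff finite_hstrip_conj)
  note IH = Suc.IH[OF m(3)]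
  have len: "length l \<le> Suc N" using hstrip_length[OF m(1)] IH by simp
  have sl: "sum_list l = (\<Sum>i<Suc N. \<alpha> i)" using IH m(2) by simp
  have "(\<Sum>i<k. \<alpha> i) \<le> (\<Sum>i<k. part l i)" if "k \<le> Suc N" for k
  proof (cases "k = Suc N")
    case True
    then show ?thesis using sl sum_list_part[OF len] by simp
  next
    case False
    then have "(\<Sum>i<k. \<alpha> i) \<le> (\<Sum>i<k. part m i)" using IH that by simp
    also have "\<dots> \<le> (\<Sum>i<k. part l i)" by (intro sum_mono hstripD(4)[OF m(1)])
    finally show ?thesis .
  qed
  then show ?case using len sl by blast
qed (auto split: if_splits)

lemma kostka_Suc_eq:
  assumes "partition l" "\<alpha> N = 0"
  shows "kostka (Suc N) l \<alpha> = kostka N l \<alpha>"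
proof -
  have "{m. hstrip m l \<and> sum_list l = sum_list m + \<alpha> N} = {l}"
    using assms hstrip_sum_list_eq[of _ l] hstrip_refl[OF assms(1)] by auto
  then show ?thesis by simp
qed

lemma kostka_stable:
  assumes "partition l" "N \<le> N'" "\<And>i. N \<le> i \<Longrightarrow> i < N' \<Longrightarrow> \<alpha> i = 0"
  shows "kostka N' l \<alpha> = kostka N l \<alpha>"
  using assms(2,3)
proof (induction N' rule: dec_induct)
  case (step k)
  then have "kostka k l \<alpha> = kostka N l \<alpha>" by simp
  then show ?case using kostka_Suc_eq[OF assms(1), of \<alpha> k] step by (simp del: kostka.simps)
qed simp

lemma kostka_diag:
  assumes "partition l" "length l \<le> N"
  shows "kostka N l (part l) = 1"
  using assms
proof (induction N arbitrary: l)
  case (Suc N)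
  have anti: "(if Suc i < N then part l (Suc i) else 0) \<le> (if i < N then part l i else 0)" for i
    using part_antimono[OF Suc.prems(1), of i "Suc i"] by simp
  obtain m where m: "partition m" "\<And>i. part m i = (if i < N then part l i else 0)"
    using partition_of_fun[of "\<lambda>i. if i < N then part l i else 0" N, OF anti] by auto
  have mN: "length m \<le> N" using m(2)[of N] part_eq_0_iff[OF m(1), of N] by simp
  have ml: "hstrip m l"
    unfolding hstrip_def using m Suc.prems part_antimono[OF Suc.prems(1)] part_eq_0_iff[OF Suc.prems(1)]
    by auto
  have sm: "sum_list l = sum_list m + part l N"
    by (simp add: sum_list_part[OF Suc.prems(2)] sum_list_part[OF mN] m(2))
  have km: "kostka N m (part l) = 1"
  proof -
    have "kostka N m (part l) = kostka N m (part m)" by (rule kostka_cong) (simp add: m(2))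
    then show ?thesis using Suc.IH[OF m(1) mN] by simp
  qed
  have other: "kostka N q (part l) = 0"
    if q: "q \<in> {q. hstrip q l \<and> sum_list l = sum_list q + part l N} - {m}" for q
  proof (rule ccontr)
    assume nz: "kostka N q (part l) \<noteq> 0"
    note q' = kostka_nonzero[OF nz]
    have le: "part q i \<le> part l i" for i using q hstripD(4) by blast
    have "(\<Sum>i<N. part q i) = (\<Sum>i<N. part l i)" using q' sum_list_part[of q N] by simp
    then have eq: "part q i = part l i" if "i < N" for i
      using sum_mono_inv[of "part q" "{..<N}" "part l"] le that by auto
    have "part q i = part m i" for i
      using eq[of i] q' m(2)[of i] by (auto simp: part_def)
    then have "q = m" using q hstripD(1) m(1) partition_eqI by blast
    then show False using q by simp
  qed
  have "kostka (Suc N) l (part l) = kostka N m (part l)"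
    unfolding kostka.simps by (subst sum.remove[OF finite_hstrip_conj, of m]) (use ml sm other in auto)
  then show ?case using km by simp
qed auto

section \<open>Symmetry of Kostka numbers\<close>

definition between_lo :: "nat list \<Rightarrow> nat list \<Rightarrow> nat \<Rightarrow> nat" where
  "between_lo m l i = max (part m i) (part l (Suc i))"

definition between_hi :: "nat list \<Rightarrow> nat list \<Rightarrow> nat \<Rightarrow> nat" where
  "between_hi m l i = (case i of 0 \<Rightarrow> part l 0 | Suc j \<Rightarrow> min (part l i) (part m j))"

lemma between_iff:
  assumes "partition q" "partition m" "partition l"
  shows "hstrip m q \<and> hstrip q l \<longleftrightarrow> (\<forall>i. between_lo m l i \<le> part q i \<and> part q i \<le> between_hi m l i)"
    (is "?L = ?R")
proof
  assume L: ?L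
  show ?R
  proof
    fix i show "between_lo m l i \<le> part q i \<and> part q i \<le> between_hi m l i"
      using L by (cases i) (auto simp: between_lo_def between_hi_def hstrip_def)
  qed
next
  assume R: ?R
  have "part m i \<le> part q i" "part l (Suc i) \<le> part q i" for i
    using R[rule_format, of i] by (auto simp: between_lo_def)
  moreover have "part q i \<le> part l i" for i
    using R[rule_format, of i] by (cases i) (auto simp: between_hi_def)
  moreover have "part q (Suc i) \<le> part m i" for i
    using R[rule_format, of "Suc i"] by (auto simp: between_hi_def)
  ultimately show ?L using assms by (simp add: hstrip_def)
qed

text \<open>The Bender-Knuth involution in terms of row lengths. The shapes between \<open>m\<close> and \<open>l\<close> are given by
  choosing each row length independently in an interval, and reflecting all intervals exchanges the
  sizes of the two strips, because the interval ends add up to the sizes of \<open>m\<close> and \<open>l\<close>.\<close>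

lemma reflect_between:
  assumes m: "partition m" and l: "partition l" and q: "hstrip m q" "hstrip q l"
  obtains q' where "hstrip m q'" "hstrip q' l"
    "\<And>i. part q' i = between_lo m l i + between_hi m l i - part q i"
    "sum_list q + sum_list q' = sum_list m + sum_list l"
proof -
  have pq: "partition q" using q hstripD by blast
  let ?lo = "between_lo m l" and ?hi = "between_hi m l"
  have b: "?lo i \<le> part q i \<and> part q i \<le> ?hi i" for i
    using between_iff[OF pq m l] q by blast
  define f where "f i = ?lo i + ?hi i - part q i" for i
  have fb: "?lo i \<le> f i \<and> f i \<le> ?hi i" for i using b[of i] unfolding f_def by auto
  have "f (Suc i) \<le> f i" for i
    using fb[of i] fb[of "Suc i"] by (auto simp: between_lo_def between_hi_def)
  moreover have "f (length l) = 0"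
    using fb[of "length l"] by (cases "length l") (auto simp: between_hi_def part_def)
  ultimately obtain q' where q': "partition q'" "\<And>i. part q' i = f i" "length q' \<le> length l"
    using partition_of_fun[of f "length l"] by metis
  have h: "hstrip m q' \<and> hstrip q' l" using between_iff[OF q'(1) m l] fb q'(2) by simp
  let ?M = "length l"
  have tel: "(\<Sum>i<M. ?lo i + ?hi i) + ?hi M = (\<Sum>i<M. part m i) + (\<Sum>i<Suc M. part l i)" for M
  proof (induction M)
    case 0 show ?case by (simp add: between_hi_def)
  next
    case (Suc M)
    have "?lo M + ?hi (Suc M) = part l (Suc M) + part m M"
      by (auto simp: between_lo_def between_hi_def max_def min_def)
    then show ?case using Suc by simp
  qed
  have "?hi ?M = 0" by (cases ?M) (auto simp: between_hi_def part_def)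
  then have "(\<Sum>i<?M. ?lo i + ?hi i) = (\<Sum>i<?M. part m i) + (\<Sum>i<?M. part l i)"
    using tel[of ?M] by (simp add: part_def)
  moreover have "(\<Sum>i<?M. part q i) + (\<Sum>i<?M. part q' i) = (\<Sum>i<?M. ?lo i + ?hi i)"
    unfolding sum.distrib[symmetric]
  proof (intro sum.cong refl)
    fix x show "part q x + part q' x = ?lo x + ?hi x" using b[of x] unfolding q'(2) f_def by linarith
  qed
  moreover have "length q \<le> ?M" "length m \<le> ?M"
    using hstrip_length[OF q(1)] hstrip_length[OF q(2)] by auto
  ultimately have "sum_list q + sum_list q' = sum_list m + sum_list l"
    using q'(3) sum_list_part[of q ?M] sum_list_part[of q' ?M] sum_list_part[of m ?M] sum_list_part[of l ?M] by simp
  then show ?thesis using that h q'(2) unfolding f_def by blast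
qed

lemma card_between_swap:
  assumes m: "partition m" and l: "partition l"
  shows "card {q. hstrip m q \<and> hstrip q l \<and> sum_list l = sum_list q + a \<and> sum_list q = sum_list m + b} \<le>
    card {q. hstrip m q \<and> hstrip q l \<and> sum_list l = sum_list q + b \<and> sum_list q = sum_list m + a}"
    (is "card ?A \<le> card ?B")
proof -
  have "\<forall>q\<in>?A. \<exists>q'\<in>?B. \<forall>i. part q' i = between_lo m l i + between_hi m l i - part q i"
  proof
    fix q assume q: "q \<in> ?A"
    obtain q' where "hstrip m q'" "hstrip q' l"
      "\<And>i. part q' i = between_lo m l i + between_hi m l i - part q i"
      "sum_list q + sum_list q' = sum_list m + sum_list l"
      using reflect_between[OF m l] q by blast
    then show "\<exists>q'\<in>?B. \<forall>i. part q' i = between_lo m l i + between_hi m l i - part q i"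
      using q by auto
  qed
  from bchoice[OF this[unfolded Bex_def]] obtain r where
    r': "\<forall>q\<in>?A. r q \<in> ?B \<and> (\<forall>i. part (r q) i = between_lo m l i + between_hi m l i - part q i)"
    by blast
  have r: "r q \<in> ?B" "part (r q) i = between_lo m l i + between_hi m l i - part q i" if "q \<in> ?A" for q i
    using bspec[OF r' that] by blast+
  have "inj_on r ?A"
  proof (rule inj_onI)
    fix q q' assume q: "q \<in> ?A" "q' \<in> ?A" "r q = r q'"
    have p: "partition q" "partition q'" using q hstripD by blast+
    have "part q i = part q' i" for i
    proof -
      have "part q i \<le> between_hi m l i" "part q' i \<le> between_hi m l i"
        using between_iff[OF p(1) m l] between_iff[OF p(2) m l] q by blast+
      then show ?thesis using r(2)[OF q(1), of i] r(2)[OF q(2), of i] q(3) by simp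
    qed
    then show "q = q'" by (rule partition_eqI[OF p])
  qed
  moreover have "finite ?B"
    by (rule finite_subset[OF _ finite_hstrip[of l]]) auto
  moreover have "r ` ?A \<subseteq> ?B" using r(1) by (rule image_subsetI)
  ultimately show ?thesis by (intro card_inj_on_le[of r])
qed

lemma kostka_swap_last:
  assumes l: "partition l"
  shows "kostka (Suc (Suc N)) l \<alpha> = kostka (Suc (Suc N)) l (\<alpha>(N := \<alpha> (Suc N), Suc N := \<alpha> N))"
proof -
  let ?M = "{m. partition m \<and> sum_list m \<le> sum_list l}"
  let ?C = "\<lambda>a b m. {q. hstrip m q \<and> hstrip q l \<and> sum_list l = sum_list q + a \<and> sum_list q = sum_list m + b}"
  have fin: "finite ?M" by (rule finite_partitions)
  have key: "kostka (Suc (Suc N)) l \<beta> = (\<Sum>m\<in>?M. card (?C (\<beta> (Suc N)) (\<beta> N) m) * kostka N m \<beta>)" for \<beta>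
  proof -
    let ?Q = "{q. hstrip q l \<and> sum_list l = sum_list q + \<beta> (Suc N)}"
    have finQ: "finite ?Q" by (rule finite_hstrip_conj)
    have "kostka (Suc (Suc N)) l \<beta> = (\<Sum>q\<in>?Q. \<Sum>m | hstrip m q \<and> sum_list q = sum_list m + \<beta> N. kostka N m \<beta>)"
      by simp
    also have "\<dots> = (\<Sum>q\<in>?Q. \<Sum>m\<in>?M. if hstrip m q \<and> sum_list q = sum_list m + \<beta> N then kostka N m \<beta> else 0)"
    proof (rule sum.cong[OF refl])
      fix q assume "q \<in> ?Q"
      then have eq: "{m. hstrip m q \<and> sum_list q = sum_list m + \<beta> N} = {m \<in> ?M. hstrip m q \<and> sum_list q = sum_list m + \<beta> N}"
        by (auto dest: hstripD)
      show "(\<Sum>m | hstrip m q \<and> sum_list q = sum_list m + \<beta> N. kostka N m \<beta>) =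
        (\<Sum>m\<in>?M. if hstrip m q \<and> sum_list q = sum_list m + \<beta> N then kostka N m \<beta> else 0)"
        unfolding eq by (rule sum.inter_filter[OF fin])
    qed
    also have "\<dots> = (\<Sum>m\<in>?M. \<Sum>q\<in>?Q. if hstrip m q \<and> sum_list q = sum_list m + \<beta> N then kostka N m \<beta> else 0)"
      by (rule sum.swap)
    also have "\<dots> = (\<Sum>m\<in>?M. card (?C (\<beta> (Suc N)) (\<beta> N) m) * kostka N m \<beta>)"
    proof (intro sum.cong refl)
      fix m
      have "?C (\<beta> (Suc N)) (\<beta> N) m = {q \<in> ?Q. hstrip m q \<and> sum_list q = sum_list m + \<beta> N}" by auto
      then show "(\<Sum>q\<in>?Q. if hstrip m q \<and> sum_list q = sum_list m + \<beta> N then kostka N m \<beta> else 0) =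
        card (?C (\<beta> (Suc N)) (\<beta> N) m) * kostka N m \<beta>"
        using sum.inter_filter[OF finQ, of "\<lambda>q. kostka N m \<beta>"] by simp
    qed
    finally show ?thesis .
  qed
  show ?thesis
    unfolding key
  proof (intro sum.cong refl)
    fix m assume "m \<in> ?M"
    then have m: "partition m" by simp
    have "kostka N m (\<alpha>(N := \<alpha> (Suc N), Suc N := \<alpha> N)) = kostka N m \<alpha>"
      by (rule kostka_cong) simp
    moreover have "card (?C (\<alpha> (Suc N)) (\<alpha> N) m) = card (?C (\<alpha> N) (\<alpha> (Suc N)) m)"
      by (intro antisym card_between_swap m l)
    ultimately show "card (?C (\<alpha> (Suc N)) (\<alpha> N) m) * kostka N m \<alpha> =
      card (?C ((\<alpha>(N := \<alpha> (Suc N), Suc N := \<alpha> N)) (Suc N)) ((\<alpha>(N := \<alpha> (Suc N), Suc N := \<alpha> N)) N) m) *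
      kostka N m (\<alpha>(N := \<alpha> (Suc N), Suc N := \<alpha> N))"
      by simp
  qed
qed

lemma kostka_swap_adjacent:
  assumes "partition l" "Suc i < N"
  shows "kostka N l (\<alpha> \<circ> transpose i (Suc i)) = kostka N l \<alpha>"
  using assms
proof (induction N arbitrary: l)
  case (Suc N)
  show ?case
  proof (cases "Suc i = N")
    case True
    have "\<alpha> \<circ> transpose i (Suc i) = \<alpha>(i := \<alpha> (Suc i), Suc i := \<alpha> i)"
      by (auto simp: transpose_def fun_eq_iff)
    then show ?thesis using kostka_swap_last[OF Suc.prems(1), of i \<alpha>] True by metis
  next
    case False
    then have "Suc i < N" "(\<alpha> \<circ> transpose i (Suc i)) N = \<alpha> N"
      using Suc.prems by (auto simp: transpose_def)
    then show ?thesis using Suc.IH by (auto intro!: sum.cong dest: hstripD)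
  qed
qed simp

lemma kostka_swap:
  assumes l: "partition l" and "i < j" "j < N"
  shows "kostka N l (\<alpha> \<circ> transpose i j) = kostka N l \<alpha>"
  using assms(2,3)
proof (induction j arbitrary: \<alpha>)
  case (Suc j)
  show ?case
  proof (cases "i = j")
    case False
    then have ij: "i < j" "j < N" using Suc.prems by auto
    have "transpose i (Suc j) = transpose j (Suc j) \<circ> transpose i j \<circ> transpose j (Suc j)"
      using False Suc.prems by (auto simp: transpose_def fun_eq_iff)
    then have "\<alpha> \<circ> transpose i (Suc j) = ((\<alpha> \<circ> transpose j (Suc j)) \<circ> transpose i j) \<circ> transpose j (Suc j)"
      by (simp add: o_assoc)
    then show ?thesis
      using Suc.IH[OF ij] kostka_swap_adjacent[OF l Suc.prems(2)] by metis
  next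
    case True
    then show ?thesis using kostka_swap_adjacent[OF l, of j N \<alpha>] Suc.prems by metis
  qed
qed simp

lemma kostka_permute:
  assumes l: "partition l" and p: "p permutes {..<N}"
  shows "kostka N l (\<alpha> \<circ> p) = kostka N l \<alpha>"
  using finite_lessThan[of N] p
proof (induction p arbitrary: \<alpha> rule: permutes_rev_induct)
  fix \<alpha> show "kostka N l (\<alpha> \<circ> id) = kostka N l \<alpha>" by simp
next
  fix a b p \<alpha>
  assume a: "a \<in> {..<N}" and b: "b \<in> {..<N}" and IH: "\<And>\<alpha>. kostka N l (\<alpha> \<circ> p) = kostka N l \<alpha>"
  have "kostka N l (\<beta> \<circ> transpose a b) = kostka N l \<beta>" for \<beta>
    using kostka_swap[OF l, of a b N \<beta>] kostka_swap[OF l, of b a N \<beta>] a b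
    by (cases a b rule: linorder_cases) (auto simp: transpose_commute)
  then show "kostka N l (\<alpha> \<circ> (p \<circ> transpose a b)) = kostka N l \<alpha>"
    by (metis IH comp_assoc)
qed

lemma sort_by_permutation:
  fixes \<alpha> :: "nat \<Rightarrow> nat"
  obtains p where "p permutes {..<N}" "\<And>i j. i \<le> j \<Longrightarrow> j < N \<Longrightarrow> \<alpha> (p j) \<le> \<alpha> (p i)"
proof -
  let ?xs = "map \<alpha> [0..<N]"
  obtain p where p: "p permutes {..<length ?xs}" "permute_list p ?xs = rev (sort ?xs)"
    by (rule mset_eq_permutation[of "rev (sort ?xs)" ?xs]) simp
  have nth: "\<alpha> (p i) = rev (sort ?xs) ! i" if "i < N" for i
  proof -
    have "p i < N" using p(1) that permutes_in_image[of p "{..<N}" i] by simp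
    then show ?thesis using permute_list_nth[OF p(1), of i] p(2) that by simp
  qed
  have "\<alpha> (p j) \<le> \<alpha> (p i)" if "i \<le> j" "j < N" for i j
    using that sorted_rev_nth_mono[of "rev (sort ?xs)" i j] nth[of i] nth[of j] by simp
  then show ?thesis using that[of p] p(1) by simp
qed

section \<open>Beads and dominoes\<close>

text \<open>A beta number shifted down by the number of rows, so that no bound on the length has to be chosen and
  a partition becomes a set of integers containing almost all negative ones.\<close>

definition bead :: "nat list \<Rightarrow> nat \<Rightarrow> int" where
  "bead l i = int (part l i) - int i - 1"

definition maya :: "nat list \<Rightarrow> int set" where
  "maya l = range (bead l)"

lemma bead_strict:
  assumes "partition l" "i < j"
  shows "bead l j < bead l i"
  using part_antimono[OF assms(1), of i j] assms(2) by (simp add: bead_def)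

lemma bead_less_iff: "partition l \<Longrightarrow> bead l i < bead l j \<longleftrightarrow> j < i"
  using bead_strict[of l i j] bead_strict[of l j i] by (cases i j rule: linorder_cases) auto

lemma bead_eq_iff: "partition l \<Longrightarrow> bead l i = bead l j \<longleftrightarrow> i = j"
  using bead_less_iff[of l i j] bead_less_iff[of l j i] by (cases i j rule: linorder_cases) auto

lemma inj_bead: "partition l \<Longrightarrow> inj (bead l)"
  by (rule injI) (simp add: bead_eq_iff)

lemma bead_in_maya: "bead l i \<in> maya l"
  by (simp add: maya_def)

lemma decreasing_enumeration_unique:
  fixes f g :: "nat \<Rightarrow> int"
  assumes f: "\<And>i j. i < j \<Longrightarrow> f j < f i" and g: "\<And>i j. i < j \<Longrightarrow> g j < g i"
    and eq: "range f = range g"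
  shows "f i = g i"
proof (induction i rule: less_induct)
  case (less i)
  have *: "f' i \<le> g' i"
    if f': "\<And>i j. i < j \<Longrightarrow> f' j < f' i" and g': "\<And>i j. i < j \<Longrightarrow> g' j < g' i"
      and r: "range f' = range g'" and IH: "\<And>j. j < i \<Longrightarrow> f' j = g' j" for f' g' :: "nat \<Rightarrow> int"
  proof -
    obtain j where j: "f' i = g' j" using r by (metis rangeE rangeI)
    have "\<not> j < i" using IH[of j] f'[of j i] j by force
    then show ?thesis using g'[of i j] j by (cases "i = j") auto
  qed
  show ?case
    using *[OF f g eq less.IH] *[OF g f eq[symmetric] less.IH[symmetric]] by force
qed

text \<open>A set has only one strictly decreasing enumeration.\<close>

lemma maya_inject:
  assumes "partition l" "partition m" "maya l = maya m"
  shows "l = m"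
proof (rule partition_eqI[OF assms(1,2)])
  fix i
  have "bead l i = bead m i"
    by (rule decreasing_enumeration_unique)
      (use assms in \<open>auto simp: maya_def bead_strict\<close>)
  then show "part l i = part m i" by (simp add: bead_def)
qed

lemma maya_Nil: "maya [] = {x. x < 0}"
proof -
  have "x \<in> range (bead [])" if "x < 0" for x
    by (rule image_eqI[of _ _ "nat (- x - 1)"]) (use that in \<open>auto simp: bead_def\<close>)
  then show ?thesis by (auto simp: maya_def bead_def)
qed

lemma maya_low: "x < - int (length l) \<Longrightarrow> x \<in> maya l"
  unfolding maya_def by (rule image_eqI[of _ _ "nat (- x - 1)"]) (auto simp: bead_def part_def)

definition slide :: "int \<Rightarrow> int set \<Rightarrow> int \<Rightarrow> int set" where
  "slide d S b = insert (b + d) (S - {b})"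

lemma slide_source:
  assumes "b \<in> S" "d \<noteq> 0"
  shows "S - slide d S b = {b}"
  using assms by (auto simp: slide_def)

lemma slide_inject:
  assumes "b \<in> S" "b + d \<notin> S" "b \<in> S'" "b + d \<notin> S'" "slide d S b = slide d S' b"
  shows "S = S'"
  using assms unfolding slide_def by (metis Diff_insert_absorb insert_Diff insert_Diff_single insert_iff)

lemma range_fun_upd: "inj f \<Longrightarrow> range (f(r := x)) = insert x (range f - {f r})"
  by (auto simp: inj_eq)

definition domino_step :: "nat list \<Rightarrow> (nat \<times> nat) set \<Rightarrow> nat list \<Rightarrow> bool" where
  "domino_step l d l' \<longleftrightarrow> partition l \<and> partition l' \<and> domino d \<and> d \<inter> diagram l = {} \<and> diagram l' = diagram l \<union> d"

definition horizontal_step :: "nat list \<Rightarrow> (nat \<times> nat) set \<Rightarrow> nat list \<Rightarrow> nat \<Rightarrow> bool" where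
  "horizontal_step l d l' r \<longleftrightarrow> d = {(r, part l r), (r, part l r + 1)} \<and> part l' = (part l)(r := part l r + 2)"

definition vertical_step :: "nat list \<Rightarrow> (nat \<times> nat) set \<Rightarrow> nat list \<Rightarrow> nat \<Rightarrow> bool" where
  "vertical_step l d l' r \<longleftrightarrow> d = {(r, part l r), (r + 1, part l r)} \<and> part l (r + 1) = part l r \<and>
     part l' = (part l)(r := part l r + 1, r + 1 := part l r + 1)"

lemma domino_step_cases:
  assumes "domino_step l d l'"
  shows "\<exists>r. horizontal_step l d l' r \<or> vertical_step l d l' r"
proof -
  have l: "partition l" "partition l'" and dd: "domino d" and disj: "d \<inter> diagram l = {}"
    and dia: "diagram l' = diagram l \<union> d" using assms by (auto simp: domino_step_def)
  have iff: "j < part l' i \<longleftrightarrow> j < part l i \<or> (i, j) \<in> d" for i j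
    using dia unfolding diagram_part by auto
  have notin: "(i, j) \<in> d \<Longrightarrow> part l i \<le> j" for i j
    using disj unfolding diagram_part by force
  have eqI: "x = y" if "\<And>j. j < x \<longleftrightarrow> j < y" for x y :: nat
    using that by (metis linorder_neqE_nat less_irrefl)
  consider i j where "d = {(i, j), (i, j + 1)}" | i j where "d = {(i, j), (i + 1, j)}"
    using dd by (auto simp: domino_def horizontal_domino_def vertical_domino_def)
  then show ?thesis
  proof cases
    case (1 r c)
    have other: "part l' i = part l i" if "i \<noteq> r" for i
      by (rule eqI) (use iff that 1 in auto)
    have r1: "part l r \<le> c" using notin[of r c] 1 by simp
    have c1: "c + 1 < part l' r" using iff[of "c + 1" r] 1 by simp
    have "part l r = c"
    proof (rule ccontr)
      assume "part l r \<noteq> c"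
      then have "part l r < part l' r" using r1 c1 by simp
      then show False using iff[of "part l r" r] 1 r1 \<open>part l r \<noteq> c\<close> by auto
    qed
    moreover have "part l' r = c + 2"
      using iff[of "c + 2" r] 1 r1 c1 by auto
    ultimately have "horizontal_step l d l' r"
      using 1 other by (auto simp: horizontal_step_def fun_eq_iff)
    then show ?thesis by blast
  next
    case (2 r c)
    have other: "part l' i = part l i" if "i \<noteq> r" "i \<noteq> r + 1" for i
      by (rule eqI) (use iff that 2 in auto)
    have r: "part l i = c \<and> part l' i = c + 1" if "i = r \<or> i = r + 1" for i
    proof -
      have r1: "part l i \<le> c" using notin[of i c] 2 that by auto
      have c1: "c < part l' i" using iff[of c i] 2 that by auto
      have "part l i = c"
      proof (rule ccontr)
        assume "part l i \<noteq> c"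
        then have "part l i < part l' i" using r1 c1 by simp
        then show False using iff[of "part l i" i] 2 r1 \<open>part l i \<noteq> c\<close> by auto
      qed
      moreover have "part l' i = c + 1"
        using iff[of "c + 1" i] 2 r1 c1 by auto
      ultimately show ?thesis by simp
    qed
    have "vertical_step l d l' r"
      using 2 other r[of r] r[of "r + 1"] by (auto simp: vertical_step_def fun_eq_iff)
    then show ?thesis by blast
  qed
qed

lemma horizontal_step_beads:
  assumes l: "partition l" and l': "partition l'" and h: "horizontal_step l d l' r"
  shows "bead l r + 1 \<notin> maya l" "bead l r + 2 \<notin> maya l" "maya l' = slide 2 (maya l) (bead l r)"
    "bead l' r = bead l r + 2"
proof -
  have p: "part l' = (part l)(r := part l r + 2)" using h by (simp add: horizontal_step_def)
  have b: "bead l' = (bead l)(r := bead l r + 2)"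
    by (auto simp: bead_def p fun_eq_iff)
  show "bead l' r = bead l r + 2" by (simp add: b)
  show "maya l' = slide 2 (maya l) (bead l r)"
    unfolding maya_def b slide_def by (rule range_fun_upd[OF inj_bead[OF l]])
  have "bead l i \<noteq> bead l r + k" if "k = 1 \<or> k = 2" for i k
  proof
    assume eq: "bead l i = bead l r + k"
    then have "i < r" using bead_less_iff[OF l, of r i] that by auto
    then have "bead l' r < bead l' i" using bead_less_iff[OF l'] by simp
    then show False using eq that \<open>i < r\<close> by (auto simp: b)
  qed
  then show "bead l r + 1 \<notin> maya l" "bead l r + 2 \<notin> maya l" unfolding maya_def by (metis rangeE)+
qed

lemma vertical_step_beads:
  assumes l: "partition l" and l': "partition l'" and h: "vertical_step l d l' r"
  shows "bead l r = bead l (r + 1) + 1" "bead l (r + 1) + 2 \<notin> maya l"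
    "maya l' = slide 2 (maya l) (bead l (r + 1))"
    "bead l' r = bead l (r + 1) + 2" "bead l' (r + 1) = bead l (r + 1) + 1"
proof -
  have p: "part l' = (part l)(r := part l r + 1, r + 1 := part l r + 1)" "part l (r + 1) = part l r"
    using h by (simp_all add: vertical_step_def)
  have br: "bead l r = bead l (r + 1) + 1" using p(2) by (simp add: bead_def)
  have b: "bead l' = (bead l)(r := bead l (r + 1) + 2, r + 1 := bead l (r + 1) + 1)"
    using p by (auto simp: bead_def fun_eq_iff)
  show "bead l r = bead l (r + 1) + 1" by (rule br)
  show "bead l' r = bead l (r + 1) + 2" "bead l' (r + 1) = bead l (r + 1) + 1" by (simp_all add: b)
  have "bead l i \<noteq> bead l (r + 1) + 2" for i
  proof
    assume eq: "bead l i = bead l (r + 1) + 2"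
    then have "i < r" using bead_less_iff[OF l, of r i] br by auto
    then have "bead l' r < bead l' i" using bead_less_iff[OF l'] by simp
    then show False using eq \<open>i < r\<close> by (auto simp: b)
  qed
  then show n2: "bead l (r + 1) + 2 \<notin> maya l" unfolding maya_def by (metis rangeE)
  show "maya l' = slide 2 (maya l) (bead l (r + 1))"
  proof (intro equalityI subsetI)
    fix x assume "x \<in> maya l'"
    then obtain i where i: "x = bead l' i" by (auto simp: maya_def)
    show "x \<in> slide 2 (maya l) (bead l (r + 1))"
    proof (cases "i = r \<or> i = r + 1")
      case True
      then show ?thesis using i br bead_in_maya[of l r] by (auto simp: b slide_def)
    next
      case False
      then have "x = bead l i" using i by (simp add: b)
      then show ?thesis using bead_eq_iff[OF l, of i "r + 1"] False bead_in_maya[of l i] by (simp add: slide_def)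
    qed
  next
    fix x assume "x \<in> slide 2 (maya l) (bead l (r + 1))"
    then consider "x = bead l' r" | i where "x = bead l i" "x \<noteq> bead l (r + 1)"
      by (auto simp: slide_def b maya_def)
    then show "x \<in> maya l'"
    proof cases
      case 2
      show ?thesis
      proof (cases "i = r")
        case True
        then have "x = bead l' (r + 1)" using 2 br by (simp add: b)
        then show ?thesis using bead_in_maya by simp
      next
        case False
        then have "x = bead l' i" using 2 by (auto simp: b)
        then show ?thesis using bead_in_maya by simp
      qed
    qed (simp add: bead_in_maya)
  qed
qed

text \<open>The moved bead \<open>b\<close> has as index \<open>R\<close> the lowest row of the domino. The domino is vertical exactly if
  the place \<open>b + 1\<close> that is jumped over is occupied, and then the bead on it drops by one row.\<close>

lemma domino_step_beads:
  assumes "domino_step l d l'"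
  obtains b t R where "bead l R = b" "b + 2 \<notin> maya l" "maya l' = slide 2 (maya l) b" "fst ` d = {t, R}"
    "(t = R \<and> b + 1 \<notin> maya l \<and> bead l' R = b + 2 \<and> \<not> vertical_domino d) \<or>
     (R = t + 1 \<and> bead l t = b + 1 \<and> bead l' t = b + 2 \<and> bead l' R = b + 1 \<and> vertical_domino d)"
proof -
  have l: "partition l" "partition l'" using assms by (auto simp: domino_step_def)
  obtain r where "horizontal_step l d l' r \<or> vertical_step l d l' r"
    using domino_step_cases[OF assms] by blast
  then show ?thesis
  proof
    assume h: "horizontal_step l d l' r"
    note B = horizontal_step_beads[OF l h]
    have d: "d = {(r, part l r), (r, part l r + 1)}" using h by (simp add: horizontal_step_def)
    have "\<not> vertical_domino d"
      unfolding vertical_domino_def d by (auto simp: doubleton_eq_iff)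
    moreover have "fst ` d = {r, r}" using d by auto
    ultimately show ?thesis using that[of r "bead l r" r] B by blast
  next
    assume h: "vertical_step l d l' r"
    note B = vertical_step_beads[OF l h]
    have d: "d = {(r, part l r), (r + 1, part l r)}" using h by (simp add: vertical_step_def)
    have "vertical_domino d" unfolding vertical_domino_def d by blast
    moreover have "fst ` d = {r, r + 1}" using d by auto
    ultimately show ?thesis using that[of "r + 1" "bead l (r + 1)" r] B by blast
  qed
qed

lemma domino_step_exists:
  assumes l: "partition l" and b: "b \<in> maya l" "b + 2 \<notin> maya l"
  shows "\<exists>l' d. domino_step l d l' \<and> maya l' = slide 2 (maya l) b"
proof -
  obtain r where r: "b = bead l r" using b by (auto simp: maya_def)
  have zero: "part l i = 0" if "length l \<le> i" for i using that by (simp add: part_def)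
  show ?thesis
  proof (cases "b + 1 \<in> maya l")
    case False
    let ?f = "(part l)(r := part l r + 2)"
    have up: "part l r + 2 \<le> part l i" if "Suc i = r" for i
    proof -
      have "bead l r < bead l i" using that bead_less_iff[OF l] by simp
      moreover have "bead l i \<noteq> b + 1" "bead l i \<noteq> b + 2" using b False bead_in_maya by metis+
      ultimately show ?thesis using that r by (auto simp: bead_def)
    qed
    have mono: "?f (Suc i) \<le> ?f i" for i
      using part_antimono[OF l, of i "Suc i"] up[of i] by auto
    have "?f (length l + r + 1) = 0" using zero by simp
    then obtain l' where l': "partition l'" "\<And>i. part l' i = ?f i"
      using partition_of_fun[of ?f, OF mono] by metis
    define d where "d = {(r, part l r), (r, part l r + 1)}"
    have h: "horizontal_step l d l' r" unfolding horizontal_step_def d_def using l'(2) by (auto simp: fun_eq_iff)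
    have "domino_step l d l'"
      unfolding domino_step_def
    proof (intro conjI l l'(1))
      show "domino d" unfolding domino_def horizontal_domino_def d_def by blast
      show "d \<inter> diagram l = {}" unfolding d_def diagram_part by auto
      show "diagram l' = diagram l \<union> d"
        unfolding d_def diagram_part l'(2) by (auto split: if_splits)
    qed
    then show ?thesis using horizontal_step_beads(3)[OF l l'(1) h] r by blast
  next
    case True
    then obtain s where s: "bead l s = b + 1" by (auto simp: maya_def)
    have "s < r" using s r bead_less_iff[OF l, of r s] by simp
    have "Suc s = r"
    proof (rule ccontr)
      assume "Suc s \<noteq> r"
      then have "bead l r < bead l (Suc s)" "bead l (Suc s) < bead l s"
        using \<open>s < r\<close> bead_less_iff[OF l] by auto
      then show False using s r by simp
    qed
    then have eq: "part l (s + 1) = part l s" using s r by (auto simp: bead_def)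
    let ?f = "(part l)(s := part l s + 1, s + 1 := part l s + 1)"
    have up: "part l s + 1 \<le> part l i" if "Suc i = s" for i
    proof -
      have "bead l s < bead l i" using that bead_less_iff[OF l] by simp
      moreover have "bead l i \<noteq> b + 2" using b bead_in_maya by metis
      ultimately show ?thesis using that s by (auto simp: bead_def)
    qed
    have mono: "?f (Suc i) \<le> ?f i" for i
      using part_antimono[OF l, of i "Suc i"] up[of i] eq by auto
    have "?f (length l + s + 2) = 0" using zero by simp
    then obtain l' where l': "partition l'" "\<And>i. part l' i = ?f i"
      using partition_of_fun[of ?f, OF mono] by metis
    define d where "d = {(s, part l s), (s + 1, part l s)}"
    have h: "vertical_step l d l' s" unfolding vertical_step_def d_def using l'(2) eq by (auto simp: fun_eq_iff)
    have "domino_step l d l'"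
      unfolding domino_step_def
    proof (intro conjI l l'(1))
      show "domino d" unfolding domino_def vertical_domino_def d_def by blast
      show "d \<inter> diagram l = {}" unfolding d_def diagram_part using eq by auto
      show "diagram l' = diagram l \<union> d"
        unfolding d_def diagram_part l'(2) using eq by (auto split: if_splits)
    qed
    then show ?thesis using vertical_step_beads(3)[OF l l'(1) h] r \<open>Suc s = r\<close> by auto
  qed
qed

text \<open>Both dominoes are compared in the intermediate shape: the lowest row of the first one and the highest
  row of the second one are indices of beads there, and a lower row means a smaller bead.\<close>

lemma domino_step_descent_iff:
  assumes d1: "domino_step l d l1" and d2: "domino_step l1 d' l2"
    and b: "b \<in> maya l" "maya l1 = slide 2 (maya l) b"
    and b': "b' \<in> maya l1" "maya l2 = slide 2 (maya l1) b'"
  shows "(\<forall>c\<in>d. \<forall>c'\<in>d'. fst c < fst c') \<longleftrightarrow> b' < b"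
proof -
  have p: "partition l1" using d1 by (simp add: domino_step_def)
  obtain b0 t R where B: "bead l R = b0" "b0 + 2 \<notin> maya l" "maya l1 = slide 2 (maya l) b0" "fst ` d = {t, R}"
    "(t = R \<and> b0 + 1 \<notin> maya l \<and> bead l1 R = b0 + 2 \<and> \<not> vertical_domino d) \<or>
     (R = t + 1 \<and> bead l t = b0 + 1 \<and> bead l1 t = b0 + 2 \<and> bead l1 R = b0 + 1 \<and> vertical_domino d)"
    using domino_step_beads[OF d1] by metis
  obtain b1 t' R' where B': "bead l1 R' = b1" "b1 + 2 \<notin> maya l1" "maya l2 = slide 2 (maya l1) b1" "fst ` d' = {t', R'}"
    "(t' = R' \<and> b1 + 1 \<notin> maya l1 \<and> bead l2 R' = b1 + 2 \<and> \<not> vertical_domino d') \<or>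
     (R' = t' + 1 \<and> bead l1 t' = b1 + 1 \<and> bead l2 t' = b1 + 2 \<and> bead l2 R' = b1 + 1 \<and> vertical_domino d')"
    using domino_step_beads[OF d2] by metis
  have b0: "b0 = b"
    using slide_source[of b "maya l" 2] slide_source[of b0 "maya l" 2] b B(1,3) bead_in_maya[of l R] by auto
  have b1: "b1 = b'"
    using slide_source[of b' "maya l1" 2] slide_source[of b1 "maya l1" 2] b' B'(1,3) bead_in_maya[of l1 R'] by auto
  have nb: "b' \<noteq> b" using b b' by (auto simp: slide_def)
  have nb1: "b + 1 \<notin> maya l1" if "b + 1 \<notin> maya l" using that b by (auto simp: slide_def)
  have "(\<forall>c\<in>d. \<forall>c'\<in>d'. fst c < fst c') \<longleftrightarrow> (\<forall>x\<in>fst ` d. \<forall>y\<in>fst ` d'. x < y)" by auto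
  also have "\<dots> \<longleftrightarrow> R < t'" unfolding B(4) B'(4) using B(5) B'(5) by auto
  also have "\<dots> \<longleftrightarrow> bead l1 t' < bead l1 R" using bead_less_iff[OF p] by simp
  also have "\<dots> \<longleftrightarrow> b' < b"
  proof -
    have "bead l1 R = b + 2 \<and> b' \<noteq> b + 1 \<or> bead l1 R = b + 1"
      using B(5) nb1 b'(1) unfolding b0 by metis
    moreover have "bead l1 t' = b' \<or> bead l1 t' = b' + 1" using B'(1,5) unfolding b1 by metis
    ultimately show ?thesis using nb by auto
  qed
  finally show ?thesis .
qed

text \<open>Initially the beads fill the negative integers, so only the beads \<open>- 1\<close> and \<open>- 2\<close> can move, and the
  latter jumps over the former.\<close>

lemma first_domino_step:
  assumes d: "domino_step [] d l" and b: "b \<in> maya []" "maya l = slide 2 (maya []) b"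
  shows "vertical_domino d \<longleftrightarrow> b = -2"
proof -
  obtain b0 t R where B: "bead [] R = b0" "b0 + 2 \<notin> maya []" "maya l = slide 2 (maya []) b0" "fst ` d = {t, R}"
    "(t = R \<and> b0 + 1 \<notin> maya [] \<and> bead l R = b0 + 2 \<and> \<not> vertical_domino d) \<or>
     (R = t + 1 \<and> bead [] t = b0 + 1 \<and> bead l t = b0 + 2 \<and> bead l R = b0 + 1 \<and> vertical_domino d)"
    using domino_step_beads[OF d] by metis
  have b0: "b0 = b"
    using slide_source[of b "maya []" 2] slide_source[of b0 "maya []" 2] b B(1,3) bead_in_maya[of "[]" R] by auto
  have "b < 0" "- 2 \<le> b" using b B(2) b0 by (auto simp: maya_Nil)
  moreover have "bead [] t < 0" using bead_in_maya[of "[]" t] by (simp add: maya_Nil)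
  ultimately show ?thesis using B(5) unfolding b0 by (auto simp: maya_Nil)
qed

section \<open>The 2-quotient\<close>

text \<open>The runner of the abacus that carries the beads congruent to \<open>r\<close> modulo \<open>2\<close>.\<close>

definition half :: "int \<Rightarrow> int set \<Rightarrow> int set" where
  "half r S = {x. 2 * x + r \<in> S}"

lemma halves_eqI:
  assumes "half 0 S = half 0 S'" "half 1 S = half 1 S'"
  shows "S = S'"
proof (rule set_eqI)
  fix x :: int
  have "x = 2 * (x div 2) + 0 \<or> x = 2 * (x div 2) + 1" by presburger
  then show "x \<in> S \<longleftrightarrow> x \<in> S'"
    using assms unfolding half_def set_eq_iff mem_Collect_eq by metis
qed

lemma half_slide_same:
  assumes "r = 0 \<or> r = 1"
  shows "half r (slide 2 S (2 * b + r)) = slide 1 (half r S) b"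
  using assms by (auto simp: half_def slide_def)

lemma half_slide_other:
  assumes "r = 0 \<and> r' = 1 \<or> r = 1 \<and> r' = 0"
  shows "half r' (slide 2 S (2 * b + r)) = half r' S"
  using assms unfolding half_def slide_def by (auto; presburger)

lemma remove_box:
  assumes l: "partition l" "l \<noteq> []"
  obtains m b where "partition m" "sum_list l = Suc (sum_list m)" "b \<in> maya m" "b + 1 \<notin> maya m"
    "maya l = slide 1 (maya m) b"
proof -
  define r where "r = length l - 1"
  have r: "Suc r = length l" using l(2) by (simp add: r_def)
  have pos: "0 < part l r" using part_pos_iff[OF l(1), of r] r by simp
  let ?f = "(part l)(r := part l r - 1)"
  have mono: "?f (Suc i) \<le> ?f i" for i
    using part_antimono[OF l(1), of i "Suc i"] r part_eq_0_iff[OF l(1), of "Suc r"] by auto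
  have "?f (length l) = 0" using r by (simp add: part_def)
  then obtain m where m: "partition m" "\<And>i. part m i = ?f i" "length m \<le> length l"
    using partition_of_fun[of ?f, OF mono] by metis
  have bl: "bead l = (bead m)(r := bead m r + 1)"
    using pos by (auto simp: bead_def m(2) fun_eq_iff)
  have "maya l = slide 1 (maya m) (bead m r)"
    unfolding maya_def bl slide_def by (rule range_fun_upd[OF inj_bead[OF m(1)]])
  moreover have "bead m r + 1 \<notin> maya m"
  proof
    assume "bead m r + 1 \<in> maya m"
    then obtain i where i: "bead m i = bead m r + 1" by (auto simp: maya_def)
    then have "i \<noteq> r" by auto
    then have "bead l i = bead l r" using i by (simp add: bl)
    then show False using bead_eq_iff[OF l(1)] \<open>i \<noteq> r\<close> by simp
  qed
  moreover have "sum_list l = Suc (sum_list m)"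
  proof -
    have "sum_list l = (\<Sum>i<length l. part l i)" by (rule sum_list_part) simp
    also have "\<dots> = part l r + (\<Sum>i\<in>{..<length l} - {r}. part l i)"
      using r by (intro sum.remove) auto
    also have "(\<Sum>i\<in>{..<length l} - {r}. part l i) = (\<Sum>i\<in>{..<length l} - {r}. part m i)"
      by (intro sum.cong refl) (simp add: m(2))
    also have "part l r = Suc (part m r)" using pos by (simp add: m(2))
    also have "Suc (part m r) + (\<Sum>i\<in>{..<length l} - {r}. part m i) = Suc (\<Sum>i<length l. part m i)"
      using r by (subst (2) sum.remove[of _ r]) auto
    also have "(\<Sum>i<length l. part m i) = sum_list m" by (rule sum_list_part[OF m(3), symmetric])
    finally show ?thesis .
  qed
  ultimately show ?thesis using that[OF m(1)] bead_in_maya by blast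
qed

lemma domino_card: "domino d \<Longrightarrow> card d = 2 \<and> finite d"
  by (auto simp: domino_def horizontal_domino_def vertical_domino_def)

lemma domino_step_domino_partitions:
  assumes l: "l \<in> domino_partitions n" and s: "domino_step l d l'"
  shows "l' \<in> domino_partitions (Suc n)"
proof -
  have p: "partition l" "partition l'" "domino d" "d \<inter> diagram l = {}" "diagram l' = diagram l \<union> d"
    using s by (auto simp: domino_step_def)
  obtain D where D: "partition_on (diagram l) D" "\<forall>d\<in>D. domino d" and sl: "sum_list l = 2 * n"
    using l by (auto simp: domino_partitions_def)
  have "d \<noteq> {}" using domino_card[OF p(3)] by auto
  then have "partition_on (diagram l') (insert d D)"
    using p(4) partition_onD1[OF D(1)] partition_onD2[OF D(1)] partition_onD3[OF D(1)] unfolding p(5)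
    by (auto simp: partition_on_def pairwise_insert disjnt_def)
  moreover have "card (diagram l') = card (diagram l) + card d"
    unfolding p(5) using p(4) domino_card[OF p(3)] by (intro card_Un_disjoint finite_diagram) auto
  then have "sum_list l' = 2 * Suc n" using sl domino_card[OF p(3)] by (simp add: card_diagram)
  ultimately show ?thesis using p(2,3) D(2) by (auto simp: domino_partitions_def)
qed

lemma diagram_Nil [simp]: "diagram [] = {}"
  by (simp add: diagram_def)

lemma Nil_domino_partitions: "[] \<in> domino_partitions 0"
  by (auto simp: domino_partitions_def partition_on_empty intro: exI[of _ "{}"])

lemma half_maya_Nil: "r = 0 \<or> r = 1 \<Longrightarrow> half r (maya []) = maya []"
  by (auto simp: half_def maya_Nil)

text \<open>Adding a box to a component of the quotient moves a bead by one step on its runner. On the original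
  abacus the bead moves by two, which adds a domino; so tileability is preserved along the way.\<close>

lemma two_quotient_surj:
  assumes "partition \<alpha>" "partition \<beta>"
  shows "\<exists>l\<in>domino_partitions (sum_list \<alpha> + sum_list \<beta>). half 0 (maya l) = maya \<alpha> \<and> half 1 (maya l) = maya \<beta>"
  using assms
proof (induction "sum_list \<alpha> + sum_list \<beta>" arbitrary: \<alpha> \<beta> rule: less_induct)
  case less
  have step: "\<exists>l'\<in>domino_partitions (Suc n). half r (maya l') = slide 1 (half r (maya l)) b \<and> half r' (maya l') = half r' (maya l)"
    if l: "l \<in> domino_partitions n" and r: "r = 0 \<and> r' = 1 \<or> r = 1 \<and> r' = 0"
      and b: "b \<in> half r (maya l)" "b + 1 \<notin> half r (maya l)" for l n r r' b
  proof -
    have "partition l" using l by (simp add: domino_partitions_def)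
    moreover have "2 * b + r \<in> maya l" "2 * b + r + 2 \<notin> maya l"
      using b by (auto simp: half_def algebra_simps)
    ultimately obtain l' d where s: "domino_step l d l'" "maya l' = slide 2 (maya l) (2 * b + r)"
      using domino_step_exists by blast
    show ?thesis
    proof (intro bexI conjI)
      show "l' \<in> domino_partitions (Suc n)" by (rule domino_step_domino_partitions[OF l s(1)])
      show "half r (maya l') = slide 1 (half r (maya l)) b"
        unfolding s(2) using r by (intro half_slide_same) auto
      show "half r' (maya l') = half r' (maya l)"
        unfolding s(2) using r by (rule half_slide_other)
    qed
  qed
  show ?case
  proof (cases "\<alpha> = []")
    case False
    obtain m b where m: "partition m" "sum_list \<alpha> = Suc (sum_list m)" "b \<in> maya m" "b + 1 \<notin> maya m"
      "maya \<alpha> = slide 1 (maya m) b"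
      using remove_box[OF less.prems(1) False] by blast
    obtain l where l: "l \<in> domino_partitions (sum_list m + sum_list \<beta>)" "half 0 (maya l) = maya m" "half 1 (maya l) = maya \<beta>"
      using less.hyps[of m \<beta>] m less.prems by auto
    then show ?thesis using step[OF l(1), of 0 1 b] m by simp
  next
    case True
    show ?thesis
    proof (cases "\<beta> = []")
      case False
      obtain m b where m: "partition m" "sum_list \<beta> = Suc (sum_list m)" "b \<in> maya m" "b + 1 \<notin> maya m"
        "maya \<beta> = slide 1 (maya m) b"
        using remove_box[OF less.prems(2) False] by blast
      obtain l where l: "l \<in> domino_partitions (sum_list \<alpha> + sum_list m)" "half 0 (maya l) = maya \<alpha>" "half 1 (maya l) = maya m"
        using less.hyps[of \<alpha> m] m less.prems by auto
      then show ?thesis using step[OF l(1), of 1 0 b] m by auto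
    next
      case b: True
      then show ?thesis
        using True Nil_domino_partitions half_maya_Nil[of 0] half_maya_Nil[of 1]
        by (intro bexI[of _ "[]"]) simp_all
    qed
  qed
qed

lemma sum_sign: "(\<Sum>j<p. (- 1) ^ j :: int) = (if odd p then 1 else 0)"
  by (induction p) auto

text \<open>Every domino covers one box of each colour of the chessboard, and a row contributes its colour excess.\<close>

lemma tiling_balanced:
  assumes "l \<in> domino_partitions n" "length l \<le> m"
  shows "(\<Sum>i<m. (- 1) ^ i * (if odd (part l i) then 1 else 0 :: int)) = 0"
proof -
  obtain D where D: "partition_on (diagram l) D" "\<And>d. d \<in> D \<Longrightarrow> domino d"
    using assms by (auto simp: domino_partitions_def)
  let ?w = "\<lambda>(i, j). (- 1) ^ (i + j) :: int"
  have "(\<Sum>c\<in>diagram l. ?w c) = (\<Sum>d\<in>D. \<Sum>c\<in>d. ?w c)"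
    unfolding partition_onD1[OF D(1)]
    using partition_onD2[OF D(1)] domino_card D(2)
    by (subst sum.Union_disjoint) (auto simp: disjoint_def)
  also have "\<dots> = 0"
  proof (rule sum.neutral, rule ballI)
    fix d assume "d \<in> D"
    then show "(\<Sum>c\<in>d. ?w c) = 0"
      using D(2)[of d] by (auto simp: domino_def horizontal_domino_def vertical_domino_def)
  qed
  finally have 0: "(\<Sum>c\<in>diagram l. ?w c) = 0" .
  have "diagram l = Sigma {..<m} (\<lambda>i. {..<part l i})"
    using assms(2) by (auto simp: diagram_part part_def split: if_splits)
  then have "(\<Sum>c\<in>diagram l. ?w c) = (\<Sum>i<m. \<Sum>j<part l i. (- 1) ^ (i + j))"
    by (simp add: sum.Sigma)
  also have "\<dots> = (\<Sum>i<m. (- 1) ^ i * (if odd (part l i) then 1 else 0 :: int))"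
    by (intro sum.cong refl) (simp add: power_add sum_distrib_left[symmetric] sum_sign)
  finally show ?thesis using 0 by simp
qed

lemma length_filter_upt: "length (filter P (map f [0..<m])) = card {i. i < m \<and> P (f i)}"
proof -
  have "length (filter P (map f [0..<m])) = length (filter (P \<circ> f) [0..<m])"
    by (simp add: filter_map)
  also have "\<dots> = card (set (filter (P \<circ> f) [0..<m]))"
    by (rule distinct_card[symmetric]) simp
  also have "set (filter (P \<circ> f) [0..<m]) = {i. i < m \<and> P (f i)}" by auto
  finally show ?thesis .
qed

lemma even_bound: "even (even_bound l)" "length l \<le> even_bound l"
  by (auto simp: even_bound_def)

text \<open>The parity of a beta number is determined by the parities of the row and of its length, and the
  balance of colours makes the two parities equally frequent.\<close>

lemma length_even_betas:
  assumes l: "l \<in> domino_partitions n"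
  shows "length (filter even (beta_numbers l)) = even_bound l div 2"
proof -
  let ?m = "even_bound l"
  have "length (filter even (beta_numbers l)) = card {i. i < ?m \<and> even (part l i + ?m - (i + 1))}"
    unfolding beta_numbers_def Let_def by (rule length_filter_upt)
  also have "{i. i < ?m \<and> even (part l i + ?m - (i + 1))} = {i \<in> {..<?m}. odd (part l i + i)}"
    using even_bound(1)[of l] by auto
  also have "int (card \<dots>) = (\<Sum>i<?m. if odd (part l i + i) then 1 else 0)"
    by (simp add: sum.If_cases Int_def)
  also have "\<dots> = (\<Sum>i<?m. (if odd i then 1 else 0) + (- 1) ^ i * (if odd (part l i) then 1 else 0 :: int))"
    by (intro sum.cong refl) auto
  also have "\<dots> = (\<Sum>i<?m. if odd i then 1 else 0)"
    by (simp add: sum.distrib tiling_balanced[OF l even_bound(2)])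
  also have "\<dots> = int (?m div 2)"
  proof -
    have "(\<Sum>i<2 * h. if odd i then 1 else (0::int)) = int h" for h :: nat
      by (induction h) auto
    from this[of "?m div 2"] show ?thesis using even_bound(1)[of l] by simp
  qed
  finally show ?thesis by simp
qed

lemma part_filter_pos:
  "sorted_wrt (\<ge>) xs \<Longrightarrow> part (filter (\<lambda>x. x > 0) xs) k = part xs k"
proof (induction xs arbitrary: k)
  case (Cons x xs)
  show ?case
  proof (cases "x > 0")
    case True
    have IH: "part (filter (\<lambda>x. x > 0) xs) j = part xs j" for j using Cons by simp
    have "part (x # ys) k = (case k of 0 \<Rightarrow> x | Suc j \<Rightarrow> part ys j)" for ys
      by (auto simp: part_def split: nat.splits)
    then show ?thesis using True IH by (simp split: nat.splits)
  next
    case False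
    then have "\<forall>y\<in>set (x # xs). y = 0" using Cons.prems by auto
    then have "filter (\<lambda>x. x > 0) (x # xs) = []" by (auto simp: filter_empty_conv)
    moreover have "part (x # xs) k = 0"
      using \<open>\<forall>y\<in>set (x # xs). y = 0\<close> by (metis nth_mem part_def)
    ultimately show ?thesis by simp
  qed
qed simp

lemma from_beta_maya:
  assumes dec: "sorted_wrt (>) e" and len: "length e = h"
  shows "partition (from_beta h e)"
    "x \<in> maya (from_beta h e) \<longleftrightarrow> x < - int h \<or> x + int h \<in> int ` set e"
proof -
  let ?g = "\<lambda>k. e ! k - (h - (k + 1))"
  \<comment> \<open>strictly decreasing natural numbers leave room for their successors, so the subtraction is not truncated\<close>
  have low: "h - (k + 1) \<le> e ! k" if "k < h" for k
    using that
  proof (induction "h - k" arbitrary: k)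
    case (Suc j)
    show ?case
    proof (cases "Suc k < h")
      case True
      have "e ! k > e ! Suc k" using dec True len by (intro sorted_wrt_nth_less[of "(>)" e]) auto
      moreover have "h - (Suc k + 1) \<le> e ! Suc k" using Suc True by (intro Suc.hyps(1)) auto
      ultimately show ?thesis by simp
    qed simp
  qed simp
  have dec': "e ! j + (j - i) \<le> e ! i" if "i \<le> j" "j < h" for i j
    using that
  proof (induction j rule: dec_induct)
    case (step k)
    have "e ! k > e ! Suc k" using dec step len by (intro sorted_wrt_nth_less[of "(>)" e]) auto
    then show ?case using step by (auto simp: Suc_diff_le)
  qed simp
  have srt: "sorted_wrt (\<ge>) (map ?g [0..<h])"
    unfolding sorted_wrt_iff_nth_less
  proof (intro allI impI)
    fix i j assume "i < j" "j < length (map ?g [0..<h])"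
    then show "map ?g [0..<h] ! j \<le> map ?g [0..<h] ! i" using dec'[of i j] low[of j] low[of i] by auto
  qed
  show "partition (from_beta h e)"
    unfolding partition_def from_beta_def using sorted_wrt_filter[OF srt] by auto
  have part: "part (from_beta h e) k = (if k < h then ?g k else 0)" for k
    unfolding from_beta_def part_filter_pos[OF srt] by (simp add: part_def)
  have bead: "bead (from_beta h e) k = (if k < h then int (e ! k) - int h else - int k - 1)" for k
    using low[of k] by (auto simp: bead_def part of_nat_diff)
  show "x \<in> maya (from_beta h e) \<longleftrightarrow> x < - int h \<or> x + int h \<in> int ` set e"
  proof
    assume "x \<in> maya (from_beta h e)"
    then obtain k where k: "x = bead (from_beta h e) k" by (auto simp: maya_def)
    show "x < - int h \<or> x + int h \<in> int ` set e"
      using k len by (cases "k < h") (auto simp: bead)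
  next
    assume "x < - int h \<or> x + int h \<in> int ` set e"
    then show "x \<in> maya (from_beta h e)"
    proof
      assume "x < - int h"
      then have "x = bead (from_beta h e) (nat (- x - 1))" by (auto simp: bead)
      then show ?thesis by (metis bead_in_maya)
    next
      assume "x + int h \<in> int ` set e"
      then obtain k where "k < h" "x + int h = int (e ! k)" using len by (auto simp: in_set_conv_nth)
      then have "x = bead (from_beta h e) k" by (simp add: bead)
      then show ?thesis by (metis bead_in_maya)
    qed
  qed
qed

lemma beta_numbers_decreasing:
  assumes "partition l"
  shows "sorted_wrt (>) (beta_numbers l)"
proof -
  have "part l j + even_bound l - (j + 1) < part l i + even_bound l - (i + 1)" if "i < j" "j < even_bound l" for i j
    using part_antimono[OF assms, of i j] that by linarith
  then show ?thesis by (auto simp: beta_numbers_def Let_def sorted_wrt_iff_nth_less)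
qed

lemma set_beta_numbers:
  "b \<in> set (beta_numbers l) \<longleftrightarrow> int b - int (even_bound l) \<in> maya l"
proof
  let ?m = "even_bound l"
  assume "b \<in> set (beta_numbers l)"
  then obtain i where "i < ?m" "b = part l i + ?m - (i + 1)" by (auto simp: beta_numbers_def Let_def)
  then have "int b - int ?m = bead l i" by (simp add: bead_def of_nat_diff)
  then show "int b - int ?m \<in> maya l" by (metis bead_in_maya)
next
  let ?m = "even_bound l"
  assume "int b - int ?m \<in> maya l"
  then obtain i where i: "int b - int ?m = bead l i" by (auto simp: maya_def)
  have "i < ?m"
  proof (rule ccontr)
    assume "\<not> i < ?m"
    then have "part l i = 0" using even_bound(2)[of l] by (simp add: part_def)
    then show False using i \<open>\<not> i < ?m\<close> by (simp add: bead_def)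
  qed
  then have "b = part l i + ?m - (i + 1)" using i by (simp add: bead_def)
  then show "b \<in> set (beta_numbers l)" using \<open>i < ?m\<close> by (auto simp: beta_numbers_def Let_def)
qed

lemma two_quotient:
  assumes l: "l \<in> domino_partitions n"
  shows "partition (quotient_minus l)" "partition (quotient_plus l)"
    "maya (quotient_minus l) = half 0 (maya l)" "maya (quotient_plus l) = half 1 (maya l)"
proof -
  have p: "partition l" using l by (simp add: domino_partitions_def)
  let ?m = "even_bound l"
  define h where "h = ?m div 2"
  have m: "?m = 2 * h" using even_bound(1)[of l] by (simp add: h_def)
  have dec: "sorted_wrt (>) (map (\<lambda>b. b div 2) (filter P (beta_numbers l)))"
    if "P = even \<or> P = odd" for P
  proof -
    have *: "sorted_wrt (>) (filter P (beta_numbers l))"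
      by (rule sorted_wrt_filter[OF beta_numbers_decreasing[OF p]])
    have "sorted_wrt (\<lambda>x y. x div 2 > y div 2) (filter P (beta_numbers l))"
    proof (rule sorted_wrt_mono_rel[OF _ *])
      fix x y assume a: "x \<in> set (filter P (beta_numbers l))" "y \<in> set (filter P (beta_numbers l))" "x > y"
      then have "even x \<longleftrightarrow> even y" using that by auto
      then show "x div 2 > y div 2" using a(3) by presburger
    qed
    then show ?thesis by (simp add: sorted_wrt_map)
  qed
  have len0: "length (map (\<lambda>b. b div 2) (filter even (beta_numbers l))) = h"
    using length_even_betas[OF l] by (simp add: h_def)
  have "length (filter even (beta_numbers l)) + length (filter odd (beta_numbers l)) = ?m"
    using sum_length_filter_compl[of even "beta_numbers l"] by (simp add: beta_numbers_def Let_def)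
  then have len1: "length (map (\<lambda>b. b div 2) (filter odd (beta_numbers l))) = h"
    using length_even_betas[OF l] m by simp
  note A = from_beta_maya[OF dec len0] and B = from_beta_maya[OF dec len1]
  show "partition (quotient_minus l)" "partition (quotient_plus l)"
    using A(1) B(1) unfolding quotient_minus_def quotient_plus_def h_def by auto
  have low: "x \<in> maya l" if "x < - 2 * int h" for x
    using that even_bound(2)[of l] m by (intro maya_low) linarith
  have in0: "x + int h \<in> int ` set (map (\<lambda>b. b div 2) (filter even (beta_numbers l))) \<longleftrightarrow>
      - int h \<le> x \<and> 2 * x \<in> maya l" for x
  proof
    assume "x + int h \<in> int ` set (map (\<lambda>b. b div 2) (filter even (beta_numbers l)))"
    then obtain b where "b \<in> set (beta_numbers l)" "even b" "x + int h = int (b div 2)" by auto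
    moreover from this have "2 * x = int b - int ?m" using m by auto
    ultimately show "- int h \<le> x \<and> 2 * x \<in> maya l" using set_beta_numbers[of b l] by auto
  next
    assume x: "- int h \<le> x \<and> 2 * x \<in> maya l"
    define b where "b = nat (2 * x + 2 * int h)"
    have b: "int b = 2 * x + 2 * int h" using x by (simp add: b_def)
    then have "b \<in> set (beta_numbers l)" using set_beta_numbers[of b l] x m by simp
    moreover have "even b" "x + int h = int (b div 2)" using b by presburger+
    ultimately show "x + int h \<in> int ` set (map (\<lambda>b. b div 2) (filter even (beta_numbers l)))" by auto
  qed
  have in1: "x + int h \<in> int ` set (map (\<lambda>b. b div 2) (filter odd (beta_numbers l))) \<longleftrightarrow>
      - int h \<le> x \<and> 2 * x + 1 \<in> maya l" for x
  proof
    assume "x + int h \<in> int ` set (map (\<lambda>b. b div 2) (filter odd (beta_numbers l)))"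
    then obtain b where b: "b \<in> set (beta_numbers l)" "odd b" "x + int h = int (b div 2)" by auto
    from b(2,3) have "2 * x + 1 = int b - int ?m" unfolding m by presburger
    then show "- int h \<le> x \<and> 2 * x + 1 \<in> maya l" using set_beta_numbers[of b l] b by auto
  next
    assume x: "- int h \<le> x \<and> 2 * x + 1 \<in> maya l"
    define b where "b = nat (2 * x + 1 + 2 * int h)"
    have b: "int b = 2 * x + 1 + 2 * int h" using x by (simp add: b_def)
    then have "b \<in> set (beta_numbers l)" using set_beta_numbers[of b l] x m by simp
    moreover have "odd b" "x + int h = int (b div 2)" using b by presburger+
    ultimately show "x + int h \<in> int ` set (map (\<lambda>b. b div 2) (filter odd (beta_numbers l)))" by auto
  qed
  have "x \<in> maya (quotient_minus l) \<longleftrightarrow> x < - int h \<or> (- int h \<le> x \<and> 2 * x \<in> maya l)" for x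
    unfolding quotient_minus_def h_def[symmetric] using A(2) in0 by simp
  then show "maya (quotient_minus l) = half 0 (maya l)"
    using low by (auto simp: half_def)
  have "x \<in> maya (quotient_plus l) \<longleftrightarrow> x < - int h \<or> (- int h \<le> x \<and> 2 * x + 1 \<in> maya l)" for x
    unfolding quotient_plus_def h_def[symmetric] using B(2) in1 by simp
  then show "maya (quotient_plus l) = half 1 (maya l)"
    using low by (auto simp: half_def)
qed

lemma domino_partitions_partition: "l \<in> domino_partitions n \<Longrightarrow> partition l"
  by (simp add: domino_partitions_def)

lemma domino_partition_eqI:
  assumes "l \<in> domino_partitions n" "l' \<in> domino_partitions n'"
    "quotient_minus l = quotient_minus l'" "quotient_plus l = quotient_plus l'"
  shows "l = l'"
proof (rule maya_inject)
  show "partition l" "partition l'" using assms by (auto intro: domino_partitions_partition)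
  show "maya l = maya l'"
  proof (rule halves_eqI)
    show "half 0 (maya l) = half 0 (maya l')"
      unfolding two_quotient(3)[OF assms(1), symmetric] two_quotient(3)[OF assms(2), symmetric] assms(3) ..
    show "half 1 (maya l) = half 1 (maya l')"
      unfolding two_quotient(4)[OF assms(1), symmetric] two_quotient(4)[OF assms(2), symmetric] assms(4) ..
  qed
qed

lemma two_quotient_ex:
  assumes "partition \<alpha>" "partition \<beta>" "sum_list \<alpha> + sum_list \<beta> = n"
  shows "\<exists>l\<in>domino_partitions n. quotient_minus l = \<alpha> \<and> quotient_plus l = \<beta>"
proof -
  obtain l where l: "l \<in> domino_partitions n" "half 0 (maya l) = maya \<alpha>" "half 1 (maya l) = maya \<beta>"
    using two_quotient_surj[OF assms(1,2)] assms(3) by auto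
  have "quotient_minus l = \<alpha>"
    by (rule maya_inject[OF two_quotient(1)[OF l(1)] assms(1)]) (simp only: two_quotient(3)[OF l(1)] l(2))
  moreover have "quotient_plus l = \<beta>"
    by (rule maya_inject[OF two_quotient(2)[OF l(1)] assms(2)]) (simp only: two_quotient(4)[OF l(1)] l(3))
  ultimately show ?thesis using l(1) by blast
qed

lemma two_quotient_size:
  assumes l: "l \<in> domino_partitions n"
  shows "sum_list (quotient_minus l) + sum_list (quotient_plus l) = n"
proof -
  obtain l' where l': "l' \<in> domino_partitions (sum_list (quotient_minus l) + sum_list (quotient_plus l))"
    "quotient_minus l' = quotient_minus l" "quotient_plus l' = quotient_plus l"
    using two_quotient_ex[OF two_quotient(1,2)[OF l] refl] by blast
  then have "l' = l" using domino_partition_eqI[OF l'(1) l] by simp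
  then show ?thesis using l l'(1) by (simp add: domino_partitions_def)
qed

lemma finite_domino_partitions: "finite (domino_partitions n)"
  by (rule finite_subset[OF _ finite_partitions[of "2 * n"]]) (auto simp: domino_partitions_def)

section \<open>Domino tableaux as sequences of bead moves\<close>

text \<open>The latest move comes first in the list.\<close>

primrec reach :: "int set \<Rightarrow> int list \<Rightarrow> int set" where
  "reach S [] = S"
| "reach S (b # bs) = slide 2 (reach S bs) b"

primrec legal :: "int set \<Rightarrow> int list \<Rightarrow> bool" where
  "legal S [] = True"
| "legal S (b # bs) = (legal S bs \<and> b \<in> reach S bs \<and> b + 2 \<notin> reach S bs)"

fun move_descents :: "int list \<Rightarrow> nat set" where
  "move_descents [] = {}"
| "move_descents [b] = (if b = - 2 then {0} else {})"
| "move_descents (b # b' # bs) = move_descents (b' # bs) \<union> (if b < b' then {Suc (length bs)} else {})"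

abbreviation vacuum :: "int set" where
  "vacuum \<equiv> {x. x < 0}"

definition move_lists :: "nat \<Rightarrow> int set \<Rightarrow> int list set" where
  "move_lists n S = {bs. length bs = n \<and> legal vacuum bs \<and> reach vacuum bs = S}"

text \<open>A tableau is built by adding one domino after the other, and each domino is recorded by the bead it moves.
  As a relation this can be followed by induction in both directions.\<close>

inductive tableau_moves :: "nat \<Rightarrow> nat list \<Rightarrow> (nat \<times> nat \<Rightarrow> nat) \<Rightarrow> int list \<Rightarrow> bool" where
  start: "tableau_moves 0 [] (\<lambda>_. undefined) []"
| step: "tableau_moves n l T bs \<Longrightarrow> domino_step l d l' \<Longrightarrow> b \<in> maya l \<Longrightarrow> b + 2 \<notin> maya l \<Longrightarrow>
    maya l' = slide 2 (maya l) b \<Longrightarrow>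
    tableau_moves (Suc n) l' (extend_tableau (Suc n) l l' T) (b # bs)"

lemma tableau_moves_legal:
  "tableau_moves n l T bs \<Longrightarrow> partition l \<and> bs \<in> move_lists n (maya l)"
  by (induction rule: tableau_moves.induct)
    (auto simp: move_lists_def maya_Nil domino_step_def)

lemma standard_extend:
  assumes s: "domino_step l d l'" and T: "T \<in> standard_domino_tableaux n l"
  shows "extend_tableau (Suc n) l l' T \<in> standard_domino_tableaux (Suc n) l'"
    "labelled_boxes l' (extend_tableau (Suc n) l l' T) (Suc n) = d"
    "k \<le> n \<Longrightarrow> labelled_boxes l' (extend_tableau (Suc n) l l' T) k = labelled_boxes l T k"
proof -
  let ?T = "extend_tableau (Suc n) l l' T"
  have p: "partition l" "partition l'" "domino d" "d \<inter> diagram l = {}" "diagram l' = diagram l \<union> d"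
    using s by (auto simp: domino_step_def)
  have PT: "T \<in> diagram l \<rightarrow>\<^sub>E {1..n}" using T by (simp add: standard_domino_tableaux_def)
  have Tl: "1 \<le> T c \<and> T c \<le> n" if "c \<in> diagram l" for c
    using PiE_mem[OF PT that] by simp
  have row: "T (i, j) \<le> T (i, j')" if "j \<le> j'" "(i, j') \<in> diagram l" for i j j'
    using T that by (auto simp: standard_domino_tableaux_def)
  have col: "T (i, j) \<le> T (i', j)" if "i \<le> i'" "(i', j) \<in> diagram l" for i i' j
    using T that by (auto simp: standard_domino_tableaux_def)
  have eT: "?T c = (if c \<in> diagram l then T c else Suc n)" if "c \<in> diagram l'" for c
    using that by (simp add: extend_tableau_def)
  show lab: "labelled_boxes l' ?T (Suc n) = d"
    using Tl p(4,5) by (force simp: labelled_boxes_def extend_tableau_def)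
  have lab': "labelled_boxes l' ?T k = labelled_boxes l T k" if "k \<le> n" for k
    using that p(5) by (auto simp: labelled_boxes_def extend_tableau_def split: if_splits)
  then show "k \<le> n \<Longrightarrow> labelled_boxes l' ?T k = labelled_boxes l T k" .
  have dom: "domino (labelled_boxes l' ?T k)" if "k \<in> {1..Suc n}" for k
  proof (cases "k = Suc n")
    case False
    then show ?thesis using T that lab'[of k] by (auto simp: standard_domino_tableaux_def)
  qed (simp add: lab p(3))
  show "?T \<in> standard_domino_tableaux (Suc n) l'"
    unfolding standard_domino_tableaux_def
  proof (intro CollectI conjI allI impI ballI)
    show "?T \<in> diagram l' \<rightarrow>\<^sub>E {1..Suc n}"
    proof (rule PiE_I)
      fix c assume "c \<in> diagram l'"
      then show "?T c \<in> {1..Suc n}" using eT[of c] Tl[of c] by auto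
    next
      fix c assume "c \<notin> diagram l'"
      then show "?T c = undefined" using p(5) by (simp add: extend_tableau_def)
    qed
  next
    fix k assume "k \<in> {1..Suc n}" then show "domino (labelled_boxes l' ?T k)" by (rule dom)
  next
    fix i j j' :: nat assume a: "j \<le> j'" "(i, j') \<in> diagram l'"
    have "(i, j) \<in> diagram l'" using diagram_closed[OF p(2) a(2) order.refl a(1)] .
    then show "?T (i, j) \<le> ?T (i, j')"
      using eT a(2) row[OF a(1)] Tl[of "(i, j)"] diagram_closed[OF p(1) _ order.refl a(1)] by auto
  next
    fix i i' j :: nat assume a: "i \<le> i'" "(i', j) \<in> diagram l'"
    have "(i, j) \<in> diagram l'" using diagram_closed[OF p(2) a(2) a(1) order.refl] .
    then show "?T (i, j) \<le> ?T (i', j)"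
      using eT a(2) col[OF a(1)] Tl[of "(i, j)"] diagram_closed[OF p(1) _ a(1) order.refl] by auto
  qed
qed

text \<open>The last conjunct keeps the last domino available for the next induction step, where its position relative
  to the new domino decides about a descent.\<close>

lemma tableau_moves_standard:
  assumes "tableau_moves n l T bs"
  shows "T \<in> standard_domino_tableaux n l \<and> domino_descents n l T = move_descents bs \<and>
    (n > 0 \<longrightarrow> (\<exists>l0 d. domino_step l0 d l \<and> hd bs \<in> maya l0 \<and> maya l = slide 2 (maya l0) (hd bs) \<and>
       labelled_boxes l T n = d))"
  using assms
proof (induction rule: tableau_moves.induct)
  case start
  have "\<not> vertical_domino {}" by (auto simp: vertical_domino_def)
  then show ?case by (auto simp: standard_domino_tableaux_def domino_descents_def labelled_boxes_def)
next
  case (step n l T bs d l' b)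
  let ?T = "extend_tableau (Suc n) l l' T"
  have T: "T \<in> standard_domino_tableaux n l" using step.IH by blast
  note E = standard_extend[OF step.hyps(2) T]
  have len: "length bs = n" using tableau_moves_legal[OF step.hyps(1)] by (simp add: move_lists_def)
  have "domino_descents (Suc n) l' ?T = move_descents (b # bs)"
  proof (cases n)
    case 0
    have "bs = []" using len 0 by simp
    have "l = []" using step.hyps(1) 0 by (auto elim: tableau_moves.cases)
    have "vertical_domino (labelled_boxes l' ?T 1) \<longleftrightarrow> b = - 2"
      using first_domino_step[of d l' b] step.hyps \<open>l = []\<close> E(2) 0 by simp
    then show ?thesis using \<open>bs = []\<close> 0 by (auto simp: domino_descents_def)
  next
    case (Suc k)
    obtain b' bs' where bs: "bs = b' # bs'" using len Suc by (cases bs) auto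
    obtain l0 where l0: "domino_step l0 (labelled_boxes l T n) l" "b' \<in> maya l0" "maya l = slide 2 (maya l0) b'"
      using step.IH Suc bs by auto
    have D: "(\<forall>c\<in>labelled_boxes l T n. \<forall>c'\<in>d. fst c < fst c') \<longleftrightarrow> b < b'"
      by (rule domino_step_descent_iff[OF l0(1) step.hyps(2) l0(2,3) step.hyps(3,5)])
    have "domino_descents (Suc n) l' ?T = domino_descents n l T \<union> (if b < b' then {n} else {})"
    proof (rule set_eqI)
      fix i
      consider "i = 0" | "1 \<le> i" "i < n" | "i = n" "1 \<le> i" | "n < i" by linarith
      then show "i \<in> domino_descents (Suc n) l' ?T \<longleftrightarrow> i \<in> domino_descents n l T \<union> (if b < b' then {n} else {})"
      proof cases
        case 1
        then show ?thesis using Suc E(3)[of 1] by (simp add: domino_descents_def)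
      next
        case 2
        then show ?thesis using E(3)[of i] E(3)[of "i + 1"] by (simp add: domino_descents_def)
      next
        case 3
        then show ?thesis using E(3)[of i] E(2) D by (simp add: domino_descents_def)
      next
        case 4
        then show ?thesis by (simp add: domino_descents_def)
      qed
    qed
    then show ?thesis using step.IH bs len by auto
  qed
  then show ?case using E(1,2) step.hyps by auto
qed

lemma standard_restrict:
  assumes l: "partition l" and T: "T \<in> standard_domino_tableaux (Suc n) l"
  obtains m d T' where "domino_step m d l" "T' \<in> standard_domino_tableaux n m"
    "T = extend_tableau (Suc n) m l T'"
proof -
  have PT: "T \<in> diagram l \<rightarrow>\<^sub>E {1..Suc n}" using T by (simp add: standard_domino_tableaux_def)
  have Tl: "1 \<le> T c \<and> T c \<le> Suc n" if "c \<in> diagram l" for c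
    using PiE_mem[OF PT that] by simp
  have row: "T (i, j) \<le> T (i, j')" if "j \<le> j'" "(i, j') \<in> diagram l" for i j j'
    using T that by (auto simp: standard_domino_tableaux_def)
  have col: "T (i, j) \<le> T (i', j)" if "i \<le> i'" "(i', j) \<in> diagram l" for i i' j
    using T that by (auto simp: standard_domino_tableaux_def)
  have dom: "domino (labelled_boxes l T k)" if "k \<in> {1..Suc n}" for k
    using T that by (auto simp: standard_domino_tableaux_def)
  define D where "D = {c \<in> diagram l. T c \<le> n}"
  have closed: "(i', j') \<in> D" if "(i, j) \<in> D" "i' \<le> i" "j' \<le> j" for i j i' j'
  proof -
    have ij: "(i, j) \<in> diagram l" "T (i, j) \<le> n" using that(1) by (auto simp: D_def)
    have "(i, j') \<in> diagram l" "(i', j') \<in> diagram l"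
      using diagram_closed[OF l ij(1)] that by auto
    moreover have "T (i', j') \<le> T (i, j')" using col[OF that(2)] calculation by blast
    moreover have "T (i, j') \<le> T (i, j)" using row[OF that(3)] ij by blast
    ultimately show ?thesis using ij by (simp add: D_def)
  qed
  obtain m where m: "partition m" "diagram m = D"
  proof (rule order_ideal_diagram[OF l, of D])
    show "D \<subseteq> diagram l" by (auto simp: D_def)
    show "(i', j') \<in> D" if "(i, j) \<in> D" "i' \<le> i" "j' \<le> j" for i j i' j'
      using closed[OF that] .
  qed
  have mem: "c \<in> diagram m \<longleftrightarrow> c \<in> diagram l \<and> T c \<le> n" for c by (simp add: m(2) D_def)
  define d where "d = labelled_boxes l T (Suc n)"
  have s: "domino_step m d l"
    unfolding domino_step_def
  proof (intro conjI m(1) l)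
    show "domino d" unfolding d_def by (rule dom) simp
    show "d \<inter> diagram m = {}" using mem by (auto simp: d_def labelled_boxes_def)
    show "diagram l = diagram m \<union> d" using mem Tl by (force simp: d_def labelled_boxes_def)
  qed
  let ?T = "restrict T (diagram m)"
  have lab: "labelled_boxes m ?T k = labelled_boxes l T k" if "k \<le> n" for k
    using mem that by (auto simp: labelled_boxes_def)
  have "?T \<in> standard_domino_tableaux n m"
    unfolding standard_domino_tableaux_def
  proof (intro CollectI conjI allI impI ballI)
    show "?T \<in> diagram m \<rightarrow>\<^sub>E {1..n}" using mem Tl by (intro restrict_PiE_iff[THEN iffD2]) auto
    show "domino (labelled_boxes m ?T k)" if "k \<in> {1..n}" for k
      using dom[of k] lab[of k] that by simp
    show "?T (i, j) \<le> ?T (i, j')" if "j \<le> j'" "(i, j') \<in> diagram m" for i j j'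
      using diagram_closed[OF m(1) that(2) order.refl that(1)] row[OF that(1)] that(2) mem by simp
    show "?T (i, j) \<le> ?T (i', j)" if "i \<le> i'" "(i', j) \<in> diagram m" for i i' j
      using diagram_closed[OF m(1) that(2) that(1) order.refl] col[OF that(1)] that(2) mem by simp
  qed
  moreover have "T = extend_tableau (Suc n) m l ?T"
  proof
    fix c
    show "T c = extend_tableau (Suc n) m l ?T c"
    proof (cases "c \<in> diagram l")
      case True
      then show ?thesis using mem[of c] Tl[of c] by (auto simp: extend_tableau_def)
    next
      case False
      then show ?thesis using mem[of c] PiE_arb[OF PT False] by (simp add: extend_tableau_def)
    qed
  qed
  ultimately show ?thesis using that s by blast
qed

lemma tableau_has_moves:
  assumes "partition l" "T \<in> standard_domino_tableaux n l" "sum_list l = 2 * n"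
  shows "\<exists>bs. tableau_moves n l T bs"
  using assms
proof (induction n arbitrary: l T)
  case 0
  then have "card (diagram l) = 0" by (simp add: card_diagram)
  then have e: "diagram l = {}" using finite_diagram by auto
  then have "l = []" using diagram_empty_iff[OF 0(1)] by simp
  moreover have "T = (\<lambda>_. undefined)" using 0(2) e by (auto simp: standard_domino_tableaux_def)
  ultimately show ?case using tableau_moves.start by blast
next
  case (Suc n)
  obtain m d T' where m: "domino_step m d l" "T' \<in> standard_domino_tableaux n m" "T = extend_tableau (Suc n) m l T'"
    using standard_restrict[OF Suc.prems(1,2)] by blast
  have p: "partition m" "domino d" "d \<inter> diagram m = {}" "diagram l = diagram m \<union> d"
    using m(1) by (auto simp: domino_step_def)
  have "card (diagram l) = card (diagram m) + card d"
    unfolding p(4) using p(3) domino_card[OF p(2)] by (intro card_Un_disjoint finite_diagram) auto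
  then have "sum_list m = 2 * n" using Suc.prems(3) domino_card[OF p(2)] by (simp add: card_diagram)
  then obtain bs where bs: "tableau_moves n m T' bs" using Suc.IH[OF p(1) m(2)] by blast
  obtain b t R where B: "bead m R = b" "b + 2 \<notin> maya m" "maya l = slide 2 (maya m) b"
    using domino_step_beads[OF m(1)] by metis
  have "b \<in> maya m" using B(1) bead_in_maya by blast
  then show ?case using tableau_moves.step[OF bs m(1) _ B(2,3)] m(3) by blast
qed

lemma legal_moves_have_tableau:
  assumes "legal vacuum bs"
  shows "\<exists>l T. l \<in> domino_partitions (length bs) \<and> maya l = reach vacuum bs \<and> tableau_moves (length bs) l T bs"
  using assms
proof (induction bs)
  case Nil
  then show ?case using Nil_domino_partitions maya_Nil tableau_moves.start by fastforce
next
  case (Cons b bs)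
  then obtain l T where l: "l \<in> domino_partitions (length bs)" "maya l = reach vacuum bs" "tableau_moves (length bs) l T bs"
    by auto
  have b: "b \<in> maya l" "b + 2 \<notin> maya l" using Cons.prems l(2) by auto
  obtain l' d where s: "domino_step l d l'" "maya l' = slide 2 (maya l) b"
    using domino_step_exists[OF domino_partitions_partition[OF l(1)] b] by blast
  show ?case
    using tableau_moves.step[OF l(3) s(1) b s(2)] domino_step_domino_partitions[OF l(1) s(1)] s(2) l(2) by auto
qed

lemma tableau_determines_moves:
  "tableau_moves n l T bs \<Longrightarrow> tableau_moves n l T bs' \<Longrightarrow> bs = bs'"
proof (induction arbitrary: bs' rule: tableau_moves.induct)
  case start
  then show ?case by (auto elim: tableau_moves.cases)
next
  case (step n l T bs d l' b)
  let ?T = "extend_tableau (Suc n) l l' T"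
  from step.prems show ?case
  proof (cases rule: tableau_moves.cases)
    case (step m U cs e c)
    have dl: "{c \<in> diagram k'. extend_tableau (Suc n) k k' W c \<le> n} = diagram k"
      if "domino_step k f k'" "tableau_moves n k W ds" for k k' W f ds
    proof -
      have "W \<in> diagram k \<rightarrow>\<^sub>E {1..n}"
        using tableau_moves_standard[OF that(2)] by (simp add: standard_domino_tableaux_def)
      then have "W c \<le> n" if "c \<in> diagram k" for c using PiE_mem[OF _ that] by fastforce
      moreover have "diagram k \<subseteq> diagram k'" using that(1) by (auto simp: domino_step_def)
      ultimately show ?thesis by (auto simp: extend_tableau_def)
    qed
    have "diagram l = diagram m"
      using dl[OF step.hyps(2,1)] dl[OF local.step(4,3)] local.step(1) by simp
    then have lm: "l = m"
      using partition_eq_iff_diagram[of l m] step.hyps(2) local.step(4) by (simp add: domino_step_def)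
    have "T = U"
    proof
      fix x
      have "T \<in> diagram l \<rightarrow>\<^sub>E {1..n}" "U \<in> diagram l \<rightarrow>\<^sub>E {1..n}"
        using tableau_moves_standard[OF step.hyps(1)] tableau_moves_standard[OF local.step(3)] lm
        by (auto simp: standard_domino_tableaux_def)
      note TU = this
      show "T x = U x"
      proof (cases "x \<in> diagram l")
        case True
        then show ?thesis using fun_cong[OF local.step(1), of x] lm by (simp add: extend_tableau_def)
      next
        case False
        show ?thesis using PiE_arb[OF TU(1) False] PiE_arb[OF TU(2) False] by simp
      qed
    qed
    then have "bs = cs" using step.IH local.step(3) lm by blast
    moreover have "b = c"
      using slide_source[of b "maya l" 2] slide_source[of c "maya l" 2] step.hyps local.step lm by auto
    ultimately show ?thesis using local.step(2) by simp
  qed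
qed

lemma moves_determine_tableau:
  "tableau_moves n l T bs \<Longrightarrow> tableau_moves n l T' bs \<Longrightarrow> T = T'"
proof (induction arbitrary: T' rule: tableau_moves.induct)
  case start
  then show ?case by (auto elim: tableau_moves.cases)
next
  case (step n l T bs d l' b)
  from step.prems show ?case
  proof (cases rule: tableau_moves.cases)
    case (step m U e)
    have "maya l = maya m"
      using slide_inject[of b "maya l" 2 "maya m"] step.hyps local.step by simp
    then have "l = m"
      using maya_inject[of l m] step.hyps(2) local.step by (simp add: domino_step_def)
    then show ?thesis using step.IH local.step by blast
  qed
qed

lemma card_tableaux_eq_card_moves:
  assumes l: "l \<in> domino_partitions n"
  shows "card {T \<in> standard_domino_tableaux n l. P (domino_descents n l T)} =
    card {bs \<in> move_lists n (maya l). P (move_descents bs)}"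
proof -
  have p: "partition l" "sum_list l = 2 * n" using l by (auto simp: domino_partitions_def)
  define F where "F T = (THE bs. tableau_moves n l T bs)" for T
  have F: "tableau_moves n l T bs \<longleftrightarrow> F T = bs" if T: "T \<in> standard_domino_tableaux n l" for T bs
  proof -
    obtain cs where cs: "tableau_moves n l T cs" using tableau_has_moves[OF p(1) T p(2)] by blast
    then have "F T = cs" unfolding F_def using tableau_determines_moves by blast
    then show ?thesis using cs tableau_determines_moves by blast
  qed
  have "bij_betw F {T \<in> standard_domino_tableaux n l. P (domino_descents n l T)}
      {bs \<in> move_lists n (maya l). P (move_descents bs)}"
    unfolding bij_betw_def
  proof
    show "inj_on F {T \<in> standard_domino_tableaux n l. P (domino_descents n l T)}"
      by (rule inj_onI) (metis (no_types, lifting) F mem_Collect_eq moves_determine_tableau)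
    show "F ` {T \<in> standard_domino_tableaux n l. P (domino_descents n l T)} =
      {bs \<in> move_lists n (maya l). P (move_descents bs)}"
    proof (intro equalityI subsetI)
      fix bs assume "bs \<in> F ` {T \<in> standard_domino_tableaux n l. P (domino_descents n l T)}"
      then obtain T where T: "T \<in> standard_domino_tableaux n l" "P (domino_descents n l T)" "bs = F T" by auto
      then have "tableau_moves n l T bs" using F by simp
      then show "bs \<in> {bs \<in> move_lists n (maya l). P (move_descents bs)}"
        using tableau_moves_legal tableau_moves_standard T(2) by fastforce
    next
      fix bs assume bs: "bs \<in> {bs \<in> move_lists n (maya l). P (move_descents bs)}"
      then have "legal vacuum bs" "length bs = n" "reach vacuum bs = maya l" by (auto simp: move_lists_def)
      then obtain k T where k: "k \<in> domino_partitions n" "maya k = maya l" "tableau_moves n k T bs"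
        using legal_moves_have_tableau[of bs] by auto
      have "k = l" using maya_inject[OF domino_partitions_partition[OF k(1)] p(1) k(2)] .
      then have T: "tableau_moves n l T bs" using k by simp
      then have "T \<in> standard_domino_tableaux n l" "P (domino_descents n l T)"
        using tableau_moves_standard[OF T] bs by auto
      moreover have "F T = bs" using F[of T bs] T calculation by simp
      ultimately show "bs \<in> F ` {T \<in> standard_domino_tableaux n l. P (domino_descents n l T)}" by blast
    qed
  qed
  then show ?thesis by (rule bij_betw_same_card)
qed

section \<open>Increasing move sequences and horizontal strips\<close>

text \<open>A descent-free run of moves is determined by the set \<open>M\<close> of its starting points. When the moves are
  made from left to right, a bead is found at \<open>b\<close> if it was there from the outset or has just
  been moved there, and the place \<open>b + d\<close> has not been touched yet.\<close>

definition bead_strip :: "int \<Rightarrow> int set \<Rightarrow> int set \<Rightarrow> int set \<Rightarrow> bool" where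
  "bead_strip d S M S' \<longleftrightarrow> finite M \<and> (\<forall>b\<in>M. (b \<in> S \<or> b - d \<in> M) \<and> b + d \<notin> S) \<and>
     S' = (S \<union> {x. x - d \<in> M}) - M"

lemma bead_strip_empty: "bead_strip d S {} S' \<longleftrightarrow> S' = S"
  by (auto simp: bead_strip_def)

lemma bead_strip_insert:
  assumes d: "0 < d" and b: "\<And>x. x \<in> M \<Longrightarrow> x < b"
  shows "bead_strip d S (insert b M) S' \<longleftrightarrow>
    (\<exists>S1. bead_strip d S M S1 \<and> b \<in> S1 \<and> b + d \<notin> S1 \<and> S' = slide d S1 b)"
proof -
  let ?S1 = "(S \<union> {x. x - d \<in> M}) - M"
  have nb: "b \<notin> M" "b + d \<notin> M" using b[of b] b[of "b + d"] d by auto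
  have c1: "b \<in> ?S1 \<longleftrightarrow> b \<in> S \<or> b - d \<in> insert b M" using nb d by auto
  have c2: "b + d \<notin> ?S1 \<longleftrightarrow> b + d \<notin> S" using nb by auto
  have c3: "x - d \<in> insert b M \<longleftrightarrow> x - d \<in> M" if "x \<in> M" for x using b[OF that] d by auto
  have c4: "slide d ?S1 b = (S \<union> {x. x - d \<in> insert b M}) - insert b M" if "b \<in> ?S1"
    using nb d that unfolding slide_def by (auto simp: algebra_simps)
  have "bead_strip d S (insert b M) S' \<longleftrightarrow> finite M \<and> (b \<in> S \<or> b - d \<in> insert b M) \<and> b + d \<notin> S \<and>
    (\<forall>x\<in>M. (x \<in> S \<or> x - d \<in> M) \<and> x + d \<notin> S) \<and> S' = (S \<union> {x. x - d \<in> insert b M}) - insert b M"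
    unfolding bead_strip_def using c3 by auto
  also have "\<dots> \<longleftrightarrow> (\<exists>S1. bead_strip d S M S1 \<and> b \<in> S1 \<and> b + d \<notin> S1 \<and> S' = slide d S1 b)"
    unfolding bead_strip_def using c1 c2 c4 by auto
  finally show ?thesis .
qed

lemma increasing_moves_iff_bead_strip:
  "sorted_wrt (>) cs \<Longrightarrow> legal S cs \<and> reach S cs = S' \<longleftrightarrow> bead_strip 2 S (set cs) S'"
proof (induction cs arbitrary: S')
  case (Cons b cs)
  have "bead_strip 2 S (set (b # cs)) S' \<longleftrightarrow>
    (\<exists>S1. bead_strip 2 S (set cs) S1 \<and> b \<in> S1 \<and> b + 2 \<notin> S1 \<and> S' = slide 2 S1 b)"
    using Cons.prems by (simp add: bead_strip_insert)
  also have "\<dots> \<longleftrightarrow> (\<exists>S1. (legal S cs \<and> reach S cs = S1) \<and> b \<in> S1 \<and> b + 2 \<notin> S1 \<and> S' = slide 2 S1 b)"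
    using Cons by simp
  finally show ?case by auto
qed (auto simp: bead_strip_empty)

lemma reach_append: "reach S (cs @ ds) = reach (reach S ds) cs"
  by (induction cs) auto

lemma legal_append: "legal S (cs @ ds) \<longleftrightarrow> legal S ds \<and> legal (reach S ds) cs"
  by (induction cs) (auto simp: reach_append)

lemma sorted_wrt_greater_Cons: "sorted_wrt (>) (b # b' # bs) \<longleftrightarrow> b' < b \<and> sorted_wrt (>) (b' # bs)" for b :: int
  by auto

lemma move_descents_less: "move_descents bs \<subseteq> {..<length bs}"
  by (induction bs rule: move_descents.induct) auto

text \<open>Cutting a list of moves at the last position of \<open>I\<close> leaves a run without descents; the position of the
  cut itself is free to be a descent.\<close>

lemma move_descents_append:
  assumes "legal S (cs @ ds)" "cs \<noteq> []" "length ds \<in> I" "I \<subseteq> {..length ds}"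
  shows "move_descents (cs @ ds) \<subseteq> I \<longleftrightarrow> move_descents ds \<subseteq> I \<and> sorted_wrt (>) cs"
  using assms(1,2)
proof (induction cs)
  case (Cons b cs)
  show ?case
  proof (cases cs)
    case Nil
    then show ?thesis using assms(3) by (cases ds) auto
  next
    case (Cons b' cs')
    have "b \<noteq> b'" using Cons.prems Cons by (auto simp: slide_def)
    moreover have "Suc (length (cs' @ ds)) \<notin> I" using assms(4) by auto
    ultimately have "move_descents ((b # cs) @ ds) \<subseteq> I \<longleftrightarrow> move_descents (cs @ ds) \<subseteq> I \<and> b' < b"
      using Cons by auto
    also have "move_descents (cs @ ds) \<subseteq> I \<longleftrightarrow> move_descents ds \<subseteq> I \<and> sorted_wrt (>) cs"
      using Cons.IH Cons.prems Cons by auto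
    finally show ?thesis unfolding Cons sorted_wrt_greater_Cons by auto
  qed
qed simp

lemma bead_strip_vac_ge: "bead_strip 2 vacuum M S' \<Longrightarrow> b \<in> M \<Longrightarrow> - 2 \<le> b"
  by (force simp: bead_strip_def)

text \<open>In the first run a descent in position \<open>0\<close> has to be excluded too. It means that the first move
  starts at \<open>- 2\<close>, which in an increasing run happens as soon as \<open>- 2\<close> occurs at all.\<close>

lemma move_descents_empty_iff:
  "legal vacuum bs \<Longrightarrow> move_descents bs = {} \<longleftrightarrow> sorted_wrt (>) bs \<and> - 2 \<notin> set bs"
proof (induction bs rule: move_descents.induct)
  case (3 b b' bs)
  have "b \<noteq> b'" using "3.prems" by (auto simp: slide_def)
  then have "move_descents (b # b' # bs) = {} \<longleftrightarrow> (sorted_wrt (>) (b' # bs) \<and> - 2 \<notin> set (b' # bs)) \<and> b' < b"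
    using 3 by auto
  also have "\<dots> \<longleftrightarrow> (sorted_wrt (>) (b # b' # bs)) \<and> - 2 \<notin> set (b # b' # bs)"
  proof -
    have "- 2 \<le> b'" if "sorted_wrt (>) (b' # bs)"
      using bead_strip_vac_ge[of "set (b' # bs)" "reach vacuum (b' # bs)" b'] "3.prems"
        increasing_moves_iff_bead_strip[OF that, of vacuum "reach vacuum (b' # bs)"] by auto
    then show ?thesis unfolding sorted_wrt_greater_Cons by auto
  qed
  finally show ?case .
qed auto

lemma distinct_if_decreasing: "sorted_wrt (>) cs \<Longrightarrow> distinct cs" for cs :: "int list"
  by (induction cs) auto

lemma card_decreasing_lists:
  "card {cs :: int list. sorted_wrt (>) cs \<and> P (set cs) \<and> length cs = k} = card {M. finite M \<and> P M \<and> card M = k}"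
proof -
  have "bij_betw set {cs :: int list. sorted_wrt (>) cs \<and> P (set cs) \<and> length cs = k} {M. finite M \<and> P M \<and> card M = k}"
  proof (rule bij_betw_byWitness[where f' = "\<lambda>M. rev (sorted_list_of_set M)"])
    show "\<forall>cs\<in>{cs :: int list. sorted_wrt (>) cs \<and> P (set cs) \<and> length cs = k}. rev (sorted_list_of_set (set cs)) = cs"
    proof clarify
      fix cs :: "int list" assume "sorted_wrt (>) cs"
      then have "sorted_wrt (<) (rev cs)" by (simp add: sorted_wrt_rev)
      then have "sorted_list_of_set (set (rev cs)) = rev cs"
        by (intro sorted_list_of_set.idem_if_sorted_distinct) (auto simp: strict_sorted_iff)
      then show "rev (sorted_list_of_set (set cs)) = cs" by simp
    qed
    show "\<forall>M\<in>{M. finite M \<and> P M \<and> card M = k}. set (rev (sorted_list_of_set M)) = M" by simp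
    show "set ` {cs :: int list. sorted_wrt (>) cs \<and> P (set cs) \<and> length cs = k} \<subseteq> {M. finite M \<and> P M \<and> card M = k}"
      by (auto simp: distinct_card distinct_if_decreasing)
    show "(\<lambda>M. rev (sorted_list_of_set M)) ` {M. finite M \<and> P M \<and> card M = k} \<subseteq>
      {cs :: int list. sorted_wrt (>) cs \<and> P (set cs) \<and> length cs = k}"
      by (auto simp: sorted_wrt_rev)
  qed
  then show ?thesis by (rule bij_betw_same_card)
qed

definition strip_moves :: "nat list \<Rightarrow> nat list \<Rightarrow> int set" where
  "strip_moves m l = (\<Union>i. {bead m i..<bead l i})"

lemma bead_le: "hstrip m l \<Longrightarrow> bead m i \<le> bead l i"
  using hstripD(4)[of m l i] by (simp add: bead_def)

lemma bead_less: "hstrip m l \<Longrightarrow> bead l (Suc i) < bead m i"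
  using hstripD(3)[of m l i] by (simp add: bead_def)

lemma card_strip_moves:
  assumes h: "hstrip m l"
  shows "finite (strip_moves m l) \<and> card (strip_moves m l) + sum_list m = sum_list l"
proof -
  have e: "strip_moves m l = (\<Union>i<length l. {bead m i..<bead l i})"
  proof -
    have "{bead m i..<bead l i} = {}" if "\<not> i < length l" for i
      using that hstripD(4)[OF h, of i] by (simp add: bead_def part_def)
    then show ?thesis unfolding strip_moves_def by blast
  qed
  have disj: "{bead m i..<bead l i} \<inter> {bead m j..<bead l j} = {}" if "i < j" for i j
  proof -
    have "bead l j \<le> bead l (Suc i)" using that bead_less_iff[OF hstripD(2)[OF h], of j "Suc i"]
      by (cases "j = Suc i") auto
    then show ?thesis using bead_less[OF h, of i] by auto
  qed
  have "card (strip_moves m l) = (\<Sum>i<length l. card {bead m i..<bead l i})"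
    unfolding e
  proof (rule card_UN_disjoint)
    show "\<forall>i\<in>{..<length l}. \<forall>j\<in>{..<length l}. i \<noteq> j \<longrightarrow> {bead m i..<bead l i} \<inter> {bead m j..<bead l j} = {}"
      using disj by (metis inf_commute linorder_neqE_nat)
  qed auto
  also have "\<dots> = (\<Sum>i<length l. part l i - part m i)"
    by (intro sum.cong refl) (simp add: bead_def nat_diff_distrib')
  finally have "card (strip_moves m l) + (\<Sum>i<length l. part m i) = (\<Sum>i<length l. (part l i - part m i) + part m i)"
    by (simp add: sum.distrib)
  also have "\<dots> = (\<Sum>i<length l. part l i)"
    by (intro sum.cong refl) (simp add: hstripD(4)[OF h])
  finally show ?thesis
    using sum_list_part[OF hstrip_length(1)[OF h]] sum_list_part[OF order.refl, of l] e by simp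
qed

lemma bead_strip_of_hstrip:
  assumes h: "hstrip m l"
  shows "bead_strip 1 (maya m) (strip_moves m l) (maya l)"
proof -
  note pm = hstripD(1)[OF h] and pl = hstripD(2)[OF h]
  have lowest: "bead l j \<le> bead m i - 1" if "i < j" for i j
  proof -
    have "bead l j \<le> bead l (Suc i)" using that bead_less_iff[OF pl, of j "Suc i"] by (cases "j = Suc i") auto
    then show ?thesis using bead_less[OF h, of i] by simp
  qed
  have notin: "bead l i \<notin> strip_moves m l" for i
  proof
    assume "bead l i \<in> strip_moves m l"
    then obtain j where j: "bead m j \<le> bead l i" "bead l i < bead l j" by (auto simp: strip_moves_def)
    then have "j < i" using bead_less_iff[OF pl] by simp
    then show False using lowest[of j i] j by simp
  qed
  show ?thesis
    unfolding bead_strip_def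
  proof (intro conjI ballI)
    show "finite (strip_moves m l)" using card_strip_moves[OF h] by blast
    fix b assume "b \<in> strip_moves m l"
    then obtain i where i: "bead m i \<le> b" "b < bead l i" by (auto simp: strip_moves_def)
    show "b \<in> maya m \<or> b - 1 \<in> strip_moves m l"
      using i bead_in_maya[of m i] by (cases "b = bead m i") (auto simp: strip_moves_def intro!: exI[of _ i])
    show "b + 1 \<notin> maya m"
    proof
      assume "b + 1 \<in> maya m"
      then obtain j where j: "bead m j = b + 1" by (auto simp: maya_def)
      then have "j < i" using i bead_less_iff[OF pm, of i j] by simp
      then show False using lowest[of j i] i j by simp
    qed
  next
    show "maya l = maya m \<union> {x. x - 1 \<in> strip_moves m l} - strip_moves m l"
    proof (intro equalityI subsetI)
      fix x assume "x \<in> maya l"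
      then obtain i where i: "x = bead l i" by (auto simp: maya_def)
      have "x \<in> maya m \<or> x - 1 \<in> strip_moves m l"
      proof (cases "bead m i = bead l i")
        case True
        then show ?thesis using i bead_in_maya[of m i] by simp
      next
        case False
        then have "x - 1 \<in> {bead m i..<bead l i}" using bead_le[OF h, of i] i by simp
        then show ?thesis unfolding strip_moves_def by blast
      qed
      then show "x \<in> maya m \<union> {x. x - 1 \<in> strip_moves m l} - strip_moves m l" using notin i by simp
    next
      fix x assume x: "x \<in> maya m \<union> {x. x - 1 \<in> strip_moves m l} - strip_moves m l"
      obtain i where i: "bead m i \<le> x" "x \<le> bead l i"
      proof -
        from x consider "x \<in> maya m" | "x - 1 \<in> strip_moves m l" by blast
        then show ?thesis
        proof cases
          case 1
          then obtain i where "x = bead m i" by (auto simp: maya_def)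
          then show ?thesis using that[of i] bead_le[OF h, of i] by simp
        next
          case 2
          then obtain i where "bead m i \<le> x - 1" "x - 1 < bead l i" by (auto simp: strip_moves_def)
          then show ?thesis using that[of i] by simp
        qed
      qed
      have "\<not> x < bead l i" using x i by (auto simp: strip_moves_def)
      then have "x = bead l i" using i by simp
      then show "x \<in> maya l" using bead_in_maya by simp
    qed
  qed
qed

text \<open>Each bead slides along the run of elements of \<open>M\<close> that begins at its place. It has to stop before
  the next bead on its right, and this is the interlacing condition.\<close>

lemma hstrip_of_bead_strip:
  assumes pm: "partition m" and pl: "partition l" and s: "bead_strip 1 (maya m) M (maya l)"
  shows "hstrip m l \<and> M = strip_moves m l"
proof -
  have fin: "finite M" and M: "\<And>b. b \<in> M \<Longrightarrow> b \<in> maya m \<or> b - 1 \<in> M" "\<And>b. b \<in> M \<Longrightarrow> b + 1 \<notin> maya m"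
    and S': "maya l = (maya m \<union> {x. x - 1 \<in> M}) - M"
    using s by (auto simp: bead_strip_def)
  have run_down: "\<exists>i. bead m i \<le> b \<and> {bead m i..b} \<subseteq> M" if "b \<in> M" for b
  proof (rule ccontr)
    assume no: "\<not> ?thesis"
    \<comment> \<open>otherwise the elements of M would descend for ever\<close>
    have "\<forall>j\<le>k. b - int j \<in> M" for k
    proof (induction k)
      case (Suc k)
      have "b - int k \<in> M" using Suc by blast
      moreover have "b - int k \<notin> maya m"
      proof
        assume "b - int k \<in> maya m"
        then obtain i where i: "bead m i = b - int k" by (auto simp: maya_def)
        have "x \<in> M" if "x \<in> {bead m i..b}" for x
          using Suc[rule_format, of "nat (b - x)"] that i by (simp add: nat_le_iff)
        then have "{bead m i..b} \<subseteq> M" by blast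
        moreover have "bead m i \<le> b" using i by simp
        ultimately show False using no by blast
      qed
      ultimately have "b - int k - 1 \<in> M" using M(1) by blast
      then have "b - int (Suc k) \<in> M" by (simp add: algebra_simps)
      then show ?case using Suc by (simp add: le_Suc_eq)
    qed (use that in simp)
    then have "range (\<lambda>k. b - int k) \<subseteq> M" by auto
    then have "finite (range (\<lambda>k. b - int k))" using fin by (rule finite_subset)
    moreover have "inj (\<lambda>k. b - int k)" by (auto intro: injI)
    ultimately show False using finite_imageD by (metis infinite_UNIV_nat)
  qed
  \<comment> \<open>the length of the run of moves beginning at bead number i\<close>
  define t where "t i = (LEAST k. bead m i + int k \<notin> M)" for i
  define e where "e i = bead m i + int (t i)" for i
  have e_notin: "e i \<notin> M" for i
  proof -
    have "\<exists>k. bead m i + int k \<notin> M"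
    proof (rule ccontr)
      assume "\<not> ?thesis"
      then have "range (\<lambda>k. bead m i + int k) \<subseteq> M" by auto
      then have "finite (range (\<lambda>k. bead m i + int k))" using fin by (rule finite_subset)
      moreover have "inj (\<lambda>k. bead m i + int k)" by (auto intro: injI)
      ultimately show False using finite_imageD by (metis infinite_UNIV_nat)
    qed
    then show ?thesis unfolding e_def t_def by (rule LeastI_ex)
  qed
  have run: "x \<in> M" if "bead m i \<le> x" "x < e i" for x i
  proof -
    have "nat (x - bead m i) < t i" using that unfolding e_def by simp
    then have "bead m i + int (nat (x - bead m i)) \<in> M"
      unfolding t_def using not_less_Least by blast
    then show ?thesis using that by simp
  qed
  have e_ge: "bead m i \<le> e i" for i by (simp add: e_def)
  have e_less: "e (Suc i) < bead m i" for i
  proof (rule ccontr)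
    assume "\<not> ?thesis"
    moreover have "bead m (Suc i) < bead m i" using bead_less_iff[OF pm] by simp
    ultimately have "bead m i - 1 \<in> M" using run[of "Suc i" "bead m i - 1"] by simp
    then show False using M(2)[of "bead m i - 1"] bead_in_maya[of m i] by simp
  qed
  have e_step: "e (Suc i) < e i" for i using e_less[of i] e_ge[of i] by simp
  have e_dec: "e j < e i" if "i < j" for i j
    using that
  proof (induction j)
    case (Suc j)
    then show ?case using e_step[of j] by (cases "i = j") auto
  qed simp
  have "range e = maya l"
  proof (intro equalityI subsetI)
    fix x assume "x \<in> range e"
    then obtain i where i: "x = e i" by auto
    have "x \<in> maya m \<or> x - 1 \<in> M"
      using e_ge[of i] run[of i "x - 1"] bead_in_maya[of m i] i by (cases "e i = bead m i") auto
    then show "x \<in> maya l" using e_notin[of i] i unfolding S' by simp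
  next
    fix x assume x: "x \<in> maya l"
    then consider "x \<in> maya m" "x \<notin> M" | "x - 1 \<in> M" "x \<notin> M" unfolding S' by blast
    then show "x \<in> range e"
    proof cases
      case 1
      then obtain i where i: "x = bead m i" by (auto simp: maya_def)
      have "\<not> x < e i" using run[of i x] 1 i by auto
      then have "x = e i" using e_ge[of i] i by simp
      then show ?thesis by blast
    next
      case 2
      obtain i where i: "bead m i \<le> x - 1" "{bead m i..x - 1} \<subseteq> M" using run_down[OF 2(1)] by blast
      have "\<not> x < e i" using run[of i x] 2 i by auto
      moreover have "\<not> e i < x" using i e_notin[of i] e_ge[of i] by auto
      ultimately have "x = e i" by simp
      then show ?thesis by blast
    qed
  qed
  then have e: "e i = bead l i" for i
    using e_dec bead_strict[OF pl] by (intro decreasing_enumeration_unique) (auto simp: maya_def)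
  have h: "hstrip m l"
    unfolding hstrip_def
  proof (intro conjI allI pm pl)
    fix i
    show "part l (Suc i) \<le> part m i" using e_less[of i] unfolding e by (simp add: bead_def)
    show "part m i \<le> part l i" using e_ge[of i] unfolding e by (simp add: bead_def)
  qed
  have "M = strip_moves m l"
  proof (intro equalityI subsetI)
    fix b assume b: "b \<in> M"
    obtain i where i: "bead m i \<le> b" "{bead m i..b} \<subseteq> M" using run_down[OF b] by blast
    have "\<not> e i \<le> b" using i e_notin[of i] e_ge[of i] by auto
    then show "b \<in> strip_moves m l" using i unfolding e by (auto simp: strip_moves_def)
  next
    fix b assume "b \<in> strip_moves m l"
    then show "b \<in> M" using run e by (auto simp: strip_moves_def)
  qed
  then show ?thesis using h by blast
qed

lemma bead_strip_iff_hstrip: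
  assumes "partition m" "partition l"
  shows "bead_strip 1 (maya m) M (maya l) \<longleftrightarrow> hstrip m l \<and> M = strip_moves m l"
  using hstrip_of_bead_strip[OF assms] bead_strip_of_hstrip by blast

lemma finite_iff_halves: "finite M \<longleftrightarrow> finite (half 0 M) \<and> finite (half 1 M)"
  and card_halves: "finite M \<Longrightarrow> card M = card (half 0 M) + card (half 1 M)"
proof -
  have M: "M = (\<lambda>x. 2 * x) ` half 0 M \<union> (\<lambda>x. 2 * x + 1) ` half 1 M"
  proof (rule halves_eqI)
    show "half 0 M = half 0 ((\<lambda>x. 2 * x) ` half 0 M \<union> (\<lambda>x. 2 * x + 1) ` half 1 M)"
      by (auto simp: half_def; presburger)
    show "half 1 M = half 1 ((\<lambda>x. 2 * x) ` half 0 M \<union> (\<lambda>x. 2 * x + 1) ` half 1 M)"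
      by (auto simp: half_def; presburger)
  qed
  have i: "inj_on (\<lambda>x. 2 * x) A" "inj_on (\<lambda>x. 2 * x + 1) A" for A :: "int set"
    by (auto simp: inj_on_def)
  show f: "finite M \<longleftrightarrow> finite (half 0 M) \<and> finite (half 1 M)"
    by (subst (1) M) (simp add: finite_image_iff i)
  assume "finite M"
  then have "card M = card ((\<lambda>x. 2 * x) ` half 0 M) + card ((\<lambda>x. 2 * x + 1) ` half 1 M)"
    using f by (subst (1) M, intro card_Un_disjoint) (auto, presburger)
  then show "card M = card (half 0 M) + card (half 1 M)" by (simp add: card_image i)
qed

lemma bead_strip_halves:
  "bead_strip 2 S M S' \<longleftrightarrow> bead_strip 1 (half 0 S) (half 0 M) (half 0 S') \<and> bead_strip 1 (half 1 S) (half 1 M) (half 1 S')"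
proof -
  have all: "(\<forall>x\<in>A. P x) \<longleftrightarrow> (\<forall>x\<in>half 0 A. P (2 * x)) \<and> (\<forall>x\<in>half 1 A. P (2 * x + 1))" for A P
  proof
    assume R: "(\<forall>x\<in>half 0 A. P (2 * x)) \<and> (\<forall>x\<in>half 1 A. P (2 * x + 1))"
    show "\<forall>x\<in>A. P x"
    proof
      fix x assume x: "x \<in> A"
      have "2 * (x div 2) = x \<or> 2 * (x div 2) + 1 = x" by presburger
      then show "P x"
      proof
        assume 1: "2 * (x div 2) = x"
        then have "x div 2 \<in> half 0 A" using x by (simp add: half_def)
        then have "P (2 * (x div 2))" using R by blast
        then show ?thesis by (simp only: 1)
      next
        assume 2: "2 * (x div 2) + 1 = x"
        then have "x div 2 \<in> half 1 A" using x by (simp add: half_def)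
        then have "P (2 * (x div 2) + 1)" using R by blast
        then show ?thesis by (simp only: 2)
      qed
    qed
  qed (auto simp: half_def)
  have eq: "A = B \<longleftrightarrow> half 0 A = half 0 B \<and> half 1 A = half 1 B" for A B
    using halves_eqI by blast
  have h: "half r ((S \<union> {x. x - 2 \<in> M}) - M) = (half r S \<union> {x. x - 1 \<in> half r M}) - half r M" for r
    by (auto simp: half_def algebra_simps)
  show ?thesis
    unfolding bead_strip_def finite_iff_halves[of M] all[of M] eq[of S'] h
    by (auto simp: half_def algebra_simps)
qed

definition double_maya :: "nat list \<times> nat list \<Rightarrow> int set" where
  "double_maya s = (\<lambda>x. 2 * x) ` maya (fst s) \<union> (\<lambda>x. 2 * x + 1) ` maya (snd s)"

lemma half_double_maya: "half 0 (double_maya s) = maya (fst s)" "half 1 (double_maya s) = maya (snd s)"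
  by (auto simp: half_def double_maya_def; presburger)+

definition pair_strip :: "nat list \<times> nat list \<Rightarrow> nat list \<times> nat list \<Rightarrow> bool" where
  "pair_strip s t \<longleftrightarrow> hstrip (fst s) (fst t) \<and> hstrip (snd s) (snd t)"

definition pair_size :: "nat list \<times> nat list \<Rightarrow> nat" where
  "pair_size s = sum_list (fst s) + sum_list (snd s)"

definition partition_pair :: "nat list \<times> nat list \<Rightarrow> bool" where
  "partition_pair s \<longleftrightarrow> partition (fst s) \<and> partition (snd s)"

lemma double_maya_inject: "partition_pair s \<Longrightarrow> partition_pair t \<Longrightarrow> double_maya s = double_maya t \<Longrightarrow> s = t"
  by (metis half_double_maya maya_inject partition_pair_def prod.expand)

lemma bead_strip_double_maya:
  assumes "partition_pair s" "partition_pair t"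
  shows "bead_strip 2 (double_maya s) M (double_maya t) \<longleftrightarrow> pair_strip s t \<and>
    half 0 M = strip_moves (fst s) (fst t) \<and> half 1 M = strip_moves (snd s) (snd t)"
  using assms unfolding bead_strip_halves half_double_maya partition_pair_def pair_strip_def
  by (auto simp: bead_strip_iff_hstrip)

lemma card_bead_strips:
  assumes st: "partition_pair s" "partition_pair t" and Q: "\<And>M. bead_strip 2 (double_maya s) M (double_maya t) \<Longrightarrow> Q M \<longleftrightarrow> q"
  shows "card {M. finite M \<and> (bead_strip 2 (double_maya s) M (double_maya t) \<and> Q M) \<and> card M = k} =
    (if pair_strip s t \<and> pair_size t = pair_size s + k \<and> q then 1 else 0)"
proof (cases "pair_strip s t")
  case False
  then show ?thesis by (simp add: bead_strip_double_maya[OF st])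
next
  case True
  define M where "M = (\<lambda>x. 2 * x) ` strip_moves (fst s) (fst t) \<union> (\<lambda>x. 2 * x + 1) ` strip_moves (snd s) (snd t)"
  have hM: "half 0 M = strip_moves (fst s) (fst t)" "half 1 M = strip_moves (snd s) (snd t)"
    by (auto simp: half_def M_def; presburger)+
  have h: "hstrip (fst s) (fst t)" "hstrip (snd s) (snd t)" using True by (auto simp: pair_strip_def)
  have bs: "bead_strip 2 (double_maya s) M' (double_maya t) \<longleftrightarrow> M' = M" for M'
    using True hM halves_eqI[of M' M] by (auto simp: bead_strip_double_maya[OF st])
  have fin: "finite M" using bs[of M] by (simp add: bead_strip_def)
  have "card M + pair_size s = pair_size t"
    using card_halves[OF fin] card_strip_moves[OF h(1)] card_strip_moves[OF h(2)] by (simp add: hM pair_size_def)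
  then have "{M. finite M \<and> (bead_strip 2 (double_maya s) M (double_maya t) \<and> Q M) \<and> card M = k} =
    (if pair_size t = pair_size s + k \<and> q then {M} else {})"
    using fin Q[of M] by (auto simp: bs)
  then show ?thesis using True by simp
qed

lemma bead_strip_pair_size:
  assumes st: "partition_pair s" "partition_pair t" and b: "bead_strip 2 (double_maya s) M (double_maya t)"
  shows "pair_strip s t \<and> pair_size t = pair_size s + card M"
proof -
  have h: "pair_strip s t" "half 0 M = strip_moves (fst s) (fst t)" "half 1 M = strip_moves (snd s) (snd t)"
    using b by (auto simp: bead_strip_double_maya[OF st])
  moreover have "finite M" using b by (simp add: bead_strip_def)
  ultimately show ?thesis
    using card_halves[of M] card_strip_moves[of "fst s" "fst t"] card_strip_moves[of "snd s" "snd t"]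
    by (auto simp: pair_size_def pair_strip_def)
qed

text \<open>The number of pairs of semistandard tableaux of shapes \<open>fst s\<close> and \<open>snd s\<close> in which the letter \<open>j\<close>
  occurs \<open>a j\<close> times in total and the first of which does not use the letter \<open>0\<close>.\<close>

primrec pair_kostka :: "nat \<Rightarrow> nat list \<times> nat list \<Rightarrow> (nat \<Rightarrow> nat) \<Rightarrow> nat" where
  "pair_kostka 0 s a = (if s = ([], []) then 1 else 0)"
| "pair_kostka (Suc k) t a = (\<Sum>s | pair_strip s t \<and> (k = 0 \<longrightarrow> fst s = fst t) \<and> pair_size t = pair_size s + a k. pair_kostka k s a)"

lemma finite_pair_strip: "finite {s. pair_strip s t}"
  by (rule finite_subset[of _ "{m. hstrip m (fst t)} \<times> {m. hstrip m (snd t)}"])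
    (auto simp: pair_strip_def finite_hstrip)

lemma pair_strip_partition: "pair_strip s t \<Longrightarrow> partition_pair s \<and> partition_pair t"
  by (auto simp: pair_strip_def partition_pair_def dest: hstripD)

lemma pair_kostka_cong: "(\<And>i. i < k \<Longrightarrow> a i = b i) \<Longrightarrow> pair_kostka k s a = pair_kostka k s b"
  by (induction k arbitrary: s) auto

text \<open>How often the letter \<open>j\<close> occurs at the positive positions of \<^term>\<open>block_word n I\<close>.\<close>

definition block_sizes :: "nat \<Rightarrow> nat set \<Rightarrow> nat \<Rightarrow> nat" where
  "block_sizes n I j = card {i \<in> {1..n}. card {d \<in> I. d < i} = j}"

lemma block_sizes_insert:
  assumes I: "finite I" "\<And>e. e \<in> I \<Longrightarrow> e < d" and d: "d < n"
  shows "block_sizes n (insert d I) (Suc (card I)) = n - d"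
    "j < Suc (card I) \<Longrightarrow> block_sizes n (insert d I) j = block_sizes d I j"
proof -
  have hi: "card {e \<in> insert d I. e < i} = Suc (card I)" if "d < i" for i
  proof -
    have "{e \<in> insert d I. e < i} = insert d I" using I(2) that by (auto intro: less_trans)
    moreover have "d \<notin> I" using I(2) by blast
    ultimately show ?thesis using I(1) by simp
  qed
  have lo: "card {e \<in> insert d I. e < i} = card {e \<in> I. e < i}" if "i \<le> d" for i
    by (rule arg_cong[of _ _ card]) (use that in auto)
  have le: "card {e \<in> I. e < i} \<le> card I" for i using I(1) by (intro card_mono) auto
  have "{i \<in> {1..n}. card {e \<in> insert d I. e < i} = Suc (card I)} = {d<..n}"
  proof (intro equalityI subsetI)
    fix i assume i: "i \<in> {i \<in> {1..n}. card {e \<in> insert d I. e < i} = Suc (card I)}"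
    have "\<not> i \<le> d" using lo[of i] le[of i] i by auto
    then show "i \<in> {d<..n}" using i by simp
  qed (use hi in auto)
  then show "block_sizes n (insert d I) (Suc (card I)) = n - d" by (simp add: block_sizes_def)
  assume j: "j < Suc (card I)"
  have "{i \<in> {1..n}. card {e \<in> insert d I. e < i} = j} = {i \<in> {1..d}. card {e \<in> I. e < i} = j}"
  proof (intro equalityI subsetI)
    fix i assume i: "i \<in> {i \<in> {1..n}. card {e \<in> insert d I. e < i} = j}"
    have "i \<le> d" using hi[of i] i j by force
    then show "i \<in> {i \<in> {1..d}. card {e \<in> I. e < i} = j}" using i lo[of i] by simp
  qed (use lo d in auto)
  then show "block_sizes n (insert d I) j = block_sizes d I j" by (simp add: block_sizes_def)
qed

lemma block_sizes_empty: "block_sizes n {} 0 = n"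
proof -
  have "{i \<in> {1..n}. card {d \<in> {}. d < i} = 0} = {1..n}" by auto
  then show ?thesis unfolding block_sizes_def by simp
qed

lemma reach_double_maya:
  assumes "legal vacuum bs"
  obtains s where "partition_pair s" "reach vacuum bs = double_maya s"
proof -
  obtain l where l: "l \<in> domino_partitions (length bs)" "maya l = reach vacuum bs"
    using legal_moves_have_tableau[OF assms] by blast
  let ?s = "(quotient_minus l, quotient_plus l)"
  have "reach vacuum bs = double_maya ?s"
    unfolding l(2)[symmetric]
    by (rule halves_eqI) (simp_all add: half_double_maya two_quotient[OF l(1)])
  then show ?thesis using that[of ?s] two_quotient(1,2)[OF l(1)] by (simp add: partition_pair_def)
qed

lemma double_maya_Nil: "double_maya ([], []) = vacuum"
proof (rule halves_eqI)
  show "half 0 (double_maya ([], [])) = half 0 vacuum"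
    unfolding half_double_maya by (auto simp: maya_Nil half_def)
  show "half 1 (double_maya ([], [])) = half 1 vacuum"
    unfolding half_double_maya by (auto simp: maya_Nil half_def)
qed

lemma finite_move_lists: "finite (move_lists n S)"
proof -
  have "bs \<in> {bs. set bs \<subseteq> {- 2 * int n..2 * int n} \<and> length bs = n}" if "legal vacuum bs" "length bs = n" for bs
  proof -
    have "set bs \<subseteq> {- 2 * int n..2 * int n} \<and> {x. x < - 2 * int n} \<subseteq> reach vacuum bs \<and> reach vacuum bs \<subseteq> {x. x < 2 * int n}"
      using that
    proof (induction bs arbitrary: n)
      case (Cons b bs)
      obtain k where k: "n = Suc k" "length bs = k" using Cons.prems by auto
      have IH: "set bs \<subseteq> {- 2 * int k..2 * int k}" "{x. x < - 2 * int k} \<subseteq> reach vacuum bs" "reach vacuum bs \<subseteq> {x. x < 2 * int k}"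
        using Cons.IH[of k] Cons.prems k by auto
      have b: "b \<in> reach vacuum bs" "b + 2 \<notin> reach vacuum bs" using Cons.prems by auto
      have b1: "b < 2 * int k" using b IH(3) by blast
      have b2: "- 2 * int k \<le> b + 2" using b IH(2) by force
      show ?case using IH b1 b2 k by (auto simp: slide_def)
    qed auto
    then show ?thesis using that by auto
  qed
  then have "move_lists n S \<subseteq> {bs. set bs \<subseteq> {- 2 * int n..2 * int n} \<and> length bs = n}"
    unfolding move_lists_def by blast
  then show ?thesis by (rule finite_subset) (rule finite_lists_length_eq, simp)
qed

text \<open>The moves after the last element of \<open>I\<close> form an increasing run, hence a horizontal strip on each of the
  two runners; these are the boxes with the largest letter in a pair of tableaux, and induction takes care
  of the earlier moves. In the first run only the odd beads move, since the even ones could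
  only begin with a move from \<open>- 2\<close>: this is why the first tableau has no letter \<open>0\<close>.\<close>

lemma card_moves_eq_pair_kostka:
  assumes "finite I" "I \<subseteq> {..<n}" "partition_pair t"
  shows "card {bs \<in> move_lists n (double_maya t). move_descents bs \<subseteq> I} = pair_kostka (Suc (card I)) t (block_sizes n I)"
  using assms
proof (induction I arbitrary: n t rule: finite_linorder_max_induct)
  case empty
  have "{bs \<in> move_lists n (double_maya t). move_descents bs \<subseteq> {}} =
    {bs. sorted_wrt (>) bs \<and> (bead_strip 2 vacuum (set bs) (double_maya t) \<and> - 2 \<notin> set bs) \<and> length bs = n}"
    using move_descents_empty_iff increasing_moves_iff_bead_strip[of _ vacuum "double_maya t"]
    unfolding move_lists_def by blast
  then have "card {bs \<in> move_lists n (double_maya t). move_descents bs \<subseteq> {}} =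
    card {M. finite M \<and> (bead_strip 2 (double_maya ([], [])) M (double_maya t) \<and> - 2 \<notin> M) \<and> card M = n}"
    unfolding double_maya_Nil using card_decreasing_lists[of "\<lambda>M. bead_strip 2 vacuum M (double_maya t) \<and> - 2 \<notin> M" n] by simp
  also have "\<dots> = (if pair_strip ([], []) t \<and> pair_size t = pair_size ([], []) + n \<and> fst t = [] then 1 else 0)"
  proof (rule card_bead_strips)
    show pp: "partition_pair ([], [])" "partition_pair t" using empty by (auto simp: partition_pair_def)
    fix M assume "bead_strip 2 (double_maya ([], [])) M (double_maya t)"
    then have "half 0 M = strip_moves [] (fst t)" by (simp add: bead_strip_double_maya[OF pp])
    moreover have "- 2 \<in> M \<longleftrightarrow> - 1 \<in> half 0 M" by (simp add: half_def)
    ultimately have "- 2 \<in> M \<longleftrightarrow> - 1 \<in> strip_moves [] (fst t)" by simp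
    also have "\<dots> \<longleftrightarrow> 0 < part (fst t) 0"
    proof
      assume "- 1 \<in> strip_moves [] (fst t)"
      then obtain i where "- 1 < bead (fst t) i" by (auto simp: strip_moves_def)
      then have "0 < part (fst t) i" by (simp add: bead_def)
      then show "0 < part (fst t) 0"
        using part_antimono[of "fst t" 0 i] empty by (auto simp: partition_pair_def)
    next
      assume "0 < part (fst t) 0"
      then show "- 1 \<in> strip_moves [] (fst t)" by (auto simp: strip_moves_def bead_def intro!: exI[of _ 0])
    qed
    also have "\<dots> \<longleftrightarrow> fst t \<noteq> []"
      using part_pos_iff[of "fst t" 0] empty by (auto simp: partition_pair_def)
    finally show "- 2 \<notin> M \<longleftrightarrow> fst t = []" by blast
  qed
  also have "\<dots> = pair_kostka (Suc (card {})) t (block_sizes n {})"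
  proof -
    have "{s. pair_strip s t \<and> fst s = fst t \<and> pair_size t = pair_size s + n} \<inter> {([], [])} =
      (if pair_strip ([], []) t \<and> pair_size t = pair_size ([], []) + n \<and> fst t = [] then {([], [])} else {})"
      by auto
    moreover have "(\<Sum>s | pair_strip s t \<and> fst s = fst t \<and> pair_size t = pair_size s + n. if s = ([], []) then 1 else (0::nat)) =
      card ({s. pair_strip s t \<and> fst s = fst t \<and> pair_size t = pair_size s + n} \<inter> {([], [])})"
      by (subst sum.If_cases) (auto intro: finite_subset[OF _ finite_pair_strip[of t]])
    ultimately show ?thesis by (simp add: block_sizes_empty)
  qed
  finally show ?case .
next
  case (insert d I)
  let ?I = "insert d I"
  have d: "d < n" "I \<subseteq> {..<d}" using insert by auto
  have dI: "d \<notin> I" using d by auto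
  let ?A = "{bs \<in> move_lists n (double_maya t). move_descents bs \<subseteq> ?I}"
  let ?X = "{s. pair_strip s t \<and> pair_size t = pair_size s + (n - d)}"
  let ?B = "\<lambda>s. {ds \<in> move_lists d (double_maya s). move_descents ds \<subseteq> I}"
  let ?C = "\<lambda>s. {cs. sorted_wrt (>) cs \<and> bead_strip 2 (double_maya s) (set cs) (double_maya t) \<and> length cs = n - d}"
  have finX: "finite ?X" by (rule finite_subset[OF _ finite_pair_strip[of t]]) auto
  have cC: "card (?C s) = (if s \<in> ?X then 1 else 0)" if "partition_pair s" for s
    using card_decreasing_lists[of "\<lambda>M. bead_strip 2 (double_maya s) M (double_maya t)" "n - d"]
      card_bead_strips[OF that insert.prems(2), of "\<lambda>_. True" True "n - d"] by simp
  have split: "cs @ ds \<in> ?A \<longleftrightarrow> (\<exists>s. partition_pair s \<and> ds \<in> ?B s \<and> cs \<in> ?C s)"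
    if len: "length cs = n - d" "length ds = d" for cs ds
  proof -
    have ne: "cs \<noteq> []" using len d by auto
    have md: "move_descents (cs @ ds) \<subseteq> ?I \<longleftrightarrow> move_descents ds \<subseteq> I \<and> sorted_wrt (>) cs" if "legal vacuum (cs @ ds)"
    proof -
      have "move_descents (cs @ ds) \<subseteq> ?I \<longleftrightarrow> move_descents ds \<subseteq> ?I \<and> sorted_wrt (>) cs"
        by (rule move_descents_append[OF that ne]) (use d len in auto)
      also have "move_descents ds \<subseteq> ?I \<longleftrightarrow> move_descents ds \<subseteq> I"
        using move_descents_less[of ds] len by auto
      finally show ?thesis .
    qed
    show ?thesis
    proof
      assume A: "cs @ ds \<in> ?A"
      then have l: "legal vacuum (cs @ ds)" "reach vacuum (cs @ ds) = double_maya t" by (auto simp: move_lists_def)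
      then have l': "legal vacuum ds" "legal (reach vacuum ds) cs" "reach (reach vacuum ds) cs = double_maya t"
        by (auto simp: legal_append reach_append)
      obtain s where s: "partition_pair s" "reach vacuum ds = double_maya s" using reach_double_maya[OF l'(1)] by blast
      have "move_descents ds \<subseteq> I" "sorted_wrt (>) cs" using md[OF l(1)] A by auto
      then have "ds \<in> ?B s" "cs \<in> ?C s"
        using l' s len increasing_moves_iff_bead_strip[of cs "double_maya s" "double_maya t"]
        by (auto simp: move_lists_def)
      then show "\<exists>s. partition_pair s \<and> ds \<in> ?B s \<and> cs \<in> ?C s" using s by blast
    next
      assume "\<exists>s. partition_pair s \<and> ds \<in> ?B s \<and> cs \<in> ?C s"
      then obtain s where s: "ds \<in> ?B s" "cs \<in> ?C s" by blast
      have "legal (double_maya s) cs \<and> reach (double_maya s) cs = double_maya t"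
        using s(2) increasing_moves_iff_bead_strip[of cs "double_maya s" "double_maya t"] by auto
      then have "legal vacuum (cs @ ds)" "reach vacuum (cs @ ds) = double_maya t"
        using s(1) by (auto simp: move_lists_def legal_append reach_append)
      then show "cs @ ds \<in> ?A" using md s len d by (auto simp: move_lists_def)
    qed
  qed
  have "bij_betw (\<lambda>(s, cs, ds). cs @ ds) (SIGMA s:?X. ?C s \<times> ?B s) ?A"
    unfolding bij_betw_def
  proof
    show "inj_on (\<lambda>(s, cs, ds). cs @ ds) (SIGMA s:?X. ?C s \<times> ?B s)"
    proof (rule inj_onI)
      fix x y assume x: "x \<in> (SIGMA s:?X. ?C s \<times> ?B s)" and y: "y \<in> (SIGMA s:?X. ?C s \<times> ?B s)"
        and xy: "(case x of (s, cs, ds) \<Rightarrow> cs @ ds) = (case y of (s, cs, ds) \<Rightarrow> cs @ ds)"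
      obtain s cs ds where x': "x = (s, cs, ds)" by (rule prod_cases3)
      obtain s' cs' ds' where y': "y = (s', cs', ds')" by (rule prod_cases3)
      have a: "pair_strip s t" "pair_strip s' t" "ds \<in> move_lists d (double_maya s)" "ds' \<in> move_lists d (double_maya s')"
        "length cs = n - d" "length cs' = n - d" "cs @ ds = cs' @ ds'"
        using x y xy unfolding x' y' by auto
      then have "cs = cs' \<and> ds = ds'" by simp
      moreover from this have "double_maya s = double_maya s'" using a by (auto simp: move_lists_def)
      then have "s = s'" using a pair_strip_partition double_maya_inject by blast
      ultimately show "x = y" unfolding x' y' by simp
    qed
    show "(\<lambda>(s, cs, ds). cs @ ds) ` (SIGMA s:?X. ?C s \<times> ?B s) = ?A"
    proof (intro equalityI subsetI)
      fix bs assume "bs \<in> (\<lambda>(s, cs, ds). cs @ ds) ` (SIGMA s:?X. ?C s \<times> ?B s)"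
      then obtain s cs ds where s: "s \<in> ?X" "cs \<in> ?C s" "ds \<in> ?B s" "bs = cs @ ds" by auto
      have "length cs = n - d" "length ds = d" using s by (auto simp: move_lists_def)
      moreover have "partition_pair s" using s(1) pair_strip_partition by blast
      ultimately show "bs \<in> ?A" using split s by blast
    next
      fix bs assume bs: "bs \<in> ?A"
      \<comment> \<open>the latest moves stand in front\<close>
      define cs ds where "cs = take (n - d) bs" and "ds = drop (n - d) bs"
      have len: "length cs = n - d" "length ds = d" "bs = cs @ ds"
        using bs d by (auto simp: cs_def ds_def move_lists_def)
      then obtain s where s: "partition_pair s" "ds \<in> ?B s" "cs \<in> ?C s" using split bs by blast
      have "s \<in> ?X"
      proof -
        have "distinct cs" using s(3) by (auto simp: distinct_if_decreasing)
        then have "card (set cs) = n - d" using len(1) by (simp add: distinct_card)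
        then show ?thesis using bead_strip_pair_size[OF s(1) insert.prems(2), of "set cs"] s(3) by auto
      qed
      then show "bs \<in> (\<lambda>(s, cs, ds). cs @ ds) ` (SIGMA s:?X. ?C s \<times> ?B s)" using s len(3) by force
    qed
  qed
  then have "card ?A = card (SIGMA s:?X. ?C s \<times> ?B s)" by (rule bij_betw_same_card[symmetric])
  also have "\<dots> = (\<Sum>s\<in>?X. card (?C s \<times> ?B s))"
  proof (rule card_SigmaI[OF finX], rule ballI, rule finite_cartesian_product)
    fix s assume s: "s \<in> ?X"
    then have "partition_pair s" using pair_strip_partition by blast
    then have "card (?C s) = 1" by (rule trans[OF cC if_P[OF s]])
    then show "finite (?C s)" by (intro card_ge_0_finite) simp
    show "finite (?B s)" by (rule finite_subset[OF _ finite_move_lists[of d "double_maya s"]]) auto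
  qed
  also have "\<dots> = (\<Sum>s\<in>?X. card (?B s))"
  proof (rule sum.cong[OF refl])
    fix s assume s: "s \<in> ?X"
    then have "partition_pair s" using pair_strip_partition by blast
    then have "card (?C s) = 1" by (rule trans[OF cC if_P[OF s]])
    then show "card (?C s \<times> ?B s) = card (?B s)" unfolding card_cartesian_product by simp
  qed
  also have "\<dots> = (\<Sum>s\<in>?X. pair_kostka (Suc (card I)) s (block_sizes d I))"
  proof (rule sum.cong[OF refl])
    fix s assume "s \<in> ?X"
    then have "partition_pair s" using pair_strip_partition by blast
    then show "card (?B s) = pair_kostka (Suc (card I)) s (block_sizes d I)" by (rule insert.IH[OF d(2)])
  qed
  also have "\<dots> = (\<Sum>s\<in>?X. pair_kostka (Suc (card I)) s (block_sizes n ?I))"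
    using block_sizes_insert(2)[OF insert.hyps(1) _ d(1)] insert.hyps(2)
    by (intro sum.cong refl pair_kostka_cong) auto
  also have "\<dots> = pair_kostka (Suc (Suc (card I))) t (block_sizes n ?I)"
    using block_sizes_insert(1)[OF insert.hyps(1) _ d(1)] insert.hyps(2) by simp
  finally show ?case using insert.hyps(1) dI by simp
qed

section \<open>Words fixed by a signed permutation\<close>

abbreviation abs_perm :: "(int \<Rightarrow> int) \<Rightarrow> int \<Rightarrow> int" where
  "abs_perm p \<equiv> \<lambda>i. \<bar>p i\<bar>"

lemma hyperoct_eq_iff: "p \<in> hyperoct n \<Longrightarrow> p i = p j \<longleftrightarrow> i = j"
  by (metis hyperoct_inv_apply(1))

lemma hyperoct_eq_0_iff: "p \<in> hyperoct n \<Longrightarrow> p i = 0 \<longleftrightarrow> i = 0"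
  by (metis hyperoct_eq_iff hyperoct_zero)

lemma abs_perm_in:
  assumes "p \<in> hyperoct n" "i \<in> {1..int n}"
  shows "\<bar>p i\<bar> \<in> {1..int n}"
proof -
  have "p i \<in> seg n" "p i \<noteq> 0" using hyperoct_in_seg[OF assms(1), of i] hyperoct_eq_0_iff[OF assms(1), of i] assms(2) by auto
  then show ?thesis by auto
qed

lemma abs_perm_inj:
  assumes p: "p \<in> hyperoct n"
  shows "inj_on (abs_perm p) {1..int n}"
proof (rule inj_onI)
  fix i j assume i: "i \<in> {1..int n}" and j: "j \<in> {1..int n}" and "\<bar>p i\<bar> = \<bar>p j\<bar>"
  then have "p i = p j \<or> p i = p (- j)" by (auto simp: hyperoct_uminus[OF p] abs_eq_iff)
  then have "i = j \<or> i = - j" using hyperoct_eq_iff[OF p] by blast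
  then show "i = j" using i j by auto
qed

lemma signed_cycle_facts:
  assumes p: "p \<in> hyperoct n"
  shows "C \<in> signed_cycles n p \<Longrightarrow> C \<noteq> {} \<and> C \<subseteq> {1..int n}"
    and "C \<in> signed_cycles n p \<Longrightarrow> x \<in> C \<Longrightarrow> orbit (abs_perm p) x = C"
    and "i \<in> {1..int n} \<Longrightarrow> i \<in> orbit (abs_perm p) i \<and> orbit (abs_perm p) i \<in> signed_cycles n p"
proof -
  let ?A = "{1..int n}"
  let ?q = "\<lambda>i. if i \<in> ?A then \<bar>p i\<bar> else i"
  have inj: "inj_on ?q ?A" using abs_perm_inj[OF p] by (auto simp: inj_on_def)
  have "?q ` ?A = ?A"
    by (rule endo_inj_surj[OF _ _ inj]) (use abs_perm_in[OF p] in auto)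
  then have "bij_betw ?q ?A ?A" using inj by (simp add: bij_betw_def)
  then have "?q permutes ?A" by (rule bij_imp_permutes) auto
  then have perm: "permutation ?q" by (metis finite_atLeastAtMost_int permutation_permutes)
  have eq: "orbit (abs_perm p) i = orbit ?q i" if "i \<in> ?A" for i
    by (rule orbit_cong0[OF that]) (use abs_perm_in[OF p] in auto)
  have cyc: "cyclic_on ?q (orbit ?q i)" for i by (rule cyclic_on_orbit'[OF perm])
  have sub: "orbit (abs_perm p) i \<subseteq> ?A" if "i \<in> ?A" for i
  proof
    fix y assume "y \<in> orbit (abs_perm p) i"
    then show "y \<in> ?A" by (induction rule: orbit.induct) (use that abs_perm_in[OF p] in blast)+
  qed
  show 1: "C \<noteq> {} \<and> C \<subseteq> ?A" if C: "C \<in> signed_cycles n p" for C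
  proof -
    obtain i where i: "C = orbit (abs_perm p) i" "i \<in> ?A"
      using C unfolding signed_cycles_def by (rule imageE)
    show ?thesis unfolding i(1) using sub[OF i(2)] orbit_nonempty by (rule conjI[rotated])
  qed
  show "i \<in> orbit (abs_perm p) i \<and> orbit (abs_perm p) i \<in> signed_cycles n p" if "i \<in> ?A" for i
    using permutation_self_in_orbit[OF perm, of i] imageI[OF that, of "orbit (abs_perm p)"]
    unfolding eq[OF that, symmetric] signed_cycles_def by (rule conjI)
  show "orbit (abs_perm p) x = C" if C: "C \<in> signed_cycles n p" "x \<in> C" for C x
  proof -
    obtain i where i: "C = orbit (abs_perm p) i" "i \<in> ?A"
      using C(1) unfolding signed_cycles_def by (rule imageE)
    have Ci: "C = orbit ?q i" unfolding i(1) by (rule eq[OF i(2)])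
    have x: "x \<in> ?A" using 1[OF C(1)] C(2) by blast
    have "\<forall>s\<in>C. C = orbit ?q s" using cyc[of i] unfolding cyclic_on_alldef Ci[symmetric] by (rule conjunct2)
    then have "C = orbit ?q x" using C(2) by (rule bspec)
    then show ?thesis using eq[OF x] by (rule trans[OF _ sym, rotated])
  qed
qed

lemma signed_cycles_disjoint:
  assumes p: "p \<in> hyperoct n" and "C \<in> signed_cycles n p" "D \<in> signed_cycles n p" "C \<noteq> D"
  shows "C \<inter> D = {}"
  using signed_cycle_facts(2)[OF p] assms by blast

lemma Union_signed_cycles:
  assumes p: "p \<in> hyperoct n"
  shows "\<Union>(signed_cycles n p) = {1..int n}"
proof (rule equalityI)
  show "\<Union>(signed_cycles n p) \<subseteq> {1..int n}"
    by (rule Union_least) (rule conjunct2[OF signed_cycle_facts(1)[OF p]])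
  show "{1..int n} \<subseteq> \<Union>(signed_cycles n p)"
  proof
    fix i assume "i \<in> {1..int n}"
    from signed_cycle_facts(3)[OF p this] show "i \<in> \<Union>(signed_cycles n p)" by (elim conjE UnionI)
  qed
qed

lemma finite_signed_cycles: "finite (signed_cycles n p)"
  by (simp add: signed_cycles_def)

lemma finite_signed_cycle:
  assumes "p \<in> hyperoct n" "C \<in> signed_cycles n p"
  shows "finite C"
  by (rule finite_subset[OF conjunct2[OF signed_cycle_facts(1)[OF assms]]]) simp

lemma signed_cycle_step:
  assumes p: "p \<in> hyperoct n" and C: "C \<in> signed_cycles n p" and x: "x \<in> C"
  shows "\<bar>p x\<bar> \<in> C"
  using signed_cycle_facts(2)[OF p C x] orbit.base[of "abs_perm p" x] by simp

lemma signed_cycle_image: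
  assumes p: "p \<in> hyperoct n" and C: "C \<in> signed_cycles n p"
  shows "abs_perm p ` C = C" "inj_on (abs_perm p) C"
proof -
  show inj: "inj_on (abs_perm p) C"
    using inj_on_subset[OF abs_perm_inj[OF p]] signed_cycle_facts(1)[OF p C] by blast
  show "abs_perm p ` C = C"
    by (rule endo_inj_surj[OF finite_signed_cycle[OF p C] _ inj]) (use signed_cycle_step[OF p C] in auto)
qed

lemma prod_signs:
  assumes p: "p \<in> hyperoct n" and C: "C \<in> signed_cycles n p"
  shows "(\<Prod>j\<in>C. sgn (p j)) = (- 1) ^ sign_changes p C"
proof -
  have "sgn (p j) = (if p j < 0 then - 1 else 1)" if "j \<in> C" for j
  proof -
    have "j \<noteq> 0" using signed_cycle_facts(1)[OF p C] that by force
    then show ?thesis using hyperoct_eq_0_iff[OF p, of j] by (auto simp: sgn_if)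
  qed
  then have "(\<Prod>j\<in>C. sgn (p j)) = (\<Prod>j\<in>C. if p j < 0 then - 1 else 1)" by (rule prod.cong[OF refl])
  also have "\<dots> = (- 1) ^ card {j \<in> C. p j < 0}"
    using finite_signed_cycle[OF p C] by (simp add: prod.If_cases Int_def)
  finally show ?thesis by (simp add: sign_changes_def)
qed

lemma sgn_mult_self: "x \<noteq> 0 \<Longrightarrow> sgn x * sgn x = (1::int)"
  by (simp add: sgn_if)

lemma fixed_word_step:
  assumes odd: "\<And>i. f (- i) = - f i" and fix_p: "f \<circ> p = f" and nz: "p j \<noteq> 0"
  shows "f \<bar>p j\<bar> = sgn (p j) * (f j :: int)"
proof -
  have "f (p j) = f j" using fix_p by (metis comp_apply)
  then show ?thesis using odd[of "p j"] nz by (auto simp: abs_if sgn_if)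
qed

text \<open>If the word had a nonzero letter on the cycle, its signs would multiply up to themselves times the
  product of all sign changes, which is \<open>- 1\<close>.\<close>

lemma fixed_word_zero_on_negative_cycle:
  assumes p: "p \<in> hyperoct n" and C: "C \<in> signed_cycles n p" and neg: "odd (sign_changes p C)"
    and odd: "\<And>i. f (- i) = - f i" and fix_p: "f \<circ> p = f" and j: "j \<in> C"
  shows "f j = (0::int)"
proof (rule ccontr)
  assume nz: "f j \<noteq> 0"
  have pn: "p x \<noteq> 0" if "x \<in> C" for x
    using hyperoct_eq_0_iff[OF p, of x] signed_cycle_facts(1)[OF p C] that by force
  note step = fixed_word_step[OF odd fix_p pn]
  have CO: "C = orbit (abs_perm p) j" using signed_cycle_facts(2)[OF p C j] by simp
  have nzC: "f x \<noteq> 0" if "x \<in> orbit (abs_perm p) j" for x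
    using that
  proof (induction rule: orbit.induct)
    case base show ?case using step[OF j] nz pn[OF j] by (simp add: sgn_if)
  next
    case (step y)
    then have "y \<in> C" using CO by simp
    then show ?case using fixed_word_step[OF odd fix_p pn] step pn[of y] by (simp add: sgn_if)
  qed
  have "(\<Prod>x\<in>C. sgn (f x)) = (\<Prod>x\<in>C. sgn (f \<bar>p x\<bar>))"
  proof -
    have "(\<Prod>x\<in>abs_perm p ` C. sgn (f x)) = (\<Prod>x\<in>C. sgn (f \<bar>p x\<bar>))"
      using prod.reindex[OF signed_cycle_image(2)[OF p C], of "\<lambda>x. sgn (f x)"] by simp
    then show ?thesis unfolding signed_cycle_image(1)[OF p C] .
  qed
  also have "\<dots> = (\<Prod>x\<in>C. sgn (p x)) * (\<Prod>x\<in>C. sgn (f x))"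
    unfolding prod.distrib[symmetric] by (intro prod.cong refl) (simp add: step sgn_mult)
  also have "\<dots> = - (\<Prod>x\<in>C. sgn (f x))" using prod_signs[OF p C] neg by simp
  finally have "(\<Prod>x\<in>C. sgn (f x)) = 0" by simp
  then show False using nzC finite_signed_cycle[OF p C] CO by (auto simp: sgn_if split: if_splits)
qed

lemma abs_prod_eq_1: "(\<And>i. i \<in> A \<Longrightarrow> \<bar>h i\<bar> = (1::int)) \<Longrightarrow> \<bar>prod h A\<bar> = 1"
  by (induction A rule: infinite_finite_induct) (auto simp: abs_mult)

text \<open>Accumulate the signs along the cycle, beginning at an arbitrary point. Since the number of sign changes
  is even, returning to that point restores the sign.\<close>

lemma sign_cocycle:
  assumes p: "p \<in> hyperoct n" and C: "C \<in> signed_cycles n p" and pos: "even (sign_changes p C)"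
  shows "\<exists>\<epsilon> :: int \<Rightarrow> int. \<forall>j\<in>C. \<bar>\<epsilon> j\<bar> = 1 \<and> \<epsilon> \<bar>p j\<bar> = sgn (p j) * \<epsilon> j"
proof -
  let ?q = "abs_perm p"
  obtain r where r: "r \<in> C" using signed_cycle_facts(1)[OF p C] by blast
  have CO: "C = orbit ?q r" using signed_cycle_facts(2)[OF p C r] by simp
  then have rr: "r \<in> orbit ?q r" using r by simp
  define m where "m = funpow_dist1 ?q r r"
  have m0: "0 < m" by (simp add: m_def)
  let ?e = "\<lambda>t. (?q ^^ t) r"
  have Ce: "C = ?e ` {0..<m}" unfolding CO m_def by (rule orbit_conv_funpow_dist1[OF rr])
  have inj: "inj_on ?e {0..<m}" unfolding m_def by (rule inj_on_funpow_dist1[OF rr])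
  have em: "?e m = r" unfolding m_def by (rule funpow_dist1_prop[OF rr])
  have sg: "sgn (p j) * sgn (p j) = 1" if "j \<in> C" for j
    using hyperoct_eq_0_iff[OF p, of j] signed_cycle_facts(1)[OF p C] that by (intro sgn_mult_self) force
  define t where "t = inv_into {0..<m} ?e"
  have t: "t j < m" "?e (t j) = j" if "j \<in> C" for j
    using that f_inv_into_f[of j ?e "{0..<m}"] inv_into_into[of j ?e "{0..<m}"] unfolding t_def Ce by auto
  have te: "t (?e k) = k" if "k < m" for k
    unfolding t_def using that by (intro inv_into_f_f[OF inj]) auto
  define \<epsilon> where "\<epsilon> j = (\<Prod>i<t j. sgn (p (?e i)))" for j
  have inC: "?e k \<in> C" if "k < m" for k using that Ce by auto
  have abs1: "\<bar>\<epsilon> j\<bar> = 1" if "j \<in> C" for j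
  proof -
    have "\<bar>sgn (p (?e i))\<bar> = 1" if "i < t j" for i
      using sg[OF inC[of i]] that t(1)[OF \<open>j \<in> C\<close>] by (auto simp: sgn_if split: if_splits)
    then show ?thesis unfolding \<epsilon>_def by (intro abs_prod_eq_1) auto
  qed
  have "\<epsilon> \<bar>p j\<bar> = sgn (p j) * \<epsilon> j" if j: "j \<in> C" for j
  proof -
    have qj: "\<bar>p j\<bar> = ?e (Suc (t j))" using t(2)[OF j] by simp
    show ?thesis
    proof (cases "Suc (t j) < m")
      case True
      have "\<epsilon> \<bar>p j\<bar> = (\<Prod>i<Suc (t j). sgn (p (?e i)))" unfolding \<epsilon>_def qj te[OF True] ..
      also have "\<dots> = \<epsilon> j * sgn (p j)" unfolding \<epsilon>_def using t(2)[OF j] by simp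
      finally show ?thesis by (simp add: mult.commute)
    next
      case False
      then have tj: "Suc (t j) = m" using t(1)[OF j] by simp
      then have "\<bar>p j\<bar> = ?e 0" using qj em by simp
      then have "\<epsilon> \<bar>p j\<bar> = 1" unfolding \<epsilon>_def using te[OF m0] by simp
      also have "1 = (\<Prod>x\<in>C. sgn (p x))" using prod_signs[OF p C] pos by simp
      also have "\<dots> = (\<Prod>i\<in>{0..<m}. sgn (p (?e i)))"
        unfolding Ce using prod.reindex[OF inj, of "\<lambda>x. sgn (p x)"] by simp
      also have "\<dots> = (\<Prod>i<Suc (t j). sgn (p (?e i)))" unfolding tj by (simp add: atLeast0LessThan)
      also have "\<dots> = \<epsilon> j * sgn (p j)" unfolding \<epsilon>_def using t(2)[OF j] by simp
      finally show ?thesis by (simp add: mult.commute)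
    qed
  qed
  then show ?thesis using abs1 by blast
qed

definition fixed_words :: "nat \<Rightarrow> (int \<Rightarrow> int) \<Rightarrow> nat \<Rightarrow> (int \<Rightarrow> int) set" where
  "fixed_words n p k = {f. (\<forall>i. f (- i) = - f i) \<and> (\<forall>i. i \<notin> seg n \<longrightarrow> f i = 0) \<and> (\<forall>i. \<bar>f i\<bar> \<le> int k) \<and> f \<circ> p = f}"

definition cycle_values :: "(int \<Rightarrow> int) \<Rightarrow> nat \<Rightarrow> int set \<Rightarrow> int set" where
  "cycle_values p k C = (if even (sign_changes p C) then {- int k..int k} else {0})"

definition word_of_values :: "nat \<Rightarrow> (int \<Rightarrow> int) \<Rightarrow> (int \<Rightarrow> int) \<Rightarrow> (int set \<Rightarrow> int) \<Rightarrow> int \<Rightarrow> int" where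
  "word_of_values n p \<epsilon> g i = (if i \<in> seg n then sgn i * (g (orbit (abs_perm p) \<bar>i\<bar>) * \<epsilon> \<bar>i\<bar>) else 0)"

text \<open>A fixed word is determined by one letter for each cycle: an arbitrary letter on a positive cycle, and the
  letter \<open>0\<close> on a negative one. The other letters of the cycle follow up to the signs \<open>\<epsilon>\<close>.\<close>

lemma bij_fixed_words:
  assumes p: "p \<in> hyperoct n"
  obtains \<epsilon> where "\<And>i. i \<in> {1..int n} \<Longrightarrow> \<bar>\<epsilon> i\<bar> = 1"
    "bij_betw (word_of_values n p \<epsilon>) (Pi\<^sub>E (signed_cycles n p) (cycle_values p k)) (fixed_words n p k)"
proof -
  let ?q = "abs_perm p" and ?CS = "signed_cycles n p"
  have "\<forall>C. \<exists>\<epsilon> :: int \<Rightarrow> int. C \<in> ?CS \<and> even (sign_changes p C) \<longrightarrow> (\<forall>j\<in>C. \<bar>\<epsilon> j\<bar> = 1 \<and> \<epsilon> \<bar>p j\<bar> = sgn (p j) * \<epsilon> j)"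
    using sign_cocycle[OF p] by blast
  from choice[OF this] obtain E :: "int set \<Rightarrow> int \<Rightarrow> int" where
    E: "\<And>C j. C \<in> ?CS \<Longrightarrow> even (sign_changes p C) \<Longrightarrow> j \<in> C \<Longrightarrow> \<bar>E C j\<bar> = 1 \<and> E C \<bar>p j\<bar> = sgn (p j) * E C j"
    by blast
  define \<epsilon> where "\<epsilon> i = (if even (sign_changes p (orbit ?q i)) then E (orbit ?q i) i else 1)" for i
  note F = signed_cycle_facts[OF p]
  have orb: "orbit ?q \<bar>p i\<bar> = orbit ?q i" if "i \<in> {1..int n}" for i
    using F(2)[of "orbit ?q i" "\<bar>p i\<bar>"] F(3)[OF that] orbit.base[of ?q i] by blast
  have abs1: "\<bar>\<epsilon> i\<bar> = 1" if "i \<in> {1..int n}" for i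
    using E[of "orbit ?q i" i] F(3)[OF that] unfolding \<epsilon>_def by auto
  have sq: "\<epsilon> i * \<epsilon> i = 1" if "i \<in> {1..int n}" for i
    using abs1[OF that] by (metis abs_mult_self_eq mult_1)
  have cocyc: "\<epsilon> \<bar>p i\<bar> = sgn (p i) * \<epsilon> i" if "i \<in> {1..int n}" "even (sign_changes p (orbit ?q i))" for i
    using E[of "orbit ?q i" i] F(3)[OF that(1)] that orb[OF that(1)] unfolding \<epsilon>_def by auto
  have pn: "p i \<noteq> 0" if "i \<in> {1..int n}" for i using hyperoct_eq_0_iff[OF p, of i] that by simp
  have sgp: "sgn (p i) * sgn (p i) = 1" if "i \<in> {1..int n}" for i by (rule sgn_mult_self[OF pn[OF that]])
  \<comment> \<open>any point of the cycle serves as the place where the letter is read off\<close>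
  define rep where "rep C = (SOME x. x \<in> C)" for C :: "int set"
  have rep: "rep C \<in> C" if "C \<in> ?CS" for C
    unfolding rep_def some_in_eq by (rule conjunct1[OF F(1)[OF that]])
  define G where "G f = (\<lambda>C\<in>?CS. f (rep C) * \<epsilon> (rep C))" for f :: "int \<Rightarrow> int"
  let ?W = "word_of_values n p \<epsilon>"
  let ?P = "Pi\<^sub>E ?CS (cycle_values p k)"
  have Wodd: "?W g (- i) = - ?W g i" for g i by (auto simp: word_of_values_def)
  have Wpos: "?W g i = g (orbit ?q i) * \<epsilon> i" if "i \<in> {1..int n}" for g i
    using that by (auto simp: word_of_values_def)
  have gb: "\<bar>g C\<bar> \<le> int k" "odd (sign_changes p C) \<Longrightarrow> g C = 0" if "g \<in> ?P" "C \<in> ?CS" for g C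
    using PiE_mem[OF that] by (auto simp: cycle_values_def split: if_splits)
  have W: "?W g \<in> fixed_words n p k" if g: "g \<in> ?P" for g
    unfolding fixed_words_def
  proof (intro CollectI conjI allI impI)
    fix i
    show "?W g (- i) = - ?W g i" by (rule Wodd)
    show "?W g i = 0" if "i \<notin> seg n" unfolding word_of_values_def using that by (rule if_not_P)
    show "\<bar>?W g i\<bar> \<le> int k"
    proof (cases "i \<in> seg n \<and> i \<noteq> 0")
      case True
      then have i: "\<bar>i\<bar> \<in> {1..int n}" by auto
      then show ?thesis using True gb(1)[OF g] F(3)[OF i] abs1[OF i] by (auto simp: word_of_values_def abs_mult)
    qed (auto simp: word_of_values_def)
  next
    have pos: "?W g (p i) = ?W g i" if i: "i \<in> {1..int n}" for i
    proof -
      have qi: "\<bar>p i\<bar> \<in> {1..int n}" by (rule abs_perm_in[OF p i])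
      have "?W g (p i) = sgn (p i) * ?W g \<bar>p i\<bar>"
        using Wodd[of g "p i"] pn[OF i] by (auto simp: abs_if sgn_if)
      also have "\<dots> = sgn (p i) * (g (orbit ?q i) * \<epsilon> \<bar>p i\<bar>)" using Wpos[OF qi] orb[OF i] by simp
      also have "\<dots> = g (orbit ?q i) * \<epsilon> i"
      proof (cases "even (sign_changes p (orbit ?q i))")
        case True
        have "sgn (p i) * (g (orbit ?q i) * (sgn (p i) * \<epsilon> i)) = (sgn (p i) * sgn (p i)) * (g (orbit ?q i) * \<epsilon> i)"
          by (simp only: mult.assoc mult.left_commute)
        then show ?thesis using cocyc[OF i True] sgp[OF i] by simp
      next
        case False
        then have "g (orbit ?q i) = 0" using gb(2)[OF g] F(3)[OF i] by blast
        then show ?thesis by simp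
      qed
      finally show ?thesis using Wpos[OF i] by simp
    qed
    show "?W g \<circ> p = ?W g"
    proof
      fix i
      consider "i \<in> {1..int n}" | "- i \<in> {1..int n}" | "i = 0" | "i \<notin> seg n" by fastforce
      then show "(?W g \<circ> p) i = ?W g i"
      proof cases
        case 2
        have "?W g (p (- i)) = ?W g (- i)" by (rule pos[OF 2])
        then show ?thesis by (simp add: hyperoct_uminus[OF p] Wodd)
      qed (auto simp: pos hyperoct_zero[OF p] hyperoct_outside[OF p])
    qed
  qed
  have fw: "f (- i) = - f i" "i \<notin> seg n \<Longrightarrow> f i = 0" "\<bar>f i\<bar> \<le> int k" "f \<circ> p = f" if "f \<in> fixed_words n p k" for f i
    using that unfolding fixed_words_def by blast+
  have fneg: "f j = 0" if "f \<in> fixed_words n p k" "C \<in> ?CS" "odd (sign_changes p C)" "j \<in> C" for f C j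
    by (rule fixed_word_zero_on_negative_cycle[OF p that(2,3) fw(1)[OF that(1)] fw(4)[OF that(1)] that(4)])
  have "bij_betw ?W ?P (fixed_words n p k)"
  proof (rule bij_betw_byWitness[where f' = G])
    show "\<forall>g\<in>?P. G (?W g) = g"
    proof
      fix g assume g: "g \<in> ?P"
      show "G (?W g) = g"
      proof
        fix C show "G (?W g) C = g C"
        proof (cases "C \<in> ?CS")
          case True
          have r: "rep C \<in> {1..int n}" using rep[OF True] F(1)[OF True] by blast
          have o: "orbit ?q (rep C) = C" by (rule F(2)[OF True rep[OF True]])
          have "G (?W g) C = g C * (\<epsilon> (rep C) * \<epsilon> (rep C))"
            using True by (simp add: G_def Wpos[OF r] o)
          then show ?thesis using sq[OF r] by simp
        next
          case False
          then show ?thesis using PiE_arb[OF g False] by (simp add: G_def)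
        qed
      qed
    qed
    show "\<forall>f\<in>fixed_words n p k. ?W (G f) = f"
    proof
      fix f assume f: "f \<in> fixed_words n p k"
      have pos: "?W (G f) i = f i" if i: "i \<in> {1..int n}" for i
      proof -
        let ?C = "orbit ?q i"
        have C: "?C \<in> ?CS" "i \<in> ?C" using F(3)[OF i] by auto
        have r: "rep ?C \<in> ?C" "rep ?C \<in> {1..int n}" using rep[OF C(1)] F(1)[OF C(1)] by blast+
        have W: "?W (G f) i = f (rep ?C) * \<epsilon> (rep ?C) * \<epsilon> i" using C by (simp add: Wpos[OF i] G_def)
        show ?thesis
        proof (cases "even (sign_changes p ?C)")
          case True
          have const: "f x * \<epsilon> x = f i * \<epsilon> i" if "x \<in> ?C" for x
            using that
          proof (induction rule: orbit.induct)
            case base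
            have "f \<bar>p i\<bar> * \<epsilon> \<bar>p i\<bar> = (sgn (p i) * sgn (p i)) * (f i * \<epsilon> i)"
              using fixed_word_step[OF fw(1)[OF f] fw(4)[OF f] pn[OF i]] cocyc[OF i True]
              by (simp only: mult.assoc mult.left_commute)
            then show ?case using sgp[OF i] by simp
          next
            case (step y)
            have y: "y \<in> {1..int n}" "orbit ?q y = ?C" using step.hyps F(1,2)[OF C(1)] by blast+
            have "f \<bar>p y\<bar> * \<epsilon> \<bar>p y\<bar> = (sgn (p y) * sgn (p y)) * (f y * \<epsilon> y)"
              using fixed_word_step[OF fw(1)[OF f] fw(4)[OF f] pn[OF y(1)]] cocyc[OF y(1)] True y(2)
              by (simp only: mult.assoc mult.left_commute)
            then show ?case using sgp[OF y(1)] step.IH by simp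
          qed
          show ?thesis using W const[OF r(1)] sq[OF i] by (simp add: mult.assoc)
        next
          case False
          then show ?thesis using W fneg[OF f C(1) False r(1)] fneg[OF f C(1) False C(2)] by simp
        qed
      qed
      show "?W (G f) = f"
      proof
        fix i
        consider "i \<in> {1..int n}" | "- i \<in> {1..int n}" | "i = 0" | "i \<notin> seg n" by fastforce
        then show "?W (G f) i = f i"
        proof cases
          case 2
          have "?W (G f) (- i) = f (- i)" by (rule pos[OF 2])
          then show ?thesis using Wodd fw(1)[OF f] by simp
        next
          case 3
          have "f 0 = 0" using fw(1)[OF f, of 0] by simp
          then show ?thesis using 3 by (simp add: word_of_values_def)
        next
          case 4
          have "?W (G f) i = 0" unfolding word_of_values_def using 4 by (rule if_not_P)
          then show ?thesis using fw(2)[OF f 4] by simp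
        qed (rule pos)
      qed
    qed
    show "?W ` ?P \<subseteq> fixed_words n p k" using W by blast
    show "G ` fixed_words n p k \<subseteq> ?P"
    proof (rule image_subsetI, rule PiE_I)
      fix f C assume f: "f \<in> fixed_words n p k" and C: "C \<in> ?CS"
      have r: "rep C \<in> C" "rep C \<in> {1..int n}" using rep[OF C] F(1)[OF C] by blast+
      have "\<bar>f (rep C) * \<epsilon> (rep C)\<bar> \<le> int k" using fw(3)[OF f] abs1[OF r(2)] by (simp add: abs_mult)
      then show "G f C \<in> cycle_values p k C"
        using C fneg[OF f C _ r(1)] by (auto simp: G_def cycle_values_def abs_le_iff)
    qed (simp add: G_def)
  qed
  then show ?thesis using that abs1 by blast
qed

lemma sum_symmetric_interval:
  fixes h :: "nat \<Rightarrow> 'a::comm_ring_1"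
  shows "(\<Sum>v\<in>{- int k..int k}. h (nat \<bar>v\<bar>)) = h 0 + 2 * (\<Sum>i\<in>{1..k}. h i)"
proof (induction k)
  case (Suc k)
  have "{- int (Suc k)..int (Suc k)} = insert (int (Suc k)) (insert (- int (Suc k)) {- int k..int k})" by auto
  then have "(\<Sum>v\<in>{- int (Suc k)..int (Suc k)}. h (nat \<bar>v\<bar>)) =
    h (Suc k) + (h (Suc k) + (\<Sum>v\<in>{- int k..int k}. h (nat \<bar>v\<bar>)))"
    by (simp add: nat_add_distrib)
  then show ?case using Suc by (simp add: algebra_simps)
qed simp

lemma fixed_words_generating_function:
  fixes x :: "nat \<Rightarrow> 'a::comm_ring_1"
  assumes p: "p \<in> hyperoct n"
  shows "finite (fixed_words n p k)"
    "(\<Sum>f\<in>fixed_words n p k. \<Prod>i\<in>{1..int n}. x (nat \<bar>f i\<bar>)) =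
      (\<Prod>C\<in>signed_cycles n p. if even (sign_changes p C) then x 0 ^ card C + 2 * (\<Sum>i\<in>{1..k}. x i ^ card C) else x 0 ^ card C)"
proof -
  let ?CS = "signed_cycles n p"
  obtain \<epsilon> where abs1: "\<And>i. i \<in> {1..int n} \<Longrightarrow> \<bar>\<epsilon> i\<bar> = 1"
    and bij: "bij_betw (word_of_values n p \<epsilon>) (Pi\<^sub>E ?CS (cycle_values p k)) (fixed_words n p k)"
    using bij_fixed_words[OF p] by blast
  have fin: "finite (cycle_values p k C)" for C by (simp add: cycle_values_def)
  show "finite (fixed_words n p k)"
  proof -
    have "finite (Pi\<^sub>E ?CS (cycle_values p k))" by (intro finite_PiE finite_signed_cycles fin)
    then show ?thesis using bij_betw_finite[OF bij] by simp
  qed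
  have "(\<Sum>f\<in>fixed_words n p k. \<Prod>i\<in>{1..int n}. x (nat \<bar>f i\<bar>)) =
    (\<Sum>g\<in>Pi\<^sub>E ?CS (cycle_values p k). \<Prod>i\<in>{1..int n}. x (nat \<bar>word_of_values n p \<epsilon> g i\<bar>))"
    by (rule sum.reindex_bij_betw[OF bij, symmetric])
  also have "\<dots> = (\<Sum>g\<in>Pi\<^sub>E ?CS (cycle_values p k). \<Prod>C\<in>?CS. x (nat \<bar>g C\<bar>) ^ card C)"
  proof (rule sum.cong[OF refl])
    fix g
    have "(\<Prod>i\<in>{1..int n}. x (nat \<bar>word_of_values n p \<epsilon> g i\<bar>)) = (\<Prod>i\<in>{1..int n}. x (nat \<bar>g (orbit (abs_perm p) i)\<bar>))"
      by (rule prod.cong[OF refl]) (auto simp: word_of_values_def abs_mult abs1)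
    also have "\<dots> = (\<Prod>C\<in>?CS. \<Prod>i\<in>C. x (nat \<bar>g (orbit (abs_perm p) i)\<bar>))"
      unfolding Union_signed_cycles[OF p, symmetric]
      using finite_signed_cycle[OF p] signed_cycles_disjoint[OF p]
      by (subst prod.Union_disjoint) auto
    also have "\<dots> = (\<Prod>C\<in>?CS. \<Prod>i\<in>C. x (nat \<bar>g C\<bar>))"
      by (intro prod.cong refl) (simp add: signed_cycle_facts(2)[OF p])
    also have "\<dots> = (\<Prod>C\<in>?CS. x (nat \<bar>g C\<bar>) ^ card C)" by simp
    finally show "(\<Prod>i\<in>{1..int n}. x (nat \<bar>word_of_values n p \<epsilon> g i\<bar>)) = (\<Prod>C\<in>?CS. x (nat \<bar>g C\<bar>) ^ card C)" .
  qed
  also have "\<dots> = (\<Prod>C\<in>?CS. \<Sum>v\<in>cycle_values p k C. x (nat \<bar>v\<bar>) ^ card C)"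
    by (rule prod_sum_PiE[symmetric, OF finite_signed_cycles fin])
  also have "\<dots> = (\<Prod>C\<in>?CS. if even (sign_changes p C) then x 0 ^ card C + 2 * (\<Sum>i\<in>{1..k}. x i ^ card C) else x 0 ^ card C)"
  proof (intro prod.cong refl)
    fix C show "(\<Sum>v\<in>cycle_values p k C. x (nat \<bar>v\<bar>) ^ card C) =
      (if even (sign_changes p C) then x 0 ^ card C + 2 * (\<Sum>i\<in>{1..k}. x i ^ card C) else x 0 ^ card C)"
      using sum_symmetric_interval[of "\<lambda>i. x i ^ card C" k] by (simp add: cycle_values_def)
  qed
  finally show "(\<Sum>f\<in>fixed_words n p k. \<Prod>i\<in>{1..int n}. x (nat \<bar>f i\<bar>)) =
      (\<Prod>C\<in>?CS. if even (sign_changes p C) then x 0 ^ card C + 2 * (\<Sum>i\<in>{1..k}. x i ^ card C) else x 0 ^ card C)" .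
qed

section \<open>Contents of words\<close>

lemma count_odd_word:
  assumes odd: "\<And>i. f (- i) = - (f i :: int)"
  shows "count (image_mset f (mset_set (seg n))) v =
    (if v = 0 then 1 + 2 * card {i \<in> {1..int n}. nat \<bar>f i\<bar> = 0} else card {i \<in> {1..int n}. nat \<bar>f i\<bar> = nat \<bar>v\<bar>})"
proof -
  have c: "count (image_mset f (mset_set (seg n))) v = card {i \<in> seg n. f i = v}"
    by (simp add: count_image_mset Int_def vimage_def conj_commute)
  show ?thesis
  proof (cases "v = 0")
    case True
    let ?A = "{i \<in> {1..int n}. f i = 0}"
    have "f 0 = 0" using odd[of 0] by simp
    then have "{i \<in> seg n. f i = 0} = insert 0 (?A \<union> uminus ` ?A)"
    proof (intro equalityI subsetI)
      fix i assume i: "i \<in> {i \<in> seg n. f i = 0}"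
      consider "i = 0" | "i > 0" | "i < 0" by linarith
      then show "i \<in> insert 0 (?A \<union> uminus ` ?A)"
      proof cases
        case 3
        then have "- i \<in> ?A" using i odd by auto
        then have "- (- i) \<in> uminus ` ?A" by blast
        then show ?thesis by simp
      qed (use i in auto)
    qed (auto simp: odd)
    moreover have fA: "finite ?A" by (rule finite_subset[of _ "{1..int n}"]) auto
    moreover have "card (?A \<union> uminus ` ?A) = card ?A + card (uminus ` ?A)"
      using fA by (intro card_Un_disjoint) auto
    moreover have "card (uminus ` ?A) = card ?A" by (intro card_image) (auto simp: inj_on_def)
    moreover have "0 \<notin> ?A \<union> uminus ` ?A" by auto
    ultimately have "card {i \<in> seg n. f i = 0} = 1 + 2 * card ?A" by simp
    then show ?thesis using c True by simp
  next
    case False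
    have "bij_betw abs {i \<in> seg n. f i = v} {i \<in> {1..int n}. nat \<bar>f i\<bar> = nat \<bar>v\<bar>}"
      unfolding bij_betw_def
    proof
      show "inj_on abs {i \<in> seg n. f i = v}"
      proof (rule inj_onI)
        fix i j assume ij: "i \<in> {i \<in> seg n. f i = v}" "j \<in> {i \<in> seg n. f i = v}" "\<bar>i\<bar> = \<bar>j\<bar>"
        have "i \<noteq> - j"
        proof
          assume "i = - j"
          then have "f i = - f j" by (simp only: odd)
          then show False using ij False by simp
        qed
        then show "i = j" using ij(3) by (auto simp: abs_eq_iff)
      qed
      show "abs ` {i \<in> seg n. f i = v} = {i \<in> {1..int n}. nat \<bar>f i\<bar> = nat \<bar>v\<bar>}"
      proof (intro equalityI subsetI)
        fix i assume "i \<in> abs ` {i \<in> seg n. f i = v}"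
        then obtain j where j: "j \<in> seg n" "f j = v" "i = \<bar>j\<bar>" by blast
        have "f 0 = 0" using odd[of 0] by simp
        then have "j \<noteq> 0" using j(2) False by blast
        moreover have "\<bar>f \<bar>j\<bar>\<bar> = \<bar>v\<bar>" using j(2) odd[of j] by (cases "j < 0") simp_all
        ultimately show "i \<in> {i \<in> {1..int n}. nat \<bar>f i\<bar> = nat \<bar>v\<bar>}" using j by auto
      next
        fix i assume i: "i \<in> {i \<in> {1..int n}. nat \<bar>f i\<bar> = nat \<bar>v\<bar>}"
        then have "\<bar>f i\<bar> = \<bar>v\<bar>" by (simp add: eq_nat_nat_iff)
        then have "f i = v \<or> f (- i) = v" unfolding odd[of i] by linarith
        then have "i \<in> {i \<in> seg n. f i = v} \<or> - i \<in> {i \<in> seg n. f i = v}" using i by auto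
        moreover have "i = \<bar>i\<bar>" "i = \<bar>- i\<bar>" using i by auto
        ultimately show "i \<in> abs ` {i \<in> seg n. f i = v}" by blast
      qed
    qed
    then have "card {i \<in> seg n. f i = v} = card {i \<in> {1..int n}. nat \<bar>f i\<bar> = nat \<bar>v\<bar>}"
      by (rule bij_betw_same_card)
    then show ?thesis using c False by simp
  qed
qed

lemma card_block_word_level: "card {i \<in> {1..int n}. nat \<bar>block_word n I i\<bar> = j} = block_sizes n I j"
proof -
  have lev: "nat \<bar>block_word n I (int i)\<bar> = card {d \<in> I. d < i}" if "i \<in> {1..n}" for i
    using that by (simp add: block_word_def sgn_if)
  have "{i \<in> {1..int n}. nat \<bar>block_word n I i\<bar> = j} = int ` {i \<in> {1..n}. card {d \<in> I. d < i} = j}"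
  proof (intro equalityI subsetI)
    fix i assume i: "i \<in> {i \<in> {1..int n}. nat \<bar>block_word n I i\<bar> = j}"
    then have k: "nat i \<in> {1..n}" "i = int (nat i)" by auto
    then have "nat i \<in> {i \<in> {1..n}. card {d \<in> I. d < i} = j}" using lev[OF k(1)] i by simp
    then show "i \<in> int ` {i \<in> {1..n}. card {d \<in> I. d < i} = j}" using k(2) by (rule rev_image_eqI)
  next
    fix i assume "i \<in> int ` {i \<in> {1..n}. card {d \<in> I. d < i} = j}"
    then obtain k where "i = int k" "k \<in> {1..n}" "card {d \<in> I. d < k} = j" by blast
    then show "i \<in> {i \<in> {1..int n}. nat \<bar>block_word n I i\<bar> = j}" using lev[of k] by simp
  qed
  then show ?thesis by (simp add: block_sizes_def card_image)
qed

text \<open>An odd word is a rearrangement of the block word as soon as its letters have the right frequencies up to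
  sign, because both words can be sorted and the sorted words agree.\<close>

lemma word_iff_content:
  assumes I: "finite I" and odd: "\<And>i. f (- i) = - f i" and zero: "\<And>i. i \<notin> seg n \<Longrightarrow> f i = 0"
  shows "f \<in> words n I \<longleftrightarrow> (\<forall>j. card {i \<in> {1..int n}. nat \<bar>f i\<bar> = j} = block_sizes n I j)"
proof
  assume f: "f \<in> words n I"
  show "\<forall>j. card {i \<in> {1..int n}. nat \<bar>f i\<bar> = j} = block_sizes n I j"
  proof
    fix j
    have "count (image_mset f (mset_set (seg n))) (int j) = count (image_mset (block_word n I) (mset_set (seg n))) (int j)"
      by (simp only: words_rearrangement[OF f])
    then show "card {i \<in> {1..int n}. nat \<bar>f i\<bar> = j} = block_sizes n I j"
      unfolding count_odd_word[of f, OF odd] count_odd_word[of "block_word n I", OF block_word_uminus] card_block_word_level[symmetric]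
      by (cases "j = 0") auto
  qed
next
  assume c: "\<forall>j. card {i \<in> {1..int n}. nat \<bar>f i\<bar> = j} = block_sizes n I j"
  have ms: "image_mset f (mset_set (seg n)) = image_mset (block_word n I) (mset_set (seg n))"
    by (rule multiset_eqI) (simp only: count_odd_word[of f, OF odd] count_odd_word[of "block_word n I", OF block_word_uminus] card_block_word_level c)
  obtain p where p: "p \<in> hyperoct n" and sm: "strict_mono_on (seg n) (\<lambda>i. lex_key n (f (p i)) (p i))"
    using hyperoct_weak_sort_exists[of f n] odd by blast
  have mono: "mono_on (seg n) (f \<circ> p)"
    by (rule strict_mono_lex_imp_mono[OF p sm])
  have eq: "f \<circ> p = block_word n I"
  proof
    fix i show "(f \<circ> p) i = block_word n I i"
    proof (cases "i \<in> seg n")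
      case True
      show ?thesis
        by (rule mono_rearrangement_eq[OF mono mono_block_word[OF I] _ True])
          (simp only: image_mset_rearrange[OF p] ms)
    next
      case False
      then have "block_word n I i = 0" unfolding block_word_def by (rule if_not_P)
      then show ?thesis using zero[OF False] hyperoct_outside[OF p False] by simp
    qed
  qed
  have "f = block_word n I \<circ> inv p"
    unfolding eq[symmetric] by (simp add: o_assoc[symmetric] hyperoct_inv_comp[OF p])
  then show "f \<in> words n I" unfolding words_def using hyperoct_inv[OF p] by blast
qed

lemma words_fixed_eq:
  assumes I: "I \<subseteq> {..<n}"
  shows "{f \<in> words n I. f \<circ> p = f} =
    {f \<in> fixed_words n p (card I). \<forall>j. card {i \<in> {1..int n}. nat \<bar>f i\<bar> = j} = block_sizes n I j}"
proof -
  have fI: "finite I" using I finite_subset by blast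
  have bd: "\<bar>f i\<bar> \<le> int (card I)" if "f \<in> words n I" for f i
  proof -
    have "card {d \<in> I. int d < \<bar>i\<bar>} \<le> card I" for i using fI by (intro card_mono) auto
    then have "\<bar>block_word n I i\<bar> \<le> int (card I)" for i by (auto simp: block_word_def abs_mult abs_sgn_eq)
    then show ?thesis using that by (auto simp: words_def)
  qed
  show ?thesis
  proof (intro equalityI subsetI)
    fix f assume "f \<in> {f \<in> words n I. f \<circ> p = f}"
    then have f: "f \<in> words n I" "f \<circ> p = f" by auto
    then show "f \<in> {f \<in> fixed_words n p (card I). \<forall>j. card {i \<in> {1..int n}. nat \<bar>f i\<bar> = j} = block_sizes n I j}"
      using word_iff_content[of I f n, OF fI words_uminus[OF f(1)] words_outside[OF f(1)]] bd[OF f(1)]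
        words_uminus[OF f(1)] words_outside[OF f(1)] unfolding fixed_words_def by blast
  next
    fix f assume "f \<in> {f \<in> fixed_words n p (card I). \<forall>j. card {i \<in> {1..int n}. nat \<bar>f i\<bar> = j} = block_sizes n I j}"
    then have f: "\<And>i. f (- i) = - f i" "\<And>i. i \<notin> seg n \<Longrightarrow> f i = 0" "f \<circ> p = f"
      "\<forall>j. card {i \<in> {1..int n}. nat \<bar>f i\<bar> = j} = block_sizes n I j"
      unfolding fixed_words_def by blast+
    then show "f \<in> {f \<in> words n I. f \<circ> p = f}" using word_iff_content[of I f n, OF fI f(1,2)] by blast
  qed
qed

section \<open>Cycle types\<close>

lemma cycle_lengths_properties:
  assumes "finite \<C>" "\<And>C. C \<in> \<C> \<Longrightarrow> finite C \<and> C \<noteq> {}"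
  shows "partition (cycle_lengths \<C>)" "sum_list (cycle_lengths \<C>) = (\<Sum>C\<in>\<C>. card C)"
    "prod_list (map h (cycle_lengths \<C>)) = (\<Prod>C\<in>\<C>. h (card C :: nat) :: 'a::comm_ring_1)"
proof -
  have ms: "mset (cycle_lengths \<C>) = image_mset card (mset_set \<C>)"
    by (simp add: cycle_lengths_def)
  have "sorted_wrt (\<ge>) (cycle_lengths \<C>)"
    by (simp add: cycle_lengths_def sorted_wrt_rev)
  moreover have "0 \<notin> set (cycle_lengths \<C>)"
  proof -
    have "set (cycle_lengths \<C>) = card ` \<C>" using arg_cong[OF ms, of set_mset] assms(1) by simp
    then show ?thesis using assms(2) by auto
  qed
  ultimately show "partition (cycle_lengths \<C>)" by (simp add: partition_def)
  have "sum_list (cycle_lengths \<C>) = sum_mset (mset (cycle_lengths \<C>))" by (rule sum_mset_sum_list[symmetric])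
  then show "sum_list (cycle_lengths \<C>) = (\<Sum>C\<in>\<C>. card C)" unfolding ms by (simp add: sum_unfold_sum_mset)
  have "prod_list (map h (cycle_lengths \<C>)) = prod_mset (image_mset h (mset (cycle_lengths \<C>)))"
    by (simp add: prod_mset_prod_list[symmetric])
  then show "prod_list (map h (cycle_lengths \<C>)) = (\<Prod>C\<in>\<C>. h (card C))"
    unfolding ms by (simp add: prod_unfold_prod_mset multiset.map_comp comp_def)
qed

lemma conj_class_properties:
  assumes p: "p \<in> hyperoct n"
  shows "conj_class n p \<in> domino_partitions n" "quotient_minus (conj_class n p) = negative_cycle_type n p"
    "quotient_plus (conj_class n p) = positive_cycle_type n p"
proof -
  let ?N = "{C \<in> signed_cycles n p. odd (sign_changes p C)}" and ?P = "{C \<in> signed_cycles n p. even (sign_changes p C)}"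
  have fin: "finite ?N" "finite ?P" using finite_signed_cycles[of n p] by auto
  have ne: "finite C \<and> C \<noteq> {}" if "C \<in> signed_cycles n p" for C
    using finite_signed_cycle[OF p that] signed_cycle_facts(1)[OF p that] by blast
  have part: "partition (negative_cycle_type n p)" "partition (positive_cycle_type n p)"
    unfolding negative_cycle_type_def positive_cycle_type_def
    by (rule cycle_lengths_properties(1); use fin ne in blast)+
  have "sum_list (negative_cycle_type n p) + sum_list (positive_cycle_type n p) = (\<Sum>C\<in>?N. card C) + (\<Sum>C\<in>?P. card C)"
    unfolding negative_cycle_type_def positive_cycle_type_def
    by (intro arg_cong2[of _ _ _ _ "(+)"] cycle_lengths_properties(2)) (use fin ne in auto)
  also have "\<dots> = (\<Sum>C\<in>?N \<union> ?P. card C)" using fin by (intro sum.union_disjoint[symmetric]) auto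
  also have "?N \<union> ?P = signed_cycles n p" by blast
  also have "(\<Sum>C\<in>signed_cycles n p. card C) = card (\<Union>(signed_cycles n p))"
    using finite_signed_cycle[OF p] signed_cycles_disjoint[OF p]
    by (intro card_Union_disjoint[symmetric]) (auto simp: pairwise_def disjnt_def)
  also have "\<dots> = n" unfolding Union_signed_cycles[OF p] by simp
  finally have "sum_list (negative_cycle_type n p) + sum_list (positive_cycle_type n p) = n" .
  then obtain l where l: "l \<in> domino_partitions n" "quotient_minus l = negative_cycle_type n p" "quotient_plus l = positive_cycle_type n p"
    using two_quotient_ex[OF part] by blast
  have "conj_class n p = l"
    unfolding conj_class_def by (rule the_equality) (use l domino_partition_eqI in auto)
  then show "conj_class n p \<in> domino_partitions n" "quotient_minus (conj_class n p) = negative_cycle_type n p"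
    "quotient_plus (conj_class n p) = positive_cycle_type n p"
    using l by auto
qed

section \<open>Monomial expansions\<close>

abbreviation lookup where "lookup \<equiv> Poly_Mapping.lookup"
abbreviation monom :: "((nat + nat) \<Rightarrow>\<^sub>0 nat) \<Rightarrow> complex \<Rightarrow> uv_poly" where
  "monom \<equiv> Poly_Mapping.single"

definition variables :: "nat \<Rightarrow> (nat + nat) set" where
  "variables N = Inl ` {..<N} \<union> Inr ` {..<N}"

definition expo :: "nat \<Rightarrow> ((nat + nat) \<Rightarrow> nat) \<Rightarrow> (nat + nat) \<Rightarrow>\<^sub>0 nat" where
  "expo N \<gamma> = (\<Sum>v\<in>variables N. Poly_Mapping.single v (\<gamma> v))"

definition exponents :: "nat \<Rightarrow> nat \<Rightarrow> ((nat + nat) \<Rightarrow> nat) set" where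
  "exponents N d = {\<gamma>. (\<forall>v. v \<notin> variables N \<longrightarrow> \<gamma> v = 0) \<and> (\<Sum>v\<in>variables N. \<gamma> v) = d}"

lemma finite_variables: "finite (variables N)"
  by (simp add: variables_def)

lemma variables_iff [simp]: "Inl i \<in> variables N \<longleftrightarrow> i < N" "Inr i \<in> variables N \<longleftrightarrow> i < N"
  by (auto simp: variables_def)

lemma lookup_expo: "lookup (expo N \<gamma>) v = (if v \<in> variables N then \<gamma> v else 0)"
proof -
  have "lookup (expo N \<gamma>) v = (\<Sum>w\<in>variables N. if w = v then \<gamma> w else 0)"
    by (simp add: expo_def lookup_sum lookup_single when_def)
  then show ?thesis by (simp add: finite_variables)
qed

lemma expo_inject:
  assumes "\<gamma> \<in> exponents N d" "\<delta> \<in> exponents N d'" "expo N \<gamma> = expo N \<delta>"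
  shows "\<gamma> = \<delta>"
proof
  fix v
  have "lookup (expo N \<gamma>) v = lookup (expo N \<delta>) v" using assms(3) by simp
  then show "\<gamma> v = \<delta> v" using assms(1,2) by (cases "v \<in> variables N") (auto simp: lookup_expo exponents_def)
qed

lemma finite_exponents: "finite (exponents N d)"
proof -
  have "finite {\<gamma>. \<forall>v. (v \<in> variables N \<longrightarrow> \<gamma> v \<in> {..d}) \<and> (v \<notin> variables N \<longrightarrow> \<gamma> v = 0)}"
    by (rule finite_set_of_finite_funs) (simp_all add: finite_variables)
  moreover have "exponents N d \<subseteq> {\<gamma>. \<forall>v. (v \<in> variables N \<longrightarrow> \<gamma> v \<in> {..d}) \<and> (v \<notin> variables N \<longrightarrow> \<gamma> v = 0)}"
    unfolding exponents_def using member_le_sum[OF _ _ finite_variables[of N]] by fastforce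
  ultimately show ?thesis by (rule finite_subset[rotated])
qed

text \<open>Distinct exponents give distinct monomials, so coefficients can be read off.\<close>

lemma lookup_expansion:
  assumes "\<delta> \<in> exponents N d"
  shows "lookup (\<Sum>\<gamma>\<in>exponents N d. monom (expo N \<gamma>) (c \<gamma>)) (expo N \<delta>) = c \<delta>"
proof -
  have "lookup (\<Sum>\<gamma>\<in>exponents N d. monom (expo N \<gamma>) (c \<gamma>)) (expo N \<delta>) =
    (\<Sum>\<gamma>\<in>exponents N d. if \<gamma> = \<delta> then c \<gamma> else 0)"
    unfolding lookup_sum
    by (intro sum.cong refl) (use expo_inject assms in \<open>auto simp: lookup_single when_def\<close>)
  then show ?thesis using assms by (simp add: finite_exponents)
qed

lemma expansion_eq_iff:
  "(\<Sum>\<gamma>\<in>exponents N d. monom (expo N \<gamma>) (b \<gamma>)) = (\<Sum>\<gamma>\<in>exponents N d. monom (expo N \<gamma>) (c \<gamma>)) \<longleftrightarrow>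
    (\<forall>\<gamma>\<in>exponents N d. b \<gamma> = c \<gamma>)"
proof
  assume "(\<Sum>\<gamma>\<in>exponents N d. monom (expo N \<gamma>) (b \<gamma>)) = (\<Sum>\<gamma>\<in>exponents N d. monom (expo N \<gamma>) (c \<gamma>))"
  note eq = this
  show "\<forall>\<gamma>\<in>exponents N d. b \<gamma> = c \<gamma>"
  proof
    fix \<gamma> assume g: "\<gamma> \<in> exponents N d"
    show "b \<gamma> = c \<gamma>" using lookup_expansion[OF g, of b] lookup_expansion[OF g, of c] unfolding eq by simp
  qed
qed simp

lemma indet_power: "indet v ^ k = monom (Poly_Mapping.single v k) 1"
  by (induction k) (simp_all add: indet_def mult_single single_add[symmetric])

lemma prod_monom: "(\<Prod>i\<in>A. monom (e i) 1) = monom (\<Sum>i\<in>A. e i) 1"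
  by (induction A rule: infinite_finite_induct) (simp_all add: mult_single)

lemma prod_indet_power: "(\<Prod>v\<in>variables N. indet v ^ \<gamma> v) = monom (expo N \<gamma>) 1"
  by (simp add: indet_power prod_monom expo_def)

lemma const_mult_monom: "const c * monom e d = monom e (c * d)"
  by (simp add: const_def mult_single)

lemma of_nat_mult_monom: "of_nat c * monom e d = monom e (of_nat c * d)"
  by (induction c) (simp_all add: distrib_right single_add)

text \<open>Kostka numbers and their analogue for pairs of shapes both count chains of shapes in which each step
  adds a strip of prescribed size.\<close>

primrec chain_count :: "(nat \<Rightarrow> 's \<Rightarrow> 's set) \<Rightarrow> ('s \<Rightarrow> nat) \<Rightarrow> 's \<Rightarrow> nat \<Rightarrow> 's \<Rightarrow> (nat \<Rightarrow> nat) \<Rightarrow> nat" where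
  "chain_count R w s0 0 s a = (if s = s0 then 1 else 0)"
| "chain_count R w s0 (Suc k) s a = (\<Sum>t | t \<in> R k s \<and> w s = w t + a k. chain_count R w s0 k t a)"

definition compositions :: "nat \<Rightarrow> nat \<Rightarrow> (nat \<Rightarrow> nat) set" where
  "compositions N d = {a. (\<forall>i\<ge>N. a i = 0) \<and> (\<Sum>i<N. a i) = d}"

lemma finite_compositions: "finite (compositions N d)"
proof -
  have "finite {a. \<forall>i. (i \<in> {..<N} \<longrightarrow> a i \<in> {..d}) \<and> (i \<notin> {..<N} \<longrightarrow> a i = 0)}"
    by (rule finite_set_of_finite_funs) simp_all
  moreover have "compositions N d \<subseteq> {a. \<forall>i. (i \<in> {..<N} \<longrightarrow> a i \<in> {..d}) \<and> (i \<notin> {..<N} \<longrightarrow> a i = 0)}"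
  proof
    fix a assume "a \<in> compositions N d"
    then have a: "\<And>i. N \<le> i \<Longrightarrow> a i = 0" and s: "(\<Sum>i<N. a i) = d" by (auto simp: compositions_def)
    have "a i \<le> d" if "i < N" for i using member_le_sum[of i "{..<N}" a] that s by simp
    then show "a \<in> {a. \<forall>i. (i \<in> {..<N} \<longrightarrow> a i \<in> {..d}) \<and> (i \<notin> {..<N} \<longrightarrow> a i = 0)}" using a by simp
  qed
  ultimately show ?thesis by (rule finite_subset[rotated])
qed

lemma compositions_0: "compositions 0 d = (if d = 0 then {\<lambda>_. 0} else {})"
  by (auto simp: compositions_def)

lemma chain_count_cong: "(\<And>i. i < k \<Longrightarrow> a i = b i) \<Longrightarrow> chain_count R w s0 k s a = chain_count R w s0 k s b"
  by (induction k arbitrary: s) auto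

text \<open>Polynomials that arise by adjoining one variable after the other, each weighting the size of a strip,
  have chain counts as coefficients.\<close>

lemma chain_expansion:
  fixes G :: "nat \<Rightarrow> 's \<Rightarrow> 'a::comm_ring_1" and x :: "nat \<Rightarrow> 'a"
  assumes fin: "\<And>k s. finite (R k s)" and le: "\<And>k s t. t \<in> R k s \<Longrightarrow> w t \<le> w s"
    and dom: "\<And>k s t. Q s \<Longrightarrow> t \<in> R k s \<Longrightarrow> Q t" and w0: "w s0 = 0"
    and G0: "\<And>s. Q s \<Longrightarrow> G 0 s = (if s = s0 then 1 else 0)"
    and G1: "\<And>k s. Q s \<Longrightarrow> G (Suc k) s = (\<Sum>t\<in>R k s. G k t * x k ^ (w s - w t))"
    and Q: "Q s"
  shows "G N s = (\<Sum>a\<in>compositions N (w s). of_nat (chain_count R w s0 N s a) * (\<Prod>i<N. x i ^ a i))"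
  using Q
proof (induction N arbitrary: s)
  case 0
  then show ?case by (auto simp: compositions_0 G0 w0)
next
  case (Suc N)
  let ?C = "chain_count R w s0"
  have fin': "finite {t. t \<in> R N s \<and> P t}" for P by (rule finite_subset[OF _ fin[of N s]]) auto
  have inner: "(\<Sum>a\<in>compositions N (w t). of_nat (?C N t a) * (\<Prod>i<N. x i ^ a i)) * x N ^ (w s - w t) =
    (\<Sum>a | a \<in> compositions (Suc N) (w s) \<and> w s = w t + a N. of_nat (?C N t a) * (\<Prod>i<Suc N. x i ^ a i))"
    if t: "t \<in> R N s" for t
    unfolding sum_distrib_right
  proof (rule sum.reindex_bij_witness[where i = "\<lambda>a. a(N := 0)" and j = "\<lambda>a. a(N := w s - w t)"])
    fix a assume a: "a \<in> compositions N (w t)"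
    then show "(a(N := w s - w t))(N := 0) = a" by (auto simp: compositions_def fun_eq_iff)
    show "a(N := w s - w t) \<in> {a. a \<in> compositions (Suc N) (w s) \<and> w s = w t + a N}"
      using a le[OF t] by (auto simp: compositions_def)
    have "?C N t (a(N := w s - w t)) = ?C N t a" by (rule chain_count_cong) simp
    then show "of_nat (?C N t (a(N := w s - w t))) * (\<Prod>i<Suc N. x i ^ (a(N := w s - w t)) i) =
      of_nat (?C N t a) * (\<Prod>i<N. x i ^ a i) * x N ^ (w s - w t)"
      by (simp add: mult.assoc)
  next
    fix a assume a: "a \<in> {a. a \<in> compositions (Suc N) (w s) \<and> w s = w t + a N}"
    then show "(a(N := 0))(N := w s - w t) = a" by (auto simp: fun_eq_iff)
    show "a(N := 0) \<in> compositions N (w t)" using a by (auto simp: compositions_def)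
  qed
  have "G (Suc N) s = (\<Sum>t\<in>R N s. (\<Sum>a\<in>compositions N (w t). of_nat (?C N t a) * (\<Prod>i<N. x i ^ a i)) * x N ^ (w s - w t))"
    unfolding G1[OF Suc.prems] by (intro sum.cong refl) (simp add: Suc.IH[OF dom[OF Suc.prems]])
  also have "\<dots> = (\<Sum>t\<in>R N s. \<Sum>a | a \<in> compositions (Suc N) (w s) \<and> w s = w t + a N. of_nat (?C N t a) * (\<Prod>i<Suc N. x i ^ a i))"
    by (intro sum.cong refl inner)
  also have "\<dots> = (\<Sum>t\<in>R N s. \<Sum>a\<in>compositions (Suc N) (w s). if w s = w t + a N then of_nat (?C N t a) * (\<Prod>i<Suc N. x i ^ a i) else 0)"
    by (rule sum.cong[OF refl]) (rule sum.inter_filter[OF finite_compositions])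
  also have "\<dots> = (\<Sum>a\<in>compositions (Suc N) (w s). \<Sum>t\<in>R N s. if w s = w t + a N then of_nat (?C N t a) * (\<Prod>i<Suc N. x i ^ a i) else 0)"
    by (rule sum.swap)
  also have "\<dots> = (\<Sum>a\<in>compositions (Suc N) (w s). of_nat (?C (Suc N) s a) * (\<Prod>i<Suc N. x i ^ a i))"
  proof (rule sum.cong[OF refl])
    fix a
    have "(\<Sum>t\<in>R N s. if w s = w t + a N then of_nat (?C N t a) * (\<Prod>i<Suc N. x i ^ a i) else 0) =
      (\<Sum>t | t \<in> R N s \<and> w s = w t + a N. of_nat (?C N t a) * (\<Prod>i<Suc N. x i ^ a i))"
      by (rule sum.inter_filter[symmetric, OF fin])
    then show "(\<Sum>t\<in>R N s. if w s = w t + a N then of_nat (?C N t a) * (\<Prod>i<Suc N. x i ^ a i) else 0) =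
      of_nat (?C (Suc N) s a) * (\<Prod>i<Suc N. x i ^ a i)"
      by (simp add: sum_distrib_right[symmetric])
  qed
  finally show ?case .
qed

lemma kostka_eq_chain_count:
  "kostka N l a = chain_count (\<lambda>_ l. {m. hstrip m l}) sum_list [] N l a"
  by (induction N arbitrary: l) simp_all

lemma schur_expansion:
  assumes "partition l"
  shows "schur N x l = (\<Sum>a\<in>compositions N (sum_list l). of_nat (kostka N l a) * (\<Prod>i<N. x i ^ a i))"
  unfolding kostka_eq_chain_count
  by (rule chain_expansion[where Q = partition])
    (use assms in \<open>auto simp: finite_hstrip hstrip_sum_list_le schur_0 schur_Suc dest: hstripD\<close>)

lemma pair_kostka_eq_chain_count:
  "pair_kostka N s a = chain_count (\<lambda>k t. {s. pair_strip s t \<and> (k = 0 \<longrightarrow> fst s = fst t)}) pair_size ([], []) N s a"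
  by (induction N arbitrary: s) (simp_all add: conj_assoc)

text \<open>Setting the first variable to \<open>0\<close> in one of the two factors forbids the letter \<open>0\<close> in the first
  tableau of a pair.\<close>

lemma pair_schur_expansion:
  fixes x :: "nat \<Rightarrow> 'a::comm_ring_1"
  assumes "partition_pair s"
  shows "schur N (x(0 := 0)) (fst s) * schur N x (snd s) =
    (\<Sum>a\<in>compositions N (pair_size s). of_nat (pair_kostka N s a) * (\<Prod>i<N. x i ^ a i))"
  unfolding pair_kostka_eq_chain_count
proof (rule chain_expansion[where Q = partition_pair and G = "\<lambda>N s. schur N (x(0 := 0)) (fst s) * schur N x (snd s)"])
  fix k :: nat and t s :: "nat list \<times> nat list"
  show "finite {s. pair_strip s t \<and> (k = 0 \<longrightarrow> fst s = fst t)}"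
    by (rule finite_subset[OF _ finite_pair_strip[of t]]) auto
  show "pair_size s \<le> pair_size t" if "s \<in> {s. pair_strip s t \<and> (k = 0 \<longrightarrow> fst s = fst t)}"
    using that by (auto simp: pair_size_def pair_strip_def intro!: add_mono hstrip_sum_list_le)
  show "partition_pair s" if "s \<in> {s. pair_strip s t \<and> (k = 0 \<longrightarrow> fst s = fst t)}"
    using that pair_strip_partition by blast
  show "pair_size ([], []) = 0" by (simp add: pair_size_def)
  assume s: "partition_pair s"
  show "schur 0 (x(0 := 0)) (fst s) * schur 0 x (snd s) = (if s = ([], []) then 1 else 0)"
    using s by (cases s) (auto simp: partition_pair_def schur_0)
  have p: "partition (fst s)" "partition (snd s)" using s by (auto simp: partition_pair_def)
  have "schur (Suc k) (x(0 := 0)) (fst s) * schur (Suc k) x (snd s) =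
    (\<Sum>(m, m')\<in>{m. hstrip m (fst s)} \<times> {m. hstrip m (snd s)}.
      schur k (x(0 := 0)) m * (x(0 := 0)) k ^ (sum_list (fst s) - sum_list m) * (schur k x m' * x k ^ (sum_list (snd s) - sum_list m')))"
    unfolding schur_Suc[OF p(1)] schur_Suc[OF p(2)] sum_product by (rule sum.cartesian_product)
  also have "{m. hstrip m (fst s)} \<times> {m. hstrip m (snd s)} = {t. pair_strip t s}"
    by (auto simp: pair_strip_def)
  also have "(\<Sum>(m, m')\<in>{t. pair_strip t s}.
      schur k (x(0 := 0)) m * (x(0 := 0)) k ^ (sum_list (fst s) - sum_list m) * (schur k x m' * x k ^ (sum_list (snd s) - sum_list m'))) =
    (\<Sum>t | pair_strip t s \<and> (k = 0 \<longrightarrow> fst t = fst s).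
      schur k (x(0 := 0)) (fst t) * schur k x (snd t) * x k ^ (pair_size s - pair_size t))"
  proof (rule sum.mono_neutral_cong_right[OF finite_pair_strip])
    show "{t. pair_strip t s \<and> (k = 0 \<longrightarrow> fst t = fst s)} \<subseteq> {t. pair_strip t s}" by blast
    show "\<forall>t\<in>{t. pair_strip t s} - {t. pair_strip t s \<and> (k = 0 \<longrightarrow> fst t = fst s)}.
      (case t of (m, m') \<Rightarrow> schur k (x(0 := 0)) m * (x(0 := 0)) k ^ (sum_list (fst s) - sum_list m) *
        (schur k x m' * x k ^ (sum_list (snd s) - sum_list m'))) = 0"
    proof
      fix t assume t: "t \<in> {t. pair_strip t s} - {t. pair_strip t s \<and> (k = 0 \<longrightarrow> fst t = fst s)}"
      then have h: "hstrip (fst t) (fst s)" "k = 0" "fst t \<noteq> fst s" by (auto simp: pair_strip_def)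
      then have "sum_list (fst t) < sum_list (fst s)"
        using hstrip_sum_list_le[OF h(1)] hstrip_sum_list_eq[OF h(1)] by fastforce
      then show "(case t of (m, m') \<Rightarrow> schur k (x(0 := 0)) m * (x(0 := 0)) k ^ (sum_list (fst s) - sum_list m) *
        (schur k x m' * x k ^ (sum_list (snd s) - sum_list m'))) = 0"
        using h(2) by (simp add: case_prod_beta power_0_left)
    qed
    fix t assume t: "t \<in> {t. pair_strip t s \<and> (k = 0 \<longrightarrow> fst t = fst s)}"
    then have le: "sum_list (fst t) \<le> sum_list (fst s)" "sum_list (snd t) \<le> sum_list (snd s)"
      by (auto simp: pair_strip_def hstrip_sum_list_le)
    have x: "(x(0 := 0)) k ^ (sum_list (fst s) - sum_list (fst t)) = x k ^ (sum_list (fst s) - sum_list (fst t))"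
      using t by (cases "k = 0") auto
    have ps: "pair_size s - pair_size t = (sum_list (fst s) - sum_list (fst t)) + (sum_list (snd s) - sum_list (snd t))"
      using le by (simp add: pair_size_def)
    show "(case t of (m, m') \<Rightarrow> schur k (x(0 := 0)) m * (x(0 := 0)) k ^ (sum_list (fst s) - sum_list m) *
        (schur k x m' * x k ^ (sum_list (snd s) - sum_list m'))) =
      schur k (x(0 := 0)) (fst t) * schur k x (snd t) * x k ^ (pair_size s - pair_size t)"
      unfolding case_prod_beta x ps power_add by (simp only: ac_simps)
  qed
  finally show "schur (Suc k) (x(0 := 0)) (fst s) * schur (Suc k) x (snd s) =
    (\<Sum>t\<in>{t. pair_strip t s \<and> (k = 0 \<longrightarrow> fst t = fst s)}.
      schur k (x(0 := 0)) (fst t) * schur k x (snd t) * x k ^ (pair_size s - pair_size t))" .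
qed (use assms in auto)

lemma sum_variables: "(\<Sum>v\<in>variables N. h v) = (\<Sum>i<N. h (Inl i)) + (\<Sum>i<N. h (Inr i))"
  unfolding variables_def by (subst sum.union_disjoint) (auto simp: sum.reindex)

lemma prod_variables: "(\<Prod>v\<in>variables N. h v) = (\<Prod>i<N. h (Inl i)) * (\<Prod>i<N. h (Inr i))"
  unfolding variables_def by (subst prod.union_disjoint) (auto simp: prod.reindex)

definition bi_kostka :: "nat \<Rightarrow> nat list \<Rightarrow> ((nat + nat) \<Rightarrow> nat) \<Rightarrow> nat" where
  "bi_kostka N l \<gamma> = kostka N (quotient_minus l) (\<gamma> \<circ> Inr) * kostka N (quotient_plus l) (\<gamma> \<circ> Inl)"

lemma bi_schur_expansion:
  assumes l: "l \<in> domino_partitions n"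
  shows "schur N varV (quotient_minus l) * schur N varU (quotient_plus l) =
    (\<Sum>\<gamma>\<in>exponents N n. monom (expo N \<gamma>) (of_nat (bi_kostka N l \<gamma>)))"
proof -
  note p = two_quotient(1,2)[OF l] and sz = two_quotient_size[OF l]
  let ?a = "quotient_minus l" and ?b = "quotient_plus l"
  let ?A = "compositions N (sum_list ?a)" and ?B = "compositions N (sum_list ?b)"
  let ?m = "\<lambda>\<gamma>. monom (expo N \<gamma>) (of_nat (bi_kostka N l \<gamma>))"
  have "schur N varV ?a * schur N varU ?b =
    (\<Sum>(\<alpha>, \<beta>)\<in>?A \<times> ?B. (of_nat (kostka N ?a \<alpha>) * (\<Prod>i<N. varV i ^ \<alpha> i)) * (of_nat (kostka N ?b \<beta>) * (\<Prod>i<N. varU i ^ \<beta> i)))"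
    unfolding schur_expansion[OF p(1)] schur_expansion[OF p(2)] sum_product by (rule sum.cartesian_product)
  also have "\<dots> = (\<Sum>(\<alpha>, \<beta>)\<in>?A \<times> ?B. ?m (case_sum \<beta> \<alpha>))"
  proof (rule sum.cong[OF refl], clarify)
    fix \<alpha> \<beta> :: "nat \<Rightarrow> nat"
    have e: "(case_sum \<beta> \<alpha>) \<circ> Inr = \<alpha>" "(case_sum \<beta> \<alpha>) \<circ> Inl = \<beta>" by auto
    have "(\<Prod>i<N. varU i ^ \<beta> i) * (\<Prod>i<N. varV i ^ \<alpha> i) = monom (expo N (case_sum \<beta> \<alpha>)) 1"
      unfolding prod_indet_power[symmetric] prod_variables by (simp add: varU_def varV_def)
    then have "(of_nat (kostka N ?a \<alpha>) * (\<Prod>i<N. varV i ^ \<alpha> i)) * (of_nat (kostka N ?b \<beta>) * (\<Prod>i<N. varU i ^ \<beta> i)) =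
      of_nat (kostka N ?a \<alpha> * kostka N ?b \<beta>) * monom (expo N (case_sum \<beta> \<alpha>)) 1"
      by (simp add: algebra_simps)
    also have "\<dots> = ?m (case_sum \<beta> \<alpha>)" unfolding of_nat_mult_monom bi_kostka_def e by simp
    finally show "(of_nat (kostka N ?a \<alpha>) * (\<Prod>i<N. varV i ^ \<alpha> i)) * (of_nat (kostka N ?b \<beta>) * (\<Prod>i<N. varU i ^ \<beta> i)) =
      ?m (case_sum \<beta> \<alpha>)" .
  qed
  also have "\<dots> = (\<Sum>\<gamma>\<in>(\<lambda>(\<alpha>, \<beta>). case_sum \<beta> \<alpha>) ` (?A \<times> ?B). ?m \<gamma>)"
  proof (subst sum.reindex)
    show "inj_on (\<lambda>(\<alpha>, \<beta>). case_sum \<beta> \<alpha>) (?A \<times> ?B)"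
      by (rule inj_onI, clarify) (metis case_sum_inject)
  qed (simp add: case_prod_beta comp_def)
  also have "\<dots> = (\<Sum>\<gamma>\<in>exponents N n. ?m \<gamma>)"
  proof (rule sum.mono_neutral_left[OF finite_exponents])
    show "(\<lambda>(\<alpha>, \<beta>). case_sum \<beta> \<alpha>) ` (?A \<times> ?B) \<subseteq> exponents N n"
    proof (rule image_subsetI, clarify)
      fix \<alpha> \<beta> :: "nat \<Rightarrow> nat" assume a: "\<alpha> \<in> ?A" "\<beta> \<in> ?B"
      have "case_sum \<beta> \<alpha> v = 0" if "v \<notin> variables N" for v
        using that a by (cases v) (auto simp: compositions_def)
      then show "case_sum \<beta> \<alpha> \<in> exponents N n"
        using a sz by (simp add: exponents_def sum_variables compositions_def)
    qed
    show "\<forall>\<gamma>\<in>exponents N n - (\<lambda>(\<alpha>, \<beta>). case_sum \<beta> \<alpha>) ` (?A \<times> ?B). ?m \<gamma> = 0"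
    proof
      fix \<gamma> assume g: "\<gamma> \<in> exponents N n - (\<lambda>(\<alpha>, \<beta>). case_sum \<beta> \<alpha>) ` (?A \<times> ?B)"
      have "bi_kostka N l \<gamma> = 0"
      proof (rule ccontr)
        assume "bi_kostka N l \<gamma> \<noteq> 0"
        then have "kostka N ?a (\<gamma> \<circ> Inr) \<noteq> 0" "kostka N ?b (\<gamma> \<circ> Inl) \<noteq> 0" by (auto simp: bi_kostka_def)
        from kostka_nonzero[OF this(1)] kostka_nonzero[OF this(2)]
        have "\<gamma> \<circ> Inr \<in> ?A" "\<gamma> \<circ> Inl \<in> ?B"
          using g by (auto simp: compositions_def exponents_def)
        moreover have "\<gamma> = case_sum (\<gamma> \<circ> Inl) (\<gamma> \<circ> Inr)" by (auto simp: fun_eq_iff split: sum.splits)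
        ultimately have "\<gamma> \<in> (\<lambda>(\<alpha>, \<beta>). case_sum \<beta> \<alpha>) ` (?A \<times> ?B)" by (intro image_eqI[of _ _ "(\<gamma> \<circ> Inr, \<gamma> \<circ> Inl)"]) auto
        then show False using g by blast
      qed
      then show "?m \<gamma> = 0" by simp
    qed
  qed
  finally show ?thesis .
qed

section \<open>Coefficients of products of power sums\<close>

definition letter_sign :: "bool \<Rightarrow> nat + nat \<Rightarrow> complex" where
  "letter_sign b v = (case v of Inl _ \<Rightarrow> 1 | Inr _ \<Rightarrow> if b then - 1 else 1)"

text \<open>The coefficient in a product of sums and differences of power sums: each factor picks a variable. A
  pair \<open>(k, True)\<close> stands for the difference, which assigns the sign \<open>- 1\<close> to the letters of \<open>V\<close>. Variables range
  over both infinite alphabets, so the coefficients are stable in the number of variables.\<close>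

primrec power_coeff :: "(nat \<times> bool) list \<Rightarrow> ((nat + nat) \<Rightarrow> nat) \<Rightarrow> complex" where
  "power_coeff [] \<gamma> = (if \<gamma> = (\<lambda>_. 0) then 1 else 0)"
| "power_coeff (kb # L) \<gamma> = (\<Sum>v | fst kb \<le> \<gamma> v. letter_sign (snd kb) v * power_coeff L (\<gamma>(v := \<gamma> v - fst kb)))"

lemma power_coeff_permute:
  assumes "bij p" "\<And>b v. letter_sign b (p v) = letter_sign b v"
  shows "power_coeff L (\<gamma> \<circ> p) = power_coeff L \<gamma>"
proof (induction L arbitrary: \<gamma>)
  case Nil
  have "\<gamma> \<circ> p = (\<lambda>_. 0) \<longleftrightarrow> \<gamma> = (\<lambda>_. 0)"
    using bij_is_surj[OF assms(1)] by (auto simp: fun_eq_iff surj_def) metis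
  then show ?case unfolding power_coeff.simps by (rule if_cong) (rule refl)+
next
  case (Cons kb L)
  let ?k = "fst kb"
  have upd: "(\<gamma> \<circ> p)(v := x) = \<gamma>(p v := x) \<circ> p" for v x
    using bij_is_inj[OF assms(1)] by (auto simp: fun_eq_iff inj_eq)
  have "power_coeff (kb # L) (\<gamma> \<circ> p) =
    (\<Sum>v | ?k \<le> \<gamma> (p v). letter_sign (snd kb) (p v) * power_coeff L (\<gamma>(p v := \<gamma> (p v) - ?k)))"
    by (simp only: power_coeff.simps comp_apply upd assms(2) Cons.IH)
  also have "\<dots> = (\<Sum>v | ?k \<le> \<gamma> v. letter_sign (snd kb) v * power_coeff L (\<gamma>(v := \<gamma> v - ?k)))"
  proof (rule sum.reindex_bij_betw[where h = p])
    show "bij_betw p {v. ?k \<le> \<gamma> (p v)} {v. ?k \<le> \<gamma> v}"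
      using assms(1) unfolding bij_betw_def bij_def surj_def by (auto simp: inj_on_def image_iff)
  qed
  also have "\<dots> = power_coeff (kb # L) \<gamma>" by (simp only: power_coeff.simps)
  finally show ?case .
qed

definition power_factor :: "nat \<Rightarrow> nat \<times> bool \<Rightarrow> uv_poly" where
  "power_factor N kb = (if snd kb then power_sum N varU (fst kb) - power_sum N varV (fst kb)
     else power_sum N varU (fst kb) + power_sum N varV (fst kb))"

lemma power_factor_expansion:
  "power_factor N kb = (\<Sum>v\<in>variables N. monom (Poly_Mapping.single v (fst kb)) (letter_sign (snd kb) v))"
  unfolding sum_variables power_factor_def power_sum_def varU_def varV_def indet_power
  by (simp add: letter_sign_def sum_negf[symmetric] single_uminus)

lemma power_product_expansion:
  assumes "\<And>kb. kb \<in> set L \<Longrightarrow> 0 < fst kb"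
  shows "prod_list (map (power_factor N) L) =
    (\<Sum>\<gamma>\<in>exponents N (sum_list (map fst L)). monom (expo N \<gamma>) (power_coeff L \<gamma>))"
  using assms
proof (induction L)
  case Nil
  have "exponents N 0 = {\<lambda>_. 0}"
    by (auto simp: exponents_def finite_variables fun_eq_iff)
  moreover have "expo N (\<lambda>_. 0) = 0" by (simp add: expo_def)
  ultimately show ?case by simp
next
  case (Cons kb L)
  let ?k = "fst kb" and ?d = "sum_list (map fst L)"
  have k: "0 < ?k" using Cons.prems by simp
  have shift: "Poly_Mapping.single v ?k + expo N \<gamma> = expo N (\<gamma>(v := \<gamma> v + ?k))" if "v \<in> variables N" for v \<gamma>
    by (rule poly_mapping_eqI) (use that in \<open>auto simp: lookup_add lookup_expo lookup_single when_def\<close>)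
  have tot: "(\<Sum>w\<in>variables N. (\<gamma>(v := x)) w) + \<gamma> v = (\<Sum>w\<in>variables N. \<gamma> w) + x" if "v \<in> variables N" for v x \<gamma>
    by (simp add: sum.remove[OF finite_variables that] finite_variables ac_simps)
  have "prod_list (map (power_factor N) (kb # L)) =
    (\<Sum>(v, \<gamma>)\<in>variables N \<times> exponents N ?d. monom (Poly_Mapping.single v ?k) (letter_sign (snd kb) v) * monom (expo N \<gamma>) (power_coeff L \<gamma>))"
  proof -
    have IH: "prod_list (map (power_factor N) L) = (\<Sum>\<gamma>\<in>exponents N ?d. monom (expo N \<gamma>) (power_coeff L \<gamma>))"
      using Cons by simp
    show ?thesis
      unfolding list.map prod_list.Cons IH power_factor_expansion[of N kb] sum_product by (rule sum.cartesian_product)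
  qed
  also have "\<dots> = (\<Sum>(\<gamma>, v)\<in>(SIGMA \<gamma>:exponents N (?k + ?d). {v. ?k \<le> \<gamma> v}).
      monom (expo N \<gamma>) (letter_sign (snd kb) v * power_coeff L (\<gamma>(v := \<gamma> v - ?k))))"
  proof (rule sum.reindex_bij_witness[where i = "\<lambda>(\<gamma>, v). (v, \<gamma>(v := \<gamma> v - ?k))" and j = "\<lambda>(v, \<gamma>). (\<gamma>(v := \<gamma> v + ?k), v)"])
    fix a assume "a \<in> variables N \<times> exponents N ?d"
    then obtain v \<gamma> where a: "a = (v, \<gamma>)" "v \<in> variables N" "\<gamma> \<in> exponents N ?d" by blast
    show "(case (case a of (v, \<gamma>) \<Rightarrow> (\<gamma>(v := \<gamma> v + ?k), v)) of (\<gamma>, v) \<Rightarrow> (v, \<gamma>(v := \<gamma> v - ?k))) = a"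
      by (simp add: a)
    show "(case a of (v, \<gamma>) \<Rightarrow> (\<gamma>(v := \<gamma> v + ?k), v)) \<in> (SIGMA \<gamma>:exponents N (?k + ?d). {v. ?k \<le> \<gamma> v})"
      using a tot[OF a(2), of \<gamma> "\<gamma> v + ?k"] by (auto simp: exponents_def)
    show "(case (case a of (v, \<gamma>) \<Rightarrow> (\<gamma>(v := \<gamma> v + ?k), v)) of (\<gamma>, v) \<Rightarrow>
        monom (expo N \<gamma>) (letter_sign (snd kb) v * power_coeff L (\<gamma>(v := \<gamma> v - ?k)))) =
      (case a of (v, \<gamma>) \<Rightarrow> monom (Poly_Mapping.single v ?k) (letter_sign (snd kb) v) * monom (expo N \<gamma>) (power_coeff L \<gamma>))"
      by (simp add: a mult_single shift)
  next
    fix b assume "b \<in> (SIGMA \<gamma>:exponents N (?k + ?d). {v. ?k \<le> \<gamma> v})"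
    then obtain v \<gamma> where b: "b = (\<gamma>, v)" "\<gamma> \<in> exponents N (?k + ?d)" "?k \<le> \<gamma> v" by blast
    have v: "v \<in> variables N" using b k by (auto simp: exponents_def)
    show "(case (case b of (\<gamma>, v) \<Rightarrow> (v, \<gamma>(v := \<gamma> v - ?k))) of (v, \<gamma>) \<Rightarrow> (\<gamma>(v := \<gamma> v + ?k), v)) = b"
      using b by simp
    show "(case b of (\<gamma>, v) \<Rightarrow> (v, \<gamma>(v := \<gamma> v - ?k))) \<in> variables N \<times> exponents N ?d"
      using b v tot[OF v, of \<gamma> "\<gamma> v - ?k"] by (auto simp: exponents_def)
  qed
  also have "\<dots> = (\<Sum>\<gamma>\<in>exponents N (?k + ?d). \<Sum>v | ?k \<le> \<gamma> v.
      monom (expo N \<gamma>) (letter_sign (snd kb) v * power_coeff L (\<gamma>(v := \<gamma> v - ?k))))"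
  proof (rule sum.Sigma[symmetric, OF finite_exponents], rule ballI)
    fix \<gamma> assume "\<gamma> \<in> exponents N (?k + ?d)"
    then have "{v. ?k \<le> \<gamma> v} \<subseteq> variables N" using k by (auto simp: exponents_def)
    then show "finite {v. ?k \<le> \<gamma> v}" by (rule finite_subset[OF _ finite_variables])
  qed
  also have "\<dots> = (\<Sum>\<gamma>\<in>exponents N (sum_list (map fst (kb # L))). monom (expo N \<gamma>) (power_coeff (kb # L) \<gamma>))"
  proof (rule sum.cong)
    fix \<gamma>
    show "(\<Sum>v | ?k \<le> \<gamma> v. monom (expo N \<gamma>) (letter_sign (snd kb) v * power_coeff L (\<gamma>(v := \<gamma> v - ?k)))) =
      monom (expo N \<gamma>) (power_coeff (kb # L) \<gamma>)"
      by (rule poly_mapping_eqI) (simp add: lookup_sum lookup_single when_def)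
  qed simp
  finally show ?case .
qed

definition class_factors :: "nat list \<Rightarrow> (nat \<times> bool) list" where
  "class_factors \<mu> = map (\<lambda>k. (k, True)) (quotient_minus \<mu>) @ map (\<lambda>k. (k, False)) (quotient_plus \<mu>)"

lemma power_sum_product_expansion:
  assumes "\<mu> \<in> domino_partitions n"
  shows "power_sum_product N \<mu> = (\<Sum>\<gamma>\<in>exponents N n. monom (expo N \<gamma>) (power_coeff (class_factors \<mu>) \<gamma>))"
proof -
  have "power_sum_product N \<mu> = prod_list (map (power_factor N) (class_factors \<mu>))"
    by (simp add: power_sum_product_def class_factors_def power_factor_def comp_def)
  also have "\<dots> = (\<Sum>\<gamma>\<in>exponents N (sum_list (map fst (class_factors \<mu>))). monom (expo N \<gamma>) (power_coeff (class_factors \<mu>) \<gamma>))"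
    by (rule power_product_expansion)
      (use two_quotient(1,2)[OF assms] in \<open>auto simp: class_factors_def partition_def intro: gr0I\<close>)
  also have "sum_list (map fst (class_factors \<mu>)) = n"
    using two_quotient_size[OF assms] by (simp add: class_factors_def comp_def)
  finally show ?thesis .
qed

section \<open>Existence and uniqueness of the character table\<close>

text \<open>Back substitution, starting with the unknowns of smallest rank.\<close>

lemma unitriangular_solve:
  fixes M :: "'s \<Rightarrow> 's \<Rightarrow> complex" and r :: "'s \<Rightarrow> int"
  assumes "finite P" and diag: "\<And>a. a \<in> P \<Longrightarrow> M a a = 1"
    and tri: "\<And>a b. a \<in> P \<Longrightarrow> b \<in> P \<Longrightarrow> a \<noteq> b \<Longrightarrow> M a b \<noteq> 0 \<Longrightarrow> r a < r b"
  shows "\<exists>\<psi>. \<forall>b\<in>P. (\<Sum>a\<in>P. \<psi> a * M a b) = c b"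
    "(\<And>b. b \<in> P \<Longrightarrow> (\<Sum>a\<in>P. \<phi> a * M a b) = 0) \<Longrightarrow> a \<in> P \<Longrightarrow> \<phi> a = 0"
proof -
  have "(\<exists>\<psi>. \<forall>b\<in>P. (\<Sum>a\<in>P. \<psi> a * M a b) = c b) \<and>
    ((\<forall>b\<in>P. (\<Sum>a\<in>P. \<phi> a * M a b) = 0) \<longrightarrow> (\<forall>a\<in>P. \<phi> a = 0))"
    using assms
  proof (induction P rule: finite_ranking_induct[where f = r])
    case (insert x S)
    show ?case
    proof (cases "x \<in> S")
      case True
      then show ?thesis using insert by (simp add: insert_absorb)
    next
      case False
      have col: "M x b = 0" if "b \<in> S" for b
      proof (rule ccontr)
        assume "M x b \<noteq> 0"
        then have "r x < r b" using insert.prems(2)[of x b] that False by auto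
        then show False using insert.hyps(2)[OF that] by simp
      qed
      have IH: "(\<exists>\<psi>. \<forall>b\<in>S. (\<Sum>a\<in>S. \<psi> a * M a b) = c b) \<and>
        ((\<forall>b\<in>S. (\<Sum>a\<in>S. \<phi> a * M a b) = 0) \<longrightarrow> (\<forall>a\<in>S. \<phi> a = 0))"
        by (rule insert.IH) (use insert.prems in auto)
      have exp: "(\<Sum>a\<in>insert x S. \<psi> a * M a b) = (\<Sum>a\<in>S. \<psi> a * M a b)" if "b \<in> S" for \<psi> b
        using insert.hyps(1) False col[OF that] by simp
      have expx: "(\<Sum>a\<in>insert x S. \<psi> a * M a x) = \<psi> x + (\<Sum>a\<in>S. \<psi> a * M a x)" for \<psi>
        using insert.hyps(1) False insert.prems(1)[of x] by simp
      obtain \<psi> where \<psi>: "\<forall>b\<in>S. (\<Sum>a\<in>S. \<psi> a * M a b) = c b" using IH by blast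
      \<comment> \<open>x has the largest rank, so its unknown does not occur in the equations solved before\<close>
      define \<psi>' where "\<psi>' = \<psi>(x := c x - (\<Sum>a\<in>S. \<psi> a * M a x))"
      have same: "(\<Sum>a\<in>S. \<psi>' a * M a b) = (\<Sum>a\<in>S. \<psi> a * M a b)" for b
        by (intro sum.cong refl) (use False in \<open>auto simp: \<psi>'_def\<close>)
      have "\<forall>b\<in>insert x S. (\<Sum>a\<in>insert x S. \<psi>' a * M a b) = c b"
      proof
        fix b assume "b \<in> insert x S"
        then show "(\<Sum>a\<in>insert x S. \<psi>' a * M a b) = c b"
        proof
          assume b: "b = x"
          show ?thesis unfolding b expx same by (simp add: \<psi>'_def)
        next
          assume b: "b \<in> S"
          show ?thesis unfolding exp[OF b] same using \<psi> b by blast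
        qed
      qed
      moreover have "(\<forall>b\<in>insert x S. (\<Sum>a\<in>insert x S. \<phi> a * M a b) = 0) \<longrightarrow> (\<forall>a\<in>insert x S. \<phi> a = 0)"
      proof
        assume 0: "\<forall>b\<in>insert x S. (\<Sum>a\<in>insert x S. \<phi> a * M a b) = 0"
        then have S0: "\<forall>a\<in>S. \<phi> a = 0" using IH exp by auto
        have "\<phi> x = 0" using 0 expx[of \<phi>] S0 by auto
        then show "\<forall>a\<in>insert x S. \<phi> a = 0" using S0 by blast
      qed
      ultimately show ?thesis by blast
    qed
  qed auto
  then show "\<exists>\<psi>. \<forall>b\<in>P. (\<Sum>a\<in>P. \<psi> a * M a b) = c b"
    "(\<And>b. b \<in> P \<Longrightarrow> (\<Sum>a\<in>P. \<phi> a * M a b) = 0) \<Longrightarrow> a \<in> P \<Longrightarrow> \<phi> a = 0"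
    by blast+
qed

text \<open>The exponents of the leading monomial of the product of Schur polynomials belonging to \<open>\<kappa>\<close>.\<close>

definition shape_exponents :: "nat list \<Rightarrow> (nat + nat) \<Rightarrow> nat" where
  "shape_exponents \<kappa> = case_sum (part (quotient_plus \<kappa>)) (part (quotient_minus \<kappa>))"

text \<open>A number that strictly increases along the dominance order.\<close>

definition dominance_rank :: "nat \<Rightarrow> nat list \<Rightarrow> nat" where
  "dominance_rank n l = (\<Sum>k\<le>n. \<Sum>i<k. part l i)"

lemma length_le_sum_list: "partition l \<Longrightarrow> length l \<le> sum_list l"
  by (induction l) (auto simp: partition_def)

lemma kostka_dominance:
  assumes l: "partition l" and m: "partition m" "length m \<le> n" and nz: "kostka n l (part m) \<noteq> 0"
  shows "dominance_rank n m \<le> dominance_rank n l" "dominance_rank n m = dominance_rank n l \<Longrightarrow> l = m"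
proof -
  note K = kostka_nonzero[OF nz]
  have le: "(\<Sum>i<k. part m i) \<le> (\<Sum>i<k. part l i)" if "k \<in> {..n}" for k using K that by simp
  show "dominance_rank n m \<le> dominance_rank n l" unfolding dominance_rank_def by (rule sum_mono[OF le])
  assume "dominance_rank n m = dominance_rank n l"
  then have eq: "(\<Sum>i<k. part m i) = (\<Sum>i<k. part l i)" if "k \<le> n" for k
    using sum_mono_inv[of "\<lambda>k. \<Sum>i<k. part m i" "{..n}" "\<lambda>k. \<Sum>i<k. part l i"] le that
    by (simp add: dominance_rank_def)
  show "l = m"
  proof (rule partition_eqI[OF l m(1)])
    fix i
    show "part l i = part m i"
    proof (cases "i < n")
      case True
      then show ?thesis using eq[of i] eq[of "Suc i"] by simp
    next
      case False
      then show ?thesis using K m(2) by (simp add: part_def)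
    qed
  qed
qed

lemma length_quotient_le:
  assumes "l \<in> domino_partitions n"
  shows "length (quotient_minus l) \<le> n" "length (quotient_plus l) \<le> n"
  using two_quotient_size[OF assms] length_le_sum_list[OF two_quotient(1)[OF assms]]
    length_le_sum_list[OF two_quotient(2)[OF assms]] by auto

lemma shape_exponents_mem:
  assumes "\<kappa> \<in> domino_partitions n"
  shows "shape_exponents \<kappa> \<in> exponents n n"
proof -
  note len = length_quotient_le[OF assms]
  have "shape_exponents \<kappa> v = 0" if "v \<notin> variables n" for v
    using that len by (cases v) (auto simp: shape_exponents_def part_def)
  moreover have "(\<Sum>v\<in>variables n. shape_exponents \<kappa> v) = n"
    using two_quotient_size[OF assms] sum_list_part[OF len(1)] sum_list_part[OF len(2)]
    by (simp add: sum_variables shape_exponents_def)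
  ultimately show ?thesis by (simp add: exponents_def)
qed

lemma bi_kostka_triangular:
  assumes a: "a \<in> domino_partitions n" and b: "b \<in> domino_partitions n"
  shows "bi_kostka n a (shape_exponents a) = 1"
    "a \<noteq> b \<Longrightarrow> bi_kostka n a (shape_exponents b) \<noteq> 0 \<Longrightarrow>
      dominance_rank n (quotient_minus b) + dominance_rank n (quotient_plus b) <
      dominance_rank n (quotient_minus a) + dominance_rank n (quotient_plus a)"
proof -
  note pa = two_quotient(1,2)[OF a] and pb = two_quotient(1,2)[OF b]
  note la = length_quotient_le[OF a] and lb = length_quotient_le[OF b]
  have e: "shape_exponents c \<circ> Inr = part (quotient_minus c)" "shape_exponents c \<circ> Inl = part (quotient_plus c)" for c
    by (auto simp: shape_exponents_def)
  show "bi_kostka n a (shape_exponents a) = 1"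
    unfolding bi_kostka_def e by (simp add: kostka_diag pa la)
  assume ne: "a \<noteq> b" and "bi_kostka n a (shape_exponents b) \<noteq> 0"
  then have nz: "kostka n (quotient_minus a) (part (quotient_minus b)) \<noteq> 0" "kostka n (quotient_plus a) (part (quotient_plus b)) \<noteq> 0"
    unfolding bi_kostka_def e by auto
  note D1 = kostka_dominance[OF pa(1) pb(1) lb(1) nz(1)] and D2 = kostka_dominance[OF pa(2) pb(2) lb(2) nz(2)]
  have "quotient_minus a \<noteq> quotient_minus b \<or> quotient_plus a \<noteq> quotient_plus b"
    using domino_partition_eqI[OF a b] ne by blast
  then show "dominance_rank n (quotient_minus b) + dominance_rank n (quotient_plus b) <
      dominance_rank n (quotient_minus a) + dominance_rank n (quotient_plus a)"
    using D1 D2 by fastforce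
qed

lemma permutation_to_partition:
  fixes \<alpha> :: "nat \<Rightarrow> nat"
  assumes "\<And>i. N \<le> i \<Longrightarrow> \<alpha> i = 0"
  obtains p l where "p permutes {..<N}" "partition l" "\<alpha> \<circ> p = part l" "sum_list l = (\<Sum>i<N. \<alpha> i)"
proof -
  obtain p where p: "p permutes {..<N}" and srt: "\<And>i j. i \<le> j \<Longrightarrow> j < N \<Longrightarrow> \<alpha> (p j) \<le> \<alpha> (p i)"
    using sort_by_permutation[of N \<alpha>] by blast
  have out: "\<alpha> (p i) = 0" if "N \<le> i" for i
    using permutes_not_in[OF p, of i] that assms by simp
  have mono: "\<alpha> (p (Suc i)) \<le> \<alpha> (p i)" for i
    using srt[of i "Suc i"] out[of "Suc i"] by (cases "Suc i < N") auto
  have "\<alpha> (p N) = 0" by (rule out) simp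
  then obtain l where l: "partition l" "\<And>i. part l i = \<alpha> (p i)" "length l \<le> N"
    using partition_of_fun[of "\<lambda>i. \<alpha> (p i)" N, OF mono] by metis
  have "sum_list l = (\<Sum>i<N. \<alpha> (p i))" using sum_list_part[OF l(3)] l(2) by simp
  also have "\<dots> = (\<Sum>i<N. \<alpha> i)" using sum.permute[OF p, of \<alpha>] by (simp add: comp_def)
  finally show ?thesis using that[OF p l(1)] l(2) by (auto simp: fun_eq_iff)
qed

text \<open>Power sums and Schur polynomials are symmetric in each of the two alphabets and stable in the number of
  variables. So a coefficient at arbitrary exponents equals the one at the sorted exponents, which
  are a pair of partitions.\<close>

lemma normalise_exponents:
  assumes g: "\<gamma> \<in> exponents N n"
  obtains \<kappa> where "\<kappa> \<in> domino_partitions n" "\<And>L. power_coeff L \<gamma> = power_coeff L (shape_exponents \<kappa>)"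
    "\<And>l. l \<in> domino_partitions n \<Longrightarrow> bi_kostka N l \<gamma> = bi_kostka n l (shape_exponents \<kappa>)"
proof -
  \<comment> \<open>enough variables for the given exponents and for the partitions of size at most n\<close>
  define N' where "N' = max N n"
  have z: "(\<gamma> \<circ> Inr) i = 0" "(\<gamma> \<circ> Inl) i = 0" if "N \<le> i" for i
    using g that by (auto simp: exponents_def)
  have z': "(\<gamma> \<circ> Inr) i = 0" "(\<gamma> \<circ> Inl) i = 0" if "N' \<le> i" for i
    using z[of i] that by (auto simp: N'_def)
  obtain p a where p: "p permutes {..<N'}" "partition a" "(\<gamma> \<circ> Inr) \<circ> p = part a" "sum_list a = (\<Sum>i<N'. (\<gamma> \<circ> Inr) i)"
    by (rule permutation_to_partition[OF z'(1)])
  obtain q b where q: "q permutes {..<N'}" "partition b" "(\<gamma> \<circ> Inl) \<circ> q = part b" "sum_list b = (\<Sum>i<N'. (\<gamma> \<circ> Inl) i)"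
    by (rule permutation_to_partition[OF z'(2)])
  have ext: "(\<Sum>i<N'. h i) = (\<Sum>i<N. h i)" if "\<And>i. N \<le> i \<Longrightarrow> h i = 0" for h :: "nat \<Rightarrow> nat"
    by (rule sum.mono_neutral_right) (use that in \<open>auto simp: N'_def\<close>)
  have "sum_list a = (\<Sum>i<N. (\<gamma> \<circ> Inr) i)" by (rule trans[OF p(4) ext[OF z(1)]])
  moreover have "sum_list b = (\<Sum>i<N. (\<gamma> \<circ> Inl) i)" by (rule trans[OF q(4) ext[OF z(2)]])
  ultimately have "sum_list a + sum_list b = n"
    using g by (simp add: exponents_def sum_variables)
  then obtain \<kappa> where \<kappa>: "\<kappa> \<in> domino_partitions n" "quotient_minus \<kappa> = a" "quotient_plus \<kappa> = b"
    using two_quotient_ex[OF p(2) q(2)] by blast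
  have len: "length a \<le> n" "length b \<le> n" using length_quotient_le[OF \<kappa>(1)] \<kappa>(2,3) by auto
  \<comment> \<open>permute the two alphabets separately\<close>
  let ?\<pi> = "map_sum q p"
  have comp: "\<gamma> \<circ> ?\<pi> = shape_exponents \<kappa>"
  proof
    fix v show "(\<gamma> \<circ> ?\<pi>) v = shape_exponents \<kappa> v"
      using fun_cong[OF p(3)] fun_cong[OF q(3)] \<kappa>(2,3) by (cases v) (auto simp: shape_exponents_def)
  qed
  have bij: "bij ?\<pi>"
  proof (rule o_bij)
    show "map_sum (inv q) (inv p) \<circ> ?\<pi> = id"
    proof
      fix v show "(map_sum (inv q) (inv p) \<circ> ?\<pi>) v = id v"
        by (cases v) (simp_all add: permutes_inverses[OF p(1)] permutes_inverses[OF q(1)])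
    qed
    show "?\<pi> \<circ> map_sum (inv q) (inv p) = id"
    proof
      fix v show "(?\<pi> \<circ> map_sum (inv q) (inv p)) v = id v"
        by (cases v) (simp_all add: permutes_inverses[OF p(1)] permutes_inverses[OF q(1)])
    qed
  qed
  have "power_coeff L \<gamma> = power_coeff L (shape_exponents \<kappa>)" for L
    unfolding comp[symmetric]
    by (rule power_coeff_permute[OF bij, symmetric]) (auto simp: letter_sign_def split: sum.splits)
  moreover have "bi_kostka N l \<gamma> = bi_kostka n l (shape_exponents \<kappa>)" if l: "l \<in> domino_partitions n" for l
  proof -
    note pl = two_quotient(1,2)[OF l]
    have k: "kostka N m \<alpha> = kostka n m (part c)"
      if m: "partition m" and \<alpha>: "\<And>i. N \<le> i \<Longrightarrow> \<alpha> i = 0" and r: "r permutes {..<N'}" "\<alpha> \<circ> r = part c"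
        and c: "length c \<le> n" for m \<alpha> r c
    proof -
      have "kostka N m \<alpha> = kostka N' m \<alpha>"
        by (rule kostka_stable[OF m, symmetric]) (use \<alpha> in \<open>auto simp: N'_def\<close>)
      also have "\<dots> = kostka N' m (part c)" using kostka_permute[OF m r(1), of \<alpha>] r(2) by simp
      also have "\<dots> = kostka n m (part c)"
        by (rule kostka_stable[OF m]) (use c in \<open>auto simp: N'_def part_def\<close>)
      finally show ?thesis .
    qed
    have e: "shape_exponents \<kappa> \<circ> Inr = part a" "shape_exponents \<kappa> \<circ> Inl = part b"
      by (auto simp: shape_exponents_def \<kappa>)
    show ?thesis
      unfolding bi_kostka_def e using k[OF pl(1) z(1) p(1,3) len(1)] k[OF pl(2) z(2) q(1,3) len(2)] by simp
  qed
  ultimately show ?thesis using that \<kappa>(1) by blast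
qed

text \<open>Comparing coefficients turns the identities for all numbers of variables into finitely many linear equations,
  one for each pair of partitions as exponents.\<close>

lemma is_character_table_iff:
  "is_character_table n \<psi> \<longleftrightarrow>
    (\<forall>\<mu>\<in>domino_partitions n. \<forall>\<kappa>\<in>domino_partitions n.
      (\<Sum>l\<in>domino_partitions n. \<psi> l \<mu> * of_nat (bi_kostka n l (shape_exponents \<kappa>))) = power_coeff (class_factors \<mu>) (shape_exponents \<kappa>)) \<and>
    (\<forall>l \<mu>. l \<notin> domino_partitions n \<or> \<mu> \<notin> domino_partitions n \<longrightarrow> \<psi> l \<mu> = 0)"
proof -
  let ?P = "domino_partitions n"
  have expand: "(\<Sum>l\<in>?P. const (\<psi> l \<mu>) * schur N varV (quotient_minus l) * schur N varU (quotient_plus l)) =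
    (\<Sum>\<gamma>\<in>exponents N n. monom (expo N \<gamma>) (\<Sum>l\<in>?P. \<psi> l \<mu> * of_nat (bi_kostka N l \<gamma>)))" for N \<mu>
  proof -
    have "(\<Sum>l\<in>?P. const (\<psi> l \<mu>) * schur N varV (quotient_minus l) * schur N varU (quotient_plus l)) =
      (\<Sum>l\<in>?P. \<Sum>\<gamma>\<in>exponents N n. monom (expo N \<gamma>) (\<psi> l \<mu> * of_nat (bi_kostka N l \<gamma>)))"
      by (intro sum.cong refl) (simp add: mult.assoc bi_schur_expansion sum_distrib_left const_mult_monom)
    also have "\<dots> = (\<Sum>\<gamma>\<in>exponents N n. \<Sum>l\<in>?P. monom (expo N \<gamma>) (\<psi> l \<mu> * of_nat (bi_kostka N l \<gamma>)))"
      by (rule sum.swap)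
    also have "\<dots> = (\<Sum>\<gamma>\<in>exponents N n. monom (expo N \<gamma>) (\<Sum>l\<in>?P. \<psi> l \<mu> * of_nat (bi_kostka N l \<gamma>)))"
      by (intro sum.cong refl poly_mapping_eqI) (simp add: lookup_sum lookup_single when_def)
    finally show ?thesis .
  qed
  have "(\<forall>N. power_sum_product N \<mu> =
      (\<Sum>l\<in>?P. const (\<psi> l \<mu>) * schur N varV (quotient_minus l) * schur N varU (quotient_plus l))) \<longleftrightarrow>
    (\<forall>\<kappa>\<in>?P. (\<Sum>l\<in>?P. \<psi> l \<mu> * of_nat (bi_kostka n l (shape_exponents \<kappa>))) = power_coeff (class_factors \<mu>) (shape_exponents \<kappa>))"
    if \<mu>: "\<mu> \<in> ?P" for \<mu>
    unfolding expand power_sum_product_expansion[OF \<mu>] expansion_eq_iff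
  proof
    assume A: "\<forall>N. \<forall>\<gamma>\<in>exponents N n. power_coeff (class_factors \<mu>) \<gamma> = (\<Sum>l\<in>?P. \<psi> l \<mu> * of_nat (bi_kostka N l \<gamma>))"
    show "\<forall>\<kappa>\<in>?P. (\<Sum>l\<in>?P. \<psi> l \<mu> * of_nat (bi_kostka n l (shape_exponents \<kappa>))) = power_coeff (class_factors \<mu>) (shape_exponents \<kappa>)"
      using A[rule_format, OF shape_exponents_mem] by simp
  next
    assume B: "\<forall>\<kappa>\<in>?P. (\<Sum>l\<in>?P. \<psi> l \<mu> * of_nat (bi_kostka n l (shape_exponents \<kappa>))) = power_coeff (class_factors \<mu>) (shape_exponents \<kappa>)"
    show "\<forall>N. \<forall>\<gamma>\<in>exponents N n. power_coeff (class_factors \<mu>) \<gamma> = (\<Sum>l\<in>?P. \<psi> l \<mu> * of_nat (bi_kostka N l \<gamma>))"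
    proof (intro allI ballI)
      fix N \<gamma> assume "\<gamma> \<in> exponents N n"
      then obtain \<kappa> where k: "\<kappa> \<in> ?P" "\<And>L. power_coeff L \<gamma> = power_coeff L (shape_exponents \<kappa>)"
        "\<And>l. l \<in> ?P \<Longrightarrow> bi_kostka N l \<gamma> = bi_kostka n l (shape_exponents \<kappa>)"
        by (rule normalise_exponents) blast
      show "power_coeff (class_factors \<mu>) \<gamma> = (\<Sum>l\<in>?P. \<psi> l \<mu> * of_nat (bi_kostka N l \<gamma>))"
        unfolding k(2) using B k(1,3) by simp
    qed
  qed
  then show ?thesis unfolding is_character_table_def by blast
qed

lemma character_table_ex1: "\<exists>!\<psi>. is_character_table n \<psi>"
proof (rule ex_ex1I)
  let ?P = "domino_partitions n"
  let ?M = "\<lambda>a b. of_nat (bi_kostka n a (shape_exponents b)) :: complex"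
  let ?r = "\<lambda>a. - int (dominance_rank n (quotient_minus a) + dominance_rank n (quotient_plus a))"
  have diag: "?M a a = 1" if "a \<in> ?P" for a using bi_kostka_triangular(1)[OF that that] by simp
  have tri: "?r a < ?r b" if "a \<in> ?P" "b \<in> ?P" "a \<noteq> b" "?M a b \<noteq> 0" for a b
  proof -
    have "bi_kostka n a (shape_exponents b) \<noteq> 0" using that(4) by simp
    from bi_kostka_triangular(2)[OF that(1,2,3) this] show ?thesis by simp
  qed
  note solve = unitriangular_solve[of ?P ?M ?r, OF finite_domino_partitions diag tri]
  have "\<forall>\<mu>. \<exists>\<psi>. \<forall>b\<in>?P. (\<Sum>a\<in>?P. \<psi> a * ?M a b) = power_coeff (class_factors \<mu>) (shape_exponents b)"
    by (intro allI solve(1))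
  from choice[OF this] obtain \<psi> where
    \<psi>: "\<And>\<mu> b. b \<in> ?P \<Longrightarrow> (\<Sum>a\<in>?P. \<psi> \<mu> a * ?M a b) = power_coeff (class_factors \<mu>) (shape_exponents b)"
    by blast
  define \<chi> where "\<chi> a \<mu> = (if a \<in> ?P \<and> \<mu> \<in> ?P then \<psi> \<mu> a else 0)" for a \<mu>
  have "(\<Sum>a\<in>?P. \<chi> a \<mu> * ?M a b) = (\<Sum>a\<in>?P. \<psi> \<mu> a * ?M a b)" if "\<mu> \<in> ?P" for \<mu> b
    by (intro sum.cong refl) (simp add: \<chi>_def that)
  then have "is_character_table n \<chi>"
    unfolding is_character_table_iff using \<psi> by (auto simp: \<chi>_def)
  then show "\<exists>\<psi>. is_character_table n \<psi>" by blast
  fix \<phi> \<chi> assume A: "is_character_table n \<phi>" "is_character_table n \<chi>"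
  show "\<phi> = \<chi>"
  proof (intro ext)
    fix a \<mu>
    show "\<phi> a \<mu> = \<chi> a \<mu>"
    proof (cases "a \<in> ?P \<and> \<mu> \<in> ?P")
      case True
      have "\<phi> a \<mu> - \<chi> a \<mu> = 0"
      proof (rule solve(2)[of "\<lambda>a. \<phi> a \<mu> - \<chi> a \<mu>"])
        fix b assume "b \<in> ?P"
        then show "(\<Sum>a\<in>?P. (\<phi> a \<mu> - \<chi> a \<mu>) * ?M a b) = 0"
          using A True unfolding is_character_table_iff by (simp add: left_diff_distrib sum_subtractf)
      qed (use True in auto)
      then show ?thesis by simp
    next
      case False
      then show ?thesis using A unfolding is_character_table_def by auto
    qed
  qed
qed

lemma character_value_table: "is_character_table n (character_value n)"
  unfolding character_value_def by (rule theI'[OF character_table_ex1])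

section \<open>Merging the two alphabets\<close>

definition substitute_monomial :: "(nat + nat \<Rightarrow> uv_poly) \<Rightarrow> ((nat + nat) \<Rightarrow>\<^sub>0 nat) \<Rightarrow> uv_poly" where
  "substitute_monomial h m = (\<Prod>v\<in>Poly_Mapping.keys m. h v ^ lookup m v)"

text \<open>The evaluation homomorphism that sends each indeterminate \<open>v\<close> to \<open>h v\<close>.\<close>

definition substitute :: "(nat + nat \<Rightarrow> uv_poly) \<Rightarrow> uv_poly \<Rightarrow> uv_poly" where
  "substitute h p = (\<Sum>m\<in>Poly_Mapping.keys p. const (lookup p m) * substitute_monomial h m)"

lemma const_add: "const (a + b) = const a + const b"
  by (simp add: const_def single_add)

lemma const_mult: "const (a * b) = const a * const b"
  by (simp add: const_def mult_single)

lemma const_0: "const 0 = 0"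
  by (simp add: const_def)

lemma const_1: "const 1 = 1"
  by (simp add: const_def)

lemma substitute_monomial_superset:
  assumes "finite A" "Poly_Mapping.keys m \<subseteq> A"
  shows "substitute_monomial h m = (\<Prod>v\<in>A. h v ^ lookup m v)"
  unfolding substitute_monomial_def
  by (rule prod.mono_neutral_left[OF assms]) (simp add: in_keys_iff)

lemma substitute_monomial_add: "substitute_monomial h (m + m') = substitute_monomial h m * substitute_monomial h m'"
proof -
  let ?A = "Poly_Mapping.keys m \<union> Poly_Mapping.keys m'"
  have "substitute_monomial h (m + m') = (\<Prod>v\<in>?A. h v ^ lookup (m + m') v)"
    by (rule substitute_monomial_superset) (simp_all add: Poly_Mapping.keys_add)
  also have "\<dots> = (\<Prod>v\<in>?A. h v ^ lookup m v) * (\<Prod>v\<in>?A. h v ^ lookup m' v)"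
    by (simp add: lookup_add power_add prod.distrib)
  also have "\<dots> = substitute_monomial h m * substitute_monomial h m'"
    using substitute_monomial_superset[of ?A m h] substitute_monomial_superset[of ?A m' h] by simp
  finally show ?thesis .
qed

lemma substitute_superset:
  assumes "finite A" "Poly_Mapping.keys p \<subseteq> A"
  shows "substitute h p = (\<Sum>m\<in>A. const (lookup p m) * substitute_monomial h m)"
  unfolding substitute_def
  by (rule sum.mono_neutral_left[OF assms]) (simp add: in_keys_iff const_0)

lemma substitute_0: "substitute h 0 = 0"
  by (simp add: substitute_def)

lemma substitute_add: "substitute h (p + q) = substitute h p + substitute h q"
proof -
  let ?A = "Poly_Mapping.keys p \<union> Poly_Mapping.keys q"
  have "substitute h (p + q) = (\<Sum>m\<in>?A. const (lookup (p + q) m) * substitute_monomial h m)"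
    by (rule substitute_superset) (simp_all add: Poly_Mapping.keys_add)
  also have "\<dots> = (\<Sum>m\<in>?A. const (lookup p m) * substitute_monomial h m) + (\<Sum>m\<in>?A. const (lookup q m) * substitute_monomial h m)"
    by (simp add: lookup_add const_add distrib_right sum.distrib)
  also have "\<dots> = substitute h p + substitute h q"
    using substitute_superset[of ?A p h] substitute_superset[of ?A q h] by simp
  finally show ?thesis .
qed

lemma substitute_sum: "substitute h (\<Sum>i\<in>A. p i) = (\<Sum>i\<in>A. substitute h (p i))"
  by (induction A rule: infinite_finite_induct) (simp_all add: substitute_0 substitute_add)

lemma substitute_diff: "substitute h (p - q) = substitute h p - substitute h q"
  using substitute_add[of h "p - q" q] by simp

lemma substitute_monom: "substitute h (monom m c) = const c * substitute_monomial h m"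
  using substitute_superset[of "{m}" "monom m c" h] by (simp split: if_splits)

lemma sum_of_monomials: "p = (\<Sum>m\<in>Poly_Mapping.keys p. monom m (lookup p m))"
  by (rule poly_mapping_eqI) (simp add: lookup_sum lookup_single when_def in_keys_iff)

lemma substitute_mult: "substitute h (p * q) = substitute h p * substitute h q"
proof -
  let ?P = "Poly_Mapping.keys p" and ?Q = "Poly_Mapping.keys q"
  have "p * q = (\<Sum>m\<in>?P. monom m (lookup p m)) * (\<Sum>m\<in>?Q. monom m (lookup q m))"
    using sum_of_monomials[of p] sum_of_monomials[of q] by simp
  also have "\<dots> = (\<Sum>m\<in>?P. \<Sum>m'\<in>?Q. monom (m + m') (lookup p m * lookup q m'))"
    by (simp add: sum_product mult_single)
  finally have "substitute h (p * q) = (\<Sum>m\<in>?P. \<Sum>m'\<in>?Q. const (lookup p m * lookup q m') * substitute_monomial h (m + m'))"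
    by (simp add: substitute_sum substitute_monom)
  also have "\<dots> = (\<Sum>m\<in>?P. \<Sum>m'\<in>?Q. (const (lookup p m) * substitute_monomial h m) * (const (lookup q m') * substitute_monomial h m'))"
    by (intro sum.cong refl) (simp only: const_mult substitute_monomial_add ac_simps)
  also have "\<dots> = substitute h p * substitute h q"
    unfolding substitute_def by (rule sum_product[symmetric])
  finally show ?thesis .
qed

lemma substitute_const: "substitute h (const c) = const c"
  unfolding const_def[of c] substitute_monom by (simp add: substitute_monomial_def)

lemma substitute_1: "substitute h 1 = 1"
  using substitute_const[of h 1] by (simp add: const_1)

lemma substitute_indet: "substitute h (indet v) = h v"
  by (simp add: indet_def substitute_monom const_1 substitute_monomial_def)

lemma substitute_power: "substitute h (p ^ k) = substitute h p ^ k"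
  by (induction k) (simp_all add: substitute_1 substitute_mult)

lemma substitute_prod: "substitute h (\<Prod>i\<in>A. p i) = (\<Prod>i\<in>A. substitute h (p i))"
  by (induction A rule: infinite_finite_induct) (simp_all add: substitute_1 substitute_mult)

lemma substitute_prod_list: "substitute h (prod_list (map f ks)) = prod_list (map (\<lambda>k. substitute h (f k)) ks)"
  by (induction ks) (simp_all add: substitute_1 substitute_mult)

lemma substitute_schur: "substitute h (schur N x l) = schur N (\<lambda>i. substitute h (x i)) l"
  by (simp add: schur_def substitute_sum substitute_prod)

lemma substitute_power_sum: "substitute h (power_sum N x k) = power_sum N (\<lambda>i. substitute h (x i)) k"
  by (simp add: power_sum_def substitute_sum substitute_power)

text \<open>Identify \<open>u\<^sub>i\<close> with \<open>v\<^sub>i\<close> for \<open>i \<ge> 1\<close> and set \<open>v\<^sub>0\<close> to \<open>0\<close>. The coefficient of \<open>\<Prod>i. u\<^sub>i ^ a i\<close> in the result is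
  the scalar product with \<open>h\<^bsub>a 0\<^esub>(U) * (\<Prod>i\<ge>1. h\<^bsub>a i\<^esub>(U + V))\<close>, the characteristic of the permutation character on the words with
  \<open>a i\<close> letters \<open>i\<close> up to sign.\<close>

definition merge_alphabets :: "uv_poly \<Rightarrow> uv_poly" where
  "merge_alphabets = substitute (case_sum varU (varU(0 := 0)))"

lemma merge_variables: "(\<lambda>i. merge_alphabets (varU i)) = varU" "(\<lambda>i. merge_alphabets (varV i)) = varU(0 := 0)"
  by (auto simp: merge_alphabets_def varU_def[of i for i] varV_def substitute_indet fun_eq_iff)

text \<open>A negative cycle only keeps the letter \<open>0\<close>, while on a positive cycle every letter \<open>i \<ge> 1\<close> counts twice,
  for \<open>i\<close> and for \<open>- i\<close>.\<close>

lemma merged_power_sum: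
  assumes "0 < j"
  shows "power_sum (Suc k) varU j - power_sum (Suc k) (varU(0 := 0)) j = varU 0 ^ j"
    "power_sum (Suc k) varU j + power_sum (Suc k) (varU(0 := 0)) j = varU 0 ^ j + 2 * (\<Sum>i\<in>{1..k}. varU i ^ j)"
proof -
  have "{..<Suc k} = insert 0 {1..k}" by auto
  then have "power_sum (Suc k) varU j = varU 0 ^ j + (\<Sum>i\<in>{1..k}. varU i ^ j)"
    "power_sum (Suc k) (varU(0 := 0)) j = (\<Sum>i\<in>{1..k}. varU i ^ j)"
    using assms by (simp_all add: power_sum_def zero_power)
  then show "power_sum (Suc k) varU j - power_sum (Suc k) (varU(0 := 0)) j = varU 0 ^ j"
    "power_sum (Suc k) varU j + power_sum (Suc k) (varU(0 := 0)) j = varU 0 ^ j + 2 * (\<Sum>i\<in>{1..k}. varU i ^ j)"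
    by simp_all
qed

lemma merged_power_sum_product:
  assumes p: "p \<in> hyperoct n"
  shows "merge_alphabets (power_sum_product (Suc k) (conj_class n p)) =
    (\<Sum>f\<in>fixed_words n p k. \<Prod>i\<in>{1..int n}. varU (nat \<bar>f i\<bar>))"
proof -
  let ?\<mu> = "conj_class n p"
  let ?N = "{C \<in> signed_cycles n p. odd (sign_changes p C)}" and ?P = "{C \<in> signed_cycles n p. even (sign_changes p C)}"
  let ?d = "\<lambda>j. varU 0 ^ j" and ?s = "\<lambda>j. varU 0 ^ j + 2 * (\<Sum>i\<in>{1..k}. varU i ^ j)"
  note cc = conj_class_properties[OF p]
  have fin: "finite ?N" "finite ?P" using finite_signed_cycles[of n p] by auto
  have ne: "finite C \<and> C \<noteq> {}" if "C \<in> signed_cycles n p" for C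
    using finite_signed_cycle[OF p that] signed_cycle_facts(1)[OF p that] by blast
  have pos: "0 < j" if "j \<in> set (quotient_minus ?\<mu>) \<or> j \<in> set (quotient_plus ?\<mu>)" for j
    using that two_quotient(1,2)[OF cc(1)] by (auto simp: partition_def intro: gr0I)
  have "merge_alphabets (power_sum_product (Suc k) ?\<mu>) =
    prod_list (map (\<lambda>j. power_sum (Suc k) varU j - power_sum (Suc k) (varU(0 := 0)) j) (quotient_minus ?\<mu>)) *
    prod_list (map (\<lambda>j. power_sum (Suc k) varU j + power_sum (Suc k) (varU(0 := 0)) j) (quotient_plus ?\<mu>))"
    unfolding power_sum_product_def merge_alphabets_def substitute_mult substitute_prod_list substitute_diff substitute_add substitute_power_sum
      merge_variables[unfolded merge_alphabets_def] ..
  also have "\<dots> = prod_list (map ?d (quotient_minus ?\<mu>)) * prod_list (map ?s (quotient_plus ?\<mu>))"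
    by (intro arg_cong2[of _ _ _ _ "(*)"] arg_cong[of _ _ prod_list] map_cong refl)
      (use merged_power_sum pos in auto)
  also have "\<dots> = (\<Prod>C\<in>?N. ?d (card C)) * (\<Prod>C\<in>?P. ?s (card C))"
    unfolding cc(2,3) negative_cycle_type_def positive_cycle_type_def
    by (intro arg_cong2[of _ _ _ _ "(*)"] cycle_lengths_properties(3)) (use fin ne in auto)
  also have "\<dots> = (\<Prod>C\<in>signed_cycles n p. if even (sign_changes p C) then ?s (card C) else ?d (card C))"
    unfolding prod.If_cases[OF finite_signed_cycles] by (simp add: Int_def Collect_neg_eq[symmetric] mult.commute)
  also have "\<dots> = (\<Sum>f\<in>fixed_words n p k. \<Prod>i\<in>{1..int n}. varU (nat \<bar>f i\<bar>))"
    by (rule fixed_words_generating_function(2)[OF p, symmetric])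
  finally show ?thesis .
qed

lemma merged_schur_expansion:
  assumes l: "l \<in> domino_partitions n"
  shows "merge_alphabets (const c * schur N varV (quotient_minus l) * schur N varU (quotient_plus l)) =
    (\<Sum>a\<in>compositions N n. monom (expo N (case_sum a (\<lambda>_. 0))) (c * of_nat (pair_kostka N (quotient_minus l, quotient_plus l) a)))"
proof -
  let ?s = "(quotient_minus l, quotient_plus l)"
  have s: "partition_pair ?s" "pair_size ?s = n"
    using two_quotient(1,2)[OF l] two_quotient_size[OF l] by (simp_all add: partition_pair_def pair_size_def)
  have m: "(\<Prod>i<N. varU i ^ a i) = monom (expo N (case_sum a (\<lambda>_. 0))) 1" for a
    unfolding prod_indet_power[symmetric] prod_variables by (simp add: varU_def)
  have "merge_alphabets (const c * schur N varV (quotient_minus l) * schur N varU (quotient_plus l)) =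
    const c * (schur N (varU(0 := 0)) (fst ?s) * schur N varU (snd ?s))"
    unfolding merge_alphabets_def substitute_mult substitute_const substitute_schur merge_variables[unfolded merge_alphabets_def]
    by (simp add: mult.assoc)
  also have "\<dots> = (\<Sum>a\<in>compositions N n. monom (expo N (case_sum a (\<lambda>_. 0))) (c * of_nat (pair_kostka N ?s a)))"
    unfolding pair_schur_expansion[OF s(1)] s(2) m of_nat_mult_monom sum_distrib_left const_mult_monom by simp
  finally show ?thesis .
qed

lemma sum_card_fibres:
  assumes "finite T" "finite P" "\<And>x. x \<in> T \<Longrightarrow> D x \<in> P"
  shows "(\<Sum>t\<in>P. card {x \<in> T. D x = t}) = card T"
  using sum.group[OF assms(1,2), of D "\<lambda>_. 1::nat"] assms(3) by (simp add: image_subset_iff)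

lemma block_sizes_composition:
  assumes "finite I"
  shows "block_sizes n I \<in> compositions (Suc (card I)) n"
proof -
  have le: "card {d \<in> I. d < i} \<le> card I" for i using assms by (intro card_mono) auto
  have "block_sizes n I j = 0" if "Suc (card I) \<le> j" for j
  proof -
    have "{i \<in> {1..n}. card {d \<in> I. d < i} = j} = {}" using le that by (auto simp: not_le dest: le_less_trans)
    then show ?thesis unfolding block_sizes_def by simp
  qed
  moreover have "(\<Sum>j<Suc (card I). block_sizes n I j) = card {1..n}"
    unfolding block_sizes_def
    by (rule sum_card_fibres) (use le in \<open>auto simp: less_Suc_eq_le\<close>)
  ultimately show ?thesis by (simp add: compositions_def)
qed

lemma lookup_word_monomial:
  assumes a: "\<And>j. N \<le> j \<Longrightarrow> a j = 0" and g: "\<And>i. i \<in> A \<Longrightarrow> g i < N" and A: "finite A"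
  shows "lookup (\<Prod>i\<in>A. varU (g i)) (expo N (case_sum a (\<lambda>_. 0))) = (if \<forall>j. card {i \<in> A. g i = j} = a j then 1 else 0)"
proof -
  let ?e = "\<Sum>i\<in>A. Poly_Mapping.single (Inl (g i)) (1::nat) :: (nat + nat) \<Rightarrow>\<^sub>0 nat"
  have le: "lookup ?e v = (case v of Inl j \<Rightarrow> card {i \<in> A. g i = j} | Inr _ \<Rightarrow> 0)" for v
    using A by (auto simp: lookup_sum lookup_single when_def sum.If_cases Int_def split: sum.splits)
  have "?e = expo N (case_sum a (\<lambda>_. 0)) \<longleftrightarrow> (\<forall>v. lookup ?e v = lookup (expo N (case_sum a (\<lambda>_. 0))) v)"
    by (metis poly_mapping_eqI)
  also have "\<dots> \<longleftrightarrow> (\<forall>j. card {i \<in> A. g i = j} = a j)"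
  proof
    assume L: "\<forall>v. lookup ?e v = lookup (expo N (case_sum a (\<lambda>_. 0))) v"
    show "\<forall>j. card {i \<in> A. g i = j} = a j"
    proof
      fix j show "card {i \<in> A. g i = j} = a j"
        using L[rule_format, of "Inl j"] a[of j] unfolding le lookup_expo by (auto split: if_splits)
    qed
  next
    assume R: "\<forall>j. card {i \<in> A. g i = j} = a j"
    show "\<forall>v. lookup ?e v = lookup (expo N (case_sum a (\<lambda>_. 0))) v"
    proof
      fix v show "lookup ?e v = lookup (expo N (case_sum a (\<lambda>_. 0))) v"
        unfolding le lookup_expo using R a by (cases v) (auto simp: not_less)
    qed
  qed
  finally have eq: "?e = expo N (case_sum a (\<lambda>_. 0)) \<longleftrightarrow> (\<forall>j. card {i \<in> A. g i = j} = a j)" .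
  have "(\<Prod>i\<in>A. varU (g i)) = monom ?e 1" unfolding varU_def indet_def by (rule prod_monom)
  then show ?thesis using eq by (simp add: lookup_single when_def)
qed

section \<open>Descent characters\<close>

text \<open>After merging the alphabets, the power sum side of the defining identity of the characters is the generating
  function of fixed words, and the Schur side that of pairs of tableaux. Compare the coefficients at the
  block sizes of \<open>I\<close>.\<close>

lemma fixed_words_eq_character_sum:
  assumes p: "p \<in> hyperoct n" and I: "I \<subseteq> {..<n}"
  shows "of_nat (card {f \<in> words n I. f \<circ> p = f}) = (\<Sum>l\<in>domino_partitions n. irr_character n l p *
      of_nat (pair_kostka (Suc (card I)) (quotient_minus l, quotient_plus l) (block_sizes n I)))"
proof -
  let ?N = "Suc (card I)" and ?\<mu> = "conj_class n p" and ?a = "block_sizes n I" and ?P = "domino_partitions n"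
  let ?E = "expo ?N (case_sum ?a (\<lambda>_. 0))"
  let ?k = "\<lambda>l a. pair_kostka ?N (quotient_minus l, quotient_plus l) a"
  have fI: "finite I" using I finite_subset by blast
  note ac = block_sizes_composition[OF fI, of n]
  have "power_sum_product ?N ?\<mu> =
    (\<Sum>l\<in>?P. const (character_value n l ?\<mu>) * schur ?N varV (quotient_minus l) * schur ?N varU (quotient_plus l))"
    using character_value_table[of n] conj_class_properties(1)[OF p] unfolding is_character_table_def by blast
  then have "merge_alphabets (power_sum_product ?N ?\<mu>) =
    (\<Sum>l\<in>?P. merge_alphabets (const (character_value n l ?\<mu>) * schur ?N varV (quotient_minus l) * schur ?N varU (quotient_plus l)))"
    unfolding merge_alphabets_def by (simp add: substitute_sum)
  also have "\<dots> = (\<Sum>l\<in>?P. \<Sum>a\<in>compositions ?N n. monom (expo ?N (case_sum a (\<lambda>_. 0))) (irr_character n l p * of_nat (?k l a)))"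
    by (intro sum.cong refl) (simp add: merged_schur_expansion irr_character_def)
  finally have eq: "(\<Sum>f\<in>fixed_words n p (card I). \<Prod>i\<in>{1..int n}. varU (nat \<bar>f i\<bar>)) =
    (\<Sum>l\<in>?P. \<Sum>a\<in>compositions ?N n. monom (expo ?N (case_sum a (\<lambda>_. 0))) (irr_character n l p * of_nat (?k l a)))"
    unfolding merged_power_sum_product[OF p] .
  have "lookup (\<Sum>f\<in>fixed_words n p (card I). \<Prod>i\<in>{1..int n}. varU (nat \<bar>f i\<bar>)) ?E =
    (\<Sum>f\<in>fixed_words n p (card I). if \<forall>j. card {i \<in> {1..int n}. nat \<bar>f i\<bar> = j} = ?a j then 1 else 0)"
    unfolding lookup_sum
  proof (rule sum.cong[OF refl], rule lookup_word_monomial)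
    fix f i assume f: "f \<in> fixed_words n p (card I)"
    then have "\<bar>f i\<bar> \<le> int (card I)" by (auto simp: fixed_words_def)
    then show "nat \<bar>f i\<bar> < ?N" by (simp add: nat_less_iff)
  qed (use ac in \<open>auto simp: compositions_def\<close>)
  also have "\<dots> = of_nat (card {f \<in> fixed_words n p (card I). \<forall>j. card {i \<in> {1..int n}. nat \<bar>f i\<bar> = j} = ?a j})"
    by (simp add: sum.If_cases[OF fixed_words_generating_function(1)[OF p]] Int_def)
  also have "\<dots> = of_nat (card {f \<in> words n I. f \<circ> p = f})"
    unfolding words_fixed_eq[OF I] ..
  finally have L: "lookup (\<Sum>f\<in>fixed_words n p (card I). \<Prod>i\<in>{1..int n}. varU (nat \<bar>f i\<bar>)) ?E =
    of_nat (card {f \<in> words n I. f \<circ> p = f})" .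
  have ex: "case_sum a (\<lambda>_. 0) \<in> exponents ?N n" if "a \<in> compositions ?N n" for a
  proof -
    have "case_sum a (\<lambda>_. 0) v = 0" if "v \<notin> variables ?N" for v
      using that \<open>a \<in> compositions ?N n\<close> by (cases v) (auto simp: compositions_def)
    then show ?thesis using that by (simp add: exponents_def sum_variables compositions_def)
  qed
  have inj: "expo ?N (case_sum a (\<lambda>_. 0)) = ?E \<longleftrightarrow> a = ?a" if "a \<in> compositions ?N n" for a
  proof
    assume "expo ?N (case_sum a (\<lambda>_. 0)) = ?E"
    then have eq: "case_sum a (\<lambda>_ :: nat. 0) = case_sum ?a (\<lambda>_. 0)" by (rule expo_inject[OF ex[OF that] ex[OF ac]])
    show "a = ?a"
    proof
      fix j show "a j = ?a j" using fun_cong[OF eq, of "Inl j"] by simp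
    qed
  qed simp
  have "lookup (\<Sum>l\<in>?P. \<Sum>a\<in>compositions ?N n. monom (expo ?N (case_sum a (\<lambda>_. 0))) (irr_character n l p * of_nat (?k l a))) ?E =
    (\<Sum>l\<in>?P. \<Sum>a\<in>compositions ?N n. if a = ?a then irr_character n l p * of_nat (?k l a) else 0)"
    unfolding lookup_sum by (intro sum.cong refl) (simp add: lookup_single when_def inj)
  also have "\<dots> = (\<Sum>l\<in>?P. irr_character n l p * of_nat (?k l ?a))"
    using ac by (simp add: finite_compositions)
  finally show ?thesis using L unfolding eq by simp
qed

lemma finite_standard_domino_tableaux: "finite (standard_domino_tableaux n l)"
  by (rule finite_subset[of _ "diagram l \<rightarrow>\<^sub>E {1..n}"])
    (auto simp: standard_domino_tableaux_def intro!: finite_PiE finite_diagram)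

lemma sum_domino_descent_count:
  assumes l: "l \<in> domino_partitions n" and I: "I \<subseteq> {..<n}"
  shows "(\<Sum>A\<in>Pow I. domino_descent_count n l A) =
    pair_kostka (Suc (card I)) (quotient_minus l, quotient_plus l) (block_sizes n I)"
proof -
  let ?s = "(quotient_minus l, quotient_plus l)"
  let ?T = "{T \<in> standard_domino_tableaux n l. domino_descents n l T \<subseteq> I}"
  have fI: "finite I" using I finite_subset by blast
  have "(\<Sum>A\<in>Pow I. domino_descent_count n l A) = (\<Sum>A\<in>Pow I. card {T \<in> ?T. domino_descents n l T = A})"
    unfolding domino_descent_count_def by (intro sum.cong refl arg_cong[of _ _ card]) auto
  also have "\<dots> = card ?T"
    by (rule sum_card_fibres) (use fI in \<open>auto intro: finite_subset[OF _ finite_standard_domino_tableaux[of n l]]\<close>)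
  also have "\<dots> = card {bs \<in> move_lists n (maya l). move_descents bs \<subseteq> I}"
    by (rule card_tableaux_eq_card_moves[OF l])
  also have "maya l = double_maya ?s"
    by (rule halves_eqI) (simp_all add: half_double_maya two_quotient[OF l])
  also have "card {bs \<in> move_lists n (double_maya ?s). move_descents bs \<subseteq> I} = pair_kostka (Suc (card I)) ?s (block_sizes n I)"
    by (rule card_moves_eq_pair_kostka[OF fI I]) (use two_quotient(1,2)[OF l] in \<open>simp add: partition_pair_def\<close>)
  finally show ?thesis .
qed

text \<open>The value at \<open>p\<close> of the class function that the descent set \<open>I\<close> contributes to the right hand side of the
  theorem.\<close>

definition descent_character :: "nat \<Rightarrow> nat set \<Rightarrow> (int \<Rightarrow> int) \<Rightarrow> complex" where
  "descent_character n I p = (\<Sum>l\<in>domino_partitions n. irr_character n l p * of_nat (domino_descent_count n l I))"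

text \<open>The sum over all subsets of \<open>I\<close> is the permutation character on words.\<close>

lemma sum_descent_character:
  assumes "p \<in> hyperoct n" "I \<subseteq> {..<n}"
  shows "(\<Sum>A\<in>Pow I. descent_character n A p) = of_nat (card {f \<in> words n I. f \<circ> p = f})"
proof -
  have "(\<Sum>A\<in>Pow I. descent_character n A p) =
    (\<Sum>l\<in>domino_partitions n. irr_character n l p * of_nat (\<Sum>A\<in>Pow I. domino_descent_count n l A))"
    unfolding descent_character_def by (subst sum.swap) (simp add: sum_distrib_left)
  also have "\<dots> = of_nat (card {f \<in> words n I. f \<circ> p = f})"
    unfolding fixed_words_eq_character_sum[OF assms]
    by (intro sum.cong refl) (simp add: sum_domino_descent_count[OF _ assms(2)])
  finally show ?thesis .
qed

lemma sum_product3: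
  fixes f g h :: "'s \<Rightarrow> 'a::comm_ring_1"
  shows "(\<Sum>a\<in>A. f a) * (\<Sum>b\<in>B. g b) * (\<Sum>c\<in>C. h c) = (\<Sum>a\<in>A. \<Sum>b\<in>B. \<Sum>c\<in>C. f a * g b * h c)"
  by (simp only: sum_distrib_left[symmetric] sum_distrib_right[symmetric])

lemma kronecker_sum_eq:
  "(\<Sum>lam\<in>domino_partitions n. \<Sum>\<mu>\<in>domino_partitions n. \<Sum>\<nu>\<in>domino_partitions n.
       kroneckerB n lam \<mu> \<nu> * of_nat (domino_descent_count n lam I) *
         of_nat (domino_descent_count n \<mu> J) * of_nat (domino_descent_count n \<nu> K)) =
   1 / of_nat (card (hyperoct n)) *
     (\<Sum>p\<in>hyperoct n. descent_character n I p * descent_character n J p * descent_character n K p)"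
proof -
  let ?P = "domino_partitions n" and ?H = "hyperoct n"
  let ?d = "\<lambda>l A. of_nat (domino_descent_count n l A) :: complex" and ?x = "irr_character n"
  have "(\<Sum>p\<in>?H. descent_character n I p * descent_character n J p * descent_character n K p) =
    (\<Sum>p\<in>?H. \<Sum>a\<in>?P. \<Sum>b\<in>?P. \<Sum>c\<in>?P. (?x a p * ?x b p * ?x c p) * (?d a I * ?d b J * ?d c K))"
    unfolding descent_character_def sum_product3
    by (intro sum.cong refl) (simp only: ac_simps)
  also have "\<dots> = (\<Sum>a\<in>?P. \<Sum>p\<in>?H. \<Sum>b\<in>?P. \<Sum>c\<in>?P. (?x a p * ?x b p * ?x c p) * (?d a I * ?d b J * ?d c K))"
    by (rule sum.swap)
  also have "\<dots> = (\<Sum>a\<in>?P. \<Sum>b\<in>?P. \<Sum>p\<in>?H. \<Sum>c\<in>?P. (?x a p * ?x b p * ?x c p) * (?d a I * ?d b J * ?d c K))"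
    by (rule sum.cong[OF refl], rule sum.swap)
  also have "\<dots> = (\<Sum>a\<in>?P. \<Sum>b\<in>?P. \<Sum>c\<in>?P. \<Sum>p\<in>?H. (?x a p * ?x b p * ?x c p) * (?d a I * ?d b J * ?d c K))"
    by (rule sum.cong[OF refl], rule sum.cong[OF refl], rule sum.swap)
  finally have E: "(\<Sum>p\<in>?H. descent_character n I p * descent_character n J p * descent_character n K p) =
    (\<Sum>a\<in>?P. \<Sum>b\<in>?P. \<Sum>c\<in>?P. \<Sum>p\<in>?H. (?x a p * ?x b p * ?x c p) * (?d a I * ?d b J * ?d c K))" .
  have "kroneckerB n a b c * ?d a I * ?d b J * ?d c K =
    1 / of_nat (card ?H) * (\<Sum>p\<in>?H. (?x a p * ?x b p * ?x c p) * (?d a I * ?d b J * ?d c K))" for a b c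
    unfolding kroneckerB_def sum_distrib_right[symmetric] by (simp only: mult.assoc)
  then show ?thesis unfolding E by (simp only: sum_distrib_left)
qed

text \<open>Moebius inversion on the lattice of subsets.\<close>

lemma eq_if_sums_over_subsets_eq:
  fixes F G :: "nat set \<Rightarrow> 'a::ab_group_add"
  assumes "finite S" and "\<And>I. I \<subseteq> S \<Longrightarrow> (\<Sum>A\<in>Pow I. F A) = (\<Sum>A\<in>Pow I. G A)" and "I \<subseteq> S"
  shows "F I = G I"
  using finite_subset[OF assms(3,1)] assms(3)
proof (induction I rule: finite_psubset_induct)
  case (psubset I)
  have fin: "finite (Pow I)" using psubset.hyps by simp
  have "(\<Sum>A\<in>Pow I - {I}. F A) = (\<Sum>A\<in>Pow I - {I}. G A)"
    using psubset.IH psubset.prems by (intro sum.cong refl) blast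
  moreover have "(\<Sum>A\<in>Pow I. h A) = h I + (\<Sum>A\<in>Pow I - {I}. h A)" for h :: "nat set \<Rightarrow> 'a"
    by (rule sum.remove[OF fin]) simp
  ultimately show ?case using assms(2)[OF psubset.prems] by simp
qed

lemma sum_card_descent_triples:
  assumes "finite I" "finite J" "finite K"
  shows "(\<Sum>A\<in>Pow I. \<Sum>B\<in>Pow J. \<Sum>C\<in>Pow K. card (descent_triples n A B C)) =
    card {(p1, p2, p3). p1 \<in> hyperoct n \<and> p2 \<in> hyperoct n \<and> p3 \<in> hyperoct n \<and>
      descents n p1 \<subseteq> I \<and> descents n p2 \<subseteq> J \<and> descents n p3 \<subseteq> K \<and> p1 \<circ> p2 \<circ> p3 = id}"
    (is "_ = card ?T")
proof -
  let ?D = "\<lambda>(p1, p2, p3). (descents n p1, descents n p2, descents n p3)"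
  have fin: "finite ?T"
    by (rule finite_subset[of _ "hyperoct n \<times> hyperoct n \<times> hyperoct n"]) (auto simp: finite_hyperoct)
  have "(\<Sum>A\<in>Pow I. \<Sum>B\<in>Pow J. \<Sum>C\<in>Pow K. card (descent_triples n A B C)) =
    (\<Sum>(A, B, C)\<in>Pow I \<times> Pow J \<times> Pow K. card (descent_triples n A B C))"
    by (simp add: sum.cartesian_product)
  also have "\<dots> = (\<Sum>t\<in>Pow I \<times> Pow J \<times> Pow K. card {x \<in> ?T. ?D x = t})"
  proof (intro sum.cong refl)
    fix t assume "t \<in> Pow I \<times> Pow J \<times> Pow K"
    then obtain A B C where t: "t = (A, B, C)" "A \<subseteq> I" "B \<subseteq> J" "C \<subseteq> K" by blast
    have "descent_triples n A B C = {x \<in> ?T. ?D x = t}"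
      unfolding descent_triples_def t(1) using t(2-4) by auto
    then show "(case t of (A, B, C) \<Rightarrow> card (descent_triples n A B C)) = card {x \<in> ?T. ?D x = t}"
      by (simp add: t(1))
  qed
  also have "\<dots> = card ?T"
    by (rule sum_card_fibres) (use fin assms in auto)
  finally show ?thesis .
qed

theorem theorem4:
  fixes n :: nat and I J K :: "nat set"
  assumes "n \<ge> 1"
    and "I \<subseteq> {0} \<union> {1..n - 1}" and "J \<subseteq> {0} \<union> {1..n - 1}" and "K \<subseteq> {0} \<union> {1..n - 1}"
  shows "(of_nat (card (descent_triples n I J K)) :: complex) =
    (\<Sum>lam\<in>domino_partitions n. \<Sum>\<mu>\<in>domino_partitions n. \<Sum>\<nu>\<in>domino_partitions n.
       kroneckerB n lam \<mu> \<nu> * of_nat (domino_descent_count n lam I) *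
         of_nat (domino_descent_count n \<mu> J) * of_nat (domino_descent_count n \<nu> K))"
proof -
  let ?S = "{..<n}" and ?H = "hyperoct n"
  have S: "{0} \<union> {1..n - 1} \<subseteq> ?S" using assms(1) by auto
  define F where "F A B C = (of_nat (card (descent_triples n A B C)) :: complex)" for A B C
  define G where "G A B C = 1 / of_nat (card ?H) *
    (\<Sum>p\<in>?H. descent_character n A p * descent_character n B p * descent_character n C p)" for A B C
  have cH: "(of_nat (card ?H) :: complex) \<noteq> 0"
    using finite_hyperoct[of n] hyperoct_id[of n] by (simp add: card_gt_0_iff) blast
  have main: "(\<Sum>A\<in>Pow I. \<Sum>B\<in>Pow J. \<Sum>C\<in>Pow K. F A B C) = (\<Sum>A\<in>Pow I. \<Sum>B\<in>Pow J. \<Sum>C\<in>Pow K. G A B C)"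
    if I: "I \<subseteq> ?S" and J: "J \<subseteq> ?S" and K: "K \<subseteq> ?S" for I J K
  proof -
    have fin: "finite I" "finite J" "finite K" using I J K by (auto intro: finite_subset)
    let ?fix = "\<lambda>A p. card {f \<in> words n A. f \<circ> p = f}"
    have "(\<Sum>A\<in>Pow I. \<Sum>B\<in>Pow J. \<Sum>C\<in>Pow K. G A B C) = 1 / of_nat (card ?H) *
      (\<Sum>A\<in>Pow I. \<Sum>B\<in>Pow J. \<Sum>C\<in>Pow K. \<Sum>p\<in>?H. descent_character n A p * descent_character n B p * descent_character n C p)"
      unfolding G_def by (simp only: sum_distrib_left)
    also have "(\<Sum>A\<in>Pow I. \<Sum>B\<in>Pow J. \<Sum>C\<in>Pow K. \<Sum>p\<in>?H. descent_character n A p * descent_character n B p * descent_character n C p) =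
      (\<Sum>A\<in>Pow I. \<Sum>B\<in>Pow J. \<Sum>p\<in>?H. \<Sum>C\<in>Pow K. descent_character n A p * descent_character n B p * descent_character n C p)"
      by (rule sum.cong[OF refl], rule sum.cong[OF refl], rule sum.swap)
    also have "\<dots> = (\<Sum>A\<in>Pow I. \<Sum>p\<in>?H. \<Sum>B\<in>Pow J. \<Sum>C\<in>Pow K. descent_character n A p * descent_character n B p * descent_character n C p)"
      by (rule sum.cong[OF refl], rule sum.swap)
    also have "\<dots> = (\<Sum>p\<in>?H. \<Sum>A\<in>Pow I. \<Sum>B\<in>Pow J. \<Sum>C\<in>Pow K. descent_character n A p * descent_character n B p * descent_character n C p)"
      by (rule sum.swap)
    also have "\<dots> = (\<Sum>p\<in>?H. (\<Sum>A\<in>Pow I. descent_character n A p) * (\<Sum>B\<in>Pow J. descent_character n B p) * (\<Sum>C\<in>Pow K. descent_character n C p))"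
      by (simp only: sum_product3)
    also have "\<dots> = (\<Sum>p\<in>?H. of_nat (?fix I p * ?fix J p * ?fix K p))"
      by (intro sum.cong refl) (simp add: sum_descent_character I J K)
    also have "\<dots> = of_nat (\<Sum>p\<in>?H. ?fix I p * ?fix J p * ?fix K p)" by simp
    also have "\<dots> = of_nat (card ?H) * of_nat (\<Sum>A\<in>Pow I. \<Sum>B\<in>Pow J. \<Sum>C\<in>Pow K. card (descent_triples n A B C))"
      unfolding sum_fixed_triples_eq_sorted_triples[OF I J K] card_sorted_triples[OF I J K]
        sum_card_descent_triples[OF fin] by simp
    also have "1 / of_nat (card ?H) * \<dots> = of_nat (\<Sum>A\<in>Pow I. \<Sum>B\<in>Pow J. \<Sum>C\<in>Pow K. card (descent_triples n A B C))"
      using cH by simp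
    finally show ?thesis by (simp add: F_def)
  qed
  have fS: "finite ?S" by simp
  have "(\<Sum>B\<in>Pow J. \<Sum>C\<in>Pow K. F I B C) = (\<Sum>B\<in>Pow J. \<Sum>C\<in>Pow K. G I B C)"
    if "I \<subseteq> ?S" "J \<subseteq> ?S" "K \<subseteq> ?S" for I J K
    by (rule eq_if_sums_over_subsets_eq[OF fS main[OF _ that(2,3)] that(1)])
  then have "(\<Sum>C\<in>Pow K. F I J C) = (\<Sum>C\<in>Pow K. G I J C)"
    if "I \<subseteq> ?S" "J \<subseteq> ?S" "K \<subseteq> ?S" for I J K
    by (rule eq_if_sums_over_subsets_eq[OF fS _ that(2), of "\<lambda>B. \<Sum>C\<in>Pow K. F I B C" "\<lambda>B. \<Sum>C\<in>Pow K. G I B C"])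
      (use that in auto)
  then have "F I J K = G I J K" if "I \<subseteq> ?S" "J \<subseteq> ?S" "K \<subseteq> ?S" for I J K
    by (rule eq_if_sums_over_subsets_eq[OF fS _ that(3), of "F I J" "G I J"]) (use that in auto)
  from this[OF subset_trans[OF assms(2) S] subset_trans[OF assms(3) S] subset_trans[OF assms(4) S]]
  show ?thesis unfolding F_def G_def kronecker_sum_eq .
qed

end
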